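(* Let $k\{Y\}=k\{y_1,\ldots,y_l\}$ be a ring of differential polynomials over a differential field $k$ of characteristic zero, with a fixed ranking. Let $\mathbb{C}=C_1,\ldots,C_p$ be a characteristic set of a characterizable differential ideal $I$ with $I=[\mathbb{C}]:H_{\mathbb{C}}^\infty$. Let $L$ be the set of leaders of $\mathbb{C}$, $N=\Theta Y\setminus\Theta L$, and write $C_i=I_{C_i}u_{C_i}^{n_i}+a_{1,i}u_{C_i}^{n_i-1}+\ldots+a_{n_i,i}$. Perform the following algorithm, in which $\mathbb{C}(i)=C_1,\ldots,C_i$ (with the current, updated values) and $I_{C_i},a_{j,i}$ always denote the coefficients of the current $C_i$: (a) for $i$ from $2$ to $p$: let $I_i'$ be an inverse of $I_{C_i}$ with respect to $\mathbb{C}(i-1)$; replace $C_i$ by $I_i'C_i$; then replace $C_i$ by its pseudo-remainder with respect to $\mathbb{C}(i-1)$; (b) for $i$ from $1$ to $p$: replace $C_i$ by $C_i/\gcd(I_{C_i},a_{1,i},\ldots,a_{n_i,i})$, the gcd being taken in $k[N][L]$; then divide $C_i$ by its leading coefficient from $k$ (so that its initial has leading coefficient $1$). Then this algorithm is correct: the resulting set $\mathbb{C}$ is the canonical characteristic set of $I$.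
   Context: $\Delta=\{\delta_1,\ldots,\delta_n\}$ is a finite set of commuting derivations, $\Theta$ the free commutative monoid of derivative operators $\delta_1^{k_1}\cdots\delta_n^{k_n}$. $k\{Y\}$ is the polynomial ring over $k$ in the differential variables $\Theta Y=\{\theta y_j\}$. $(F)$ is the ideal and $[F]$ the differential ideal generated by $F$. A ranking is a total order on $\Theta Y$ such that $\theta u\geq u$ and ($u\geq v\Rightarrow\theta u\geq\theta v$). The leader $u_f$ of $f\notin k$ is the highest differential variable in $f$; if $d=\deg_{u_f}f$, the initial $I_f$ is the coefficient of $u_f^d$, the separant is $S_f=\partial f/\partial u_f$, and the rank is $u_f^d$. Ranks are compared by $u^{d}>v^{e}$ iff $u>v$, or $u=v$ and $d>e$. $f$ is reduced with respect to $g$ if no proper derivative of $u_g$ appears in $f$ and $\deg_{u_g}f<\deg_{u_g}g$. A set $\mathbb{A}\subset k\{Y\}\setminus k$ is autoreduced if each element is reduced with respect to all the others; such sets are finite and written in order of increasing rank. $\mathbb{A}=A_1,\ldots,A_r$ has lower rank than $\mathbb{B}=B_1,\ldots,B_s$ if there is $j\le r,s$ with $\operatorname{rank}A_i=\operatorname{rank}B_i$ for $i<j$ and $\operatorname{rank}A_j<\operatorname{rank}B_j$, or if $r>s$ and $\operatorname{rank}A_i=\operatorname{rank}B_i$ for $1\le i\le s$. A characteristic set of an ideal is an autoreduced subset of it of lowest rank. $H_{\mathbb{A}}$ is the product of the initials and separants of the elements of $\mathbb{A}$, and $J:H_{\mathbb{A}}^\infty=\{a : H_{\mathbb{A}}^m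 a\in J\text{ for some }m\geq0\}$. A differential ideal $I$ is characterizable if $I=[\mathbb{A}]:H_{\mathbb{A}}^\infty$ for some characteristic set $\mathbb{A}$ of $I$. Inverse: for a polynomial $f\in k[N][L]$ and $\mathbb{C}(i-1)$, an inverse of $f$ is a polynomial $g$, involving only the differential variables occurring in $f$ and $\mathbb{C}(i-1)$, such that $fg\equiv h \bmod (\mathbb{C}(i-1))$ in $k(N)[L]$ for some nonzero $h\in k[N]$. (For a characteristic set of a characterizable ideal $I$ with $I=[\mathbb{C}]:H_{\mathbb{C}}^\infty$ the initials are known to be invertible in this sense.) Pseudo-remainder with respect to $\mathbb{C}(i-1)$: the result of successive algebraic pseudo-divisions by $C_{i-1},\ldots,C_1$ with respect to their leaders, multiplying by initials where needed; it is reduced with respect to $\mathbb{C}(i-1)$. $>_{\rm lex}$ is the lexicographic order on power products of differential variables induced by the ranking. A characteristic set $\mathbb{C}=C_1,\ldots,C_p$ of a characterizable ideal $I$, with leaders $L$ and non-leaders $N=\Theta Y\setminus\Theta L$, is canonical if (1) $I_{C_i}\in k[N]$ for all $i$; (2) for each $i$, $C_i$ has no factors in $k[N]$ (other than constants of $k$), and the coefficient in $I_{C_i}$ of its leading monomial with respect to $>_{\rm lex}$ equals $1$. The canonical characteristic set of $I$ exists and is unique. *)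

theory Defs
  imports
    "HOL-Library.Poly_Mapping"
    "HOL-Library.Product_Lexorder"
    "HOL-Computational_Algebra.Fraction_Field"
begin

section \<open>Differential polynomials\<close>

text \<open>
  The differential indeterminates $y_1,\dots,y_l$ are indexed by a type \<open>'y\<close>, the derivations
  $\delta_1,\dots,\delta_n$ by a type \<open>'d\<close>, both of sort \<open>{finite, linorder}\<close>. The derivative
  operator $\delta_1^{k_1}\cdots\delta_n^{k_n}$ is its exponent vector (so composition is addition
  and the identity is \<open>0\<close>), and the pair \<open>(j, \<tau>)\<close> is the differential variable $\tau y_j$.
  The orders on \<open>'y\<close> and \<open>'d\<close> are unrelated to the ranking: they only serve to make the
  library's \<open>idom\<close> instance for polynomial mappings, and hence the type \<open>fract\<close>, available.
\<close>

type_synonym ('y, 'd) dvar = "'y \<times> ('d \<Rightarrow>\<^sub>0 nat)"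
type_synonym ('y, 'd) dmon = "('y, 'd) dvar \<Rightarrow>\<^sub>0 nat"
type_synonym ('y, 'd, 'a) dpoly = "('y, 'd) dmon \<Rightarrow>\<^sub>0 'a"

locale differential_field =
  fixes der :: "'d \<Rightarrow> 'a::field_char_0 \<Rightarrow> 'a"
  assumes der_add: "der i (a + b) = der i a + der i b"
    and der_mult: "der i (a * b) = der i a * b + a * der i b"
    and der_commute: "der i (der j a) = der j (der i a)"

definition dapply :: "('d \<Rightarrow>\<^sub>0 nat) \<Rightarrow> ('y, 'd) dvar \<Rightarrow> ('y, 'd) dvar" where
  "dapply \<theta> v = (fst v, \<theta> + snd v)"

definition derivs :: "('y, 'd) dvar set \<Rightarrow> ('y, 'd) dvar set" where
  "derivs U = {dapply \<theta> u | \<theta> u. u \<in> U}"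

definition const :: "'a::zero \<Rightarrow> ('y, 'd, 'a) dpoly" where
  "const c = Poly_Mapping.single 0 c"

definition var :: "('y, 'd) dvar \<Rightarrow> ('y, 'd, 'a::zero_neq_one) dpoly" where
  "var v = Poly_Mapping.single (Poly_Mapping.single v 1) 1"

definition vars :: "('y, 'd, 'a::zero) dpoly \<Rightarrow> ('y, 'd) dvar set" where
  "vars p = (\<Union>m\<in>Poly_Mapping.keys p. Poly_Mapping.keys m)"

text \<open>The polynomial subring $k[V]$, for a set \<open>V\<close> of differential variables.\<close>

definition polys :: "('y, 'd) dvar set \<Rightarrow> ('y, 'd, 'a::zero) dpoly set" where
  "polys V = {p. vars p \<subseteq> V}"

definition deg_in :: "('y, 'd) dvar \<Rightarrow> ('y, 'd, 'a::zero) dpoly \<Rightarrow> nat" where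
  "deg_in v p = Max (insert 0 ((\<lambda>m. Poly_Mapping.lookup m v) ` Poly_Mapping.keys p))"

text \<open>The coefficient of $v^j$ in \<open>p\<close>, as a polynomial in the other variables.\<close>

definition coeff_in :: "('y, 'd) dvar \<Rightarrow> nat \<Rightarrow> ('y, 'd, 'a::comm_monoid_add) dpoly
    \<Rightarrow> ('y, 'd, 'a) dpoly" where
  "coeff_in v j p =
     (\<Sum>m | m \<in> Poly_Mapping.keys p \<and> Poly_Mapping.lookup m v = j.
        Poly_Mapping.single (m - Poly_Mapping.single v j) (Poly_Mapping.lookup p m))"

definition pdiff :: "('y, 'd) dvar \<Rightarrow> ('y, 'd, 'a::comm_semiring_1) dpoly
    \<Rightarrow> ('y, 'd, 'a) dpoly" where
  "pdiff v p =
     (\<Sum>m\<in>Poly_Mapping.keys p.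
        Poly_Mapping.single (m - Poly_Mapping.single v 1)
          (of_nat (Poly_Mapping.lookup m v) * Poly_Mapping.lookup p m))"

text \<open>
  The derivation of $k\{Y\}$ extending \<open>der i\<close>: apply \<open>der i\<close> to the coefficients and add
  $\sum_v (\partial p/\partial v)\,\delta_i v$.
\<close>

definition dder :: "('d \<Rightarrow> 'a \<Rightarrow> 'a) \<Rightarrow> 'd \<Rightarrow> ('y, 'd, 'a::comm_ring_1) dpoly
    \<Rightarrow> ('y, 'd, 'a) dpoly" where
  "dder der i p =
     Poly_Mapping.map (der i) p
       + (\<Sum>v\<in>vars p. pdiff v p * var (dapply (Poly_Mapping.single i 1) v))"


section \<open>Ideals\<close>

definition is_ideal :: "'r::comm_ring_1 set \<Rightarrow> bool" where
  "is_ideal J \<longleftrightarrow>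
     0 \<in> J \<and> (\<forall>a\<in>J. \<forall>b\<in>J. a + b \<in> J) \<and> (\<forall>r. \<forall>a\<in>J. r * a \<in> J)"

definition is_diff_ideal :: "('d \<Rightarrow> 'a \<Rightarrow> 'a) \<Rightarrow> ('y, 'd, 'a::comm_ring_1) dpoly set \<Rightarrow> bool" where
  "is_diff_ideal der J \<longleftrightarrow> is_ideal J \<and> (\<forall>i. \<forall>a\<in>J. dder der i a \<in> J)"

definition diff_ideal_gen :: "('d \<Rightarrow> 'a \<Rightarrow> 'a) \<Rightarrow> ('y, 'd, 'a::comm_ring_1) dpoly set
    \<Rightarrow> ('y, 'd, 'a) dpoly set" where
  "diff_ideal_gen der F = \<Inter>{J. is_diff_ideal der J \<and> F \<subseteq> J}"

definition saturation :: "'r::comm_ring_1 set \<Rightarrow> 'r \<Rightarrow> 'r set" where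
  "saturation J h = {a. \<exists>m::nat. h ^ m * a \<in> J}"


section \<open>Rankings, leaders and reduction\<close>

locale ranking =
  fixes le :: "('y, 'd) dvar \<Rightarrow> ('y, 'd) dvar \<Rightarrow> bool"
  assumes le_linear_order: "linear_order {(u, v). le u v}"
    and le_dapply: "le u (dapply \<theta> u)"
    and le_mono: "le v u \<Longrightarrow> le (dapply \<theta> v) (dapply \<theta> u)"

text \<open>The notions below are meaningful for a ranking \<open>le\<close>; those referring to the leader of a
  polynomial moreover presuppose that it is not a constant.\<close>

definition leader :: "(('y, 'd) dvar \<Rightarrow> ('y, 'd) dvar \<Rightarrow> bool) \<Rightarrow> ('y, 'd, 'a::zero) dpoly
    \<Rightarrow> ('y, 'd) dvar" where
  "leader le f = (THE u. u \<in> vars f \<and> (\<forall>v\<in>vars f. le v u))"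

definition ldeg :: "(('y, 'd) dvar \<Rightarrow> ('y, 'd) dvar \<Rightarrow> bool) \<Rightarrow> ('y, 'd, 'a::zero) dpoly
    \<Rightarrow> nat" where
  "ldeg le f = deg_in (leader le f) f"

definition initial :: "(('y, 'd) dvar \<Rightarrow> ('y, 'd) dvar \<Rightarrow> bool)
    \<Rightarrow> ('y, 'd, 'a::comm_monoid_add) dpoly \<Rightarrow> ('y, 'd, 'a) dpoly" where
  "initial le f = coeff_in (leader le f) (ldeg le f) f"

definition separant :: "(('y, 'd) dvar \<Rightarrow> ('y, 'd) dvar \<Rightarrow> bool)
    \<Rightarrow> ('y, 'd, 'a::comm_semiring_1) dpoly \<Rightarrow> ('y, 'd, 'a) dpoly" where
  "separant le f = pdiff (leader le f) f"

definition same_rank :: "(('y, 'd) dvar \<Rightarrow> ('y, 'd) dvar \<Rightarrow> bool)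
    \<Rightarrow> ('y, 'd, 'a::zero) dpoly \<Rightarrow> ('y, 'd, 'a) dpoly \<Rightarrow> bool" where
  "same_rank le f g \<longleftrightarrow> leader le f = leader le g \<and> ldeg le f = ldeg le g"

definition rank_less :: "(('y, 'd) dvar \<Rightarrow> ('y, 'd) dvar \<Rightarrow> bool)
    \<Rightarrow> ('y, 'd, 'a::zero) dpoly \<Rightarrow> ('y, 'd, 'a) dpoly \<Rightarrow> bool" where
  "rank_less le f g \<longleftrightarrow>
     (le (leader le f) (leader le g) \<and> leader le f \<noteq> leader le g)
     \<or> (leader le f = leader le g \<and> ldeg le f < ldeg le g)"

definition reduced :: "(('y, 'd) dvar \<Rightarrow> ('y, 'd) dvar \<Rightarrow> bool)
    \<Rightarrow> ('y, 'd, 'a::zero) dpoly \<Rightarrow> ('y, 'd, 'a) dpoly \<Rightarrow> bool" where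
  "reduced le f g \<longleftrightarrow>
     (\<forall>\<theta>. \<theta> \<noteq> 0 \<longrightarrow> dapply \<theta> (leader le g) \<notin> vars f)
     \<and> deg_in (leader le g) f < ldeg le g"

definition autoreduced :: "(('y, 'd) dvar \<Rightarrow> ('y, 'd) dvar \<Rightarrow> bool)
    \<Rightarrow> ('y, 'd, 'a::zero) dpoly set \<Rightarrow> bool" where
  "autoreduced le A \<longleftrightarrow>
     A \<inter> range const = {} \<and> (\<forall>f\<in>A. \<forall>g\<in>A. f \<noteq> g \<longrightarrow> reduced le f g)"

text \<open>Autoreduced sets are finite, so they are represented by lists of increasing rank.\<close>

definition autoreduced_list :: "(('y, 'd) dvar \<Rightarrow> ('y, 'd) dvar \<Rightarrow> bool)
    \<Rightarrow> ('y, 'd, 'a::zero) dpoly list \<Rightarrow> bool" where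
  "autoreduced_list le A \<longleftrightarrow> autoreduced le (set A) \<and> sorted_wrt (rank_less le) A"

definition lower_rank :: "(('y, 'd) dvar \<Rightarrow> ('y, 'd) dvar \<Rightarrow> bool)
    \<Rightarrow> ('y, 'd, 'a::zero) dpoly list \<Rightarrow> ('y, 'd, 'a) dpoly list \<Rightarrow> bool" where
  "lower_rank le A B \<longleftrightarrow>
     (\<exists>j. j < length A \<and> j < length B \<and> (\<forall>i<j. same_rank le (A ! i) (B ! i))
          \<and> rank_less le (A ! j) (B ! j))
     \<or> (length A > length B \<and> (\<forall>i<length B. same_rank le (A ! i) (B ! i)))"

definition char_set :: "(('y, 'd) dvar \<Rightarrow> ('y, 'd) dvar \<Rightarrow> bool)
    \<Rightarrow> ('y, 'd, 'a::zero) dpoly set \<Rightarrow> ('y, 'd, 'a) dpoly list \<Rightarrow> bool" where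
  "char_set le I C \<longleftrightarrow>
     autoreduced_list le C \<and> set C \<subseteq> I
     \<and> \<not> (\<exists>B. autoreduced_list le B \<and> set B \<subseteq> I \<and> lower_rank le B C)"

definition H_prod :: "(('y, 'd) dvar \<Rightarrow> ('y, 'd) dvar \<Rightarrow> bool)
    \<Rightarrow> ('y, 'd, 'a::comm_ring_1) dpoly list \<Rightarrow> ('y, 'd, 'a) dpoly" where
  "H_prod le C = (\<Prod>c\<leftarrow>C. initial le c * separant le c)"

definition characterizable :: "('d \<Rightarrow> 'a \<Rightarrow> 'a) \<Rightarrow> (('y, 'd) dvar \<Rightarrow> ('y, 'd) dvar \<Rightarrow> bool)
    \<Rightarrow> ('y, 'd, 'a::comm_ring_1) dpoly set \<Rightarrow> bool" where
  "characterizable der le I \<longleftrightarrow>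
     is_diff_ideal der I
     \<and> (\<exists>A. char_set le I A \<and> I = saturation (diff_ideal_gen der (set A)) (H_prod le A))"

definition leaders :: "(('y, 'd) dvar \<Rightarrow> ('y, 'd) dvar \<Rightarrow> bool)
    \<Rightarrow> ('y, 'd, 'a::zero) dpoly list \<Rightarrow> ('y, 'd) dvar set" where
  "leaders le C = leader le ` set C"

definition non_leaders :: "(('y, 'd) dvar \<Rightarrow> ('y, 'd) dvar \<Rightarrow> bool)
    \<Rightarrow> ('y, 'd, 'a::zero) dpoly list \<Rightarrow> ('y, 'd) dvar set" where
  "non_leaders le C = - derivs (leaders le C)"


section \<open>Canonical characteristic sets\<close>

text \<open>Lexicographic comparison of power products: the highest differential variable with
  different exponents decides.\<close>

definition lex_less :: "(('y, 'd) dvar \<Rightarrow> ('y, 'd) dvar \<Rightarrow> bool)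
    \<Rightarrow> ('y, 'd) dmon \<Rightarrow> ('y, 'd) dmon \<Rightarrow> bool" where
  "lex_less le m m' \<longleftrightarrow>
     (\<exists>v. Poly_Mapping.lookup m v < Poly_Mapping.lookup m' v
          \<and> (\<forall>w. le v w \<and> w \<noteq> v \<longrightarrow> Poly_Mapping.lookup m w = Poly_Mapping.lookup m' w))"

definition lead_mon :: "(('y, 'd) dvar \<Rightarrow> ('y, 'd) dvar \<Rightarrow> bool)
    \<Rightarrow> ('y, 'd, 'a::zero) dpoly \<Rightarrow> ('y, 'd) dmon" where
  "lead_mon le p =
     (THE m. m \<in> Poly_Mapping.keys p \<and> (\<forall>m'\<in>Poly_Mapping.keys p. m' \<noteq> m \<longrightarrow> lex_less le m' m))"

definition lex_coeff :: "(('y, 'd) dvar \<Rightarrow> ('y, 'd) dvar \<Rightarrow> bool)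
    \<Rightarrow> ('y, 'd, 'a::zero) dpoly \<Rightarrow> 'a" where
  "lex_coeff le p = Poly_Mapping.lookup p (lead_mon le p)"

definition canonical_char_set :: "(('y, 'd) dvar \<Rightarrow> ('y, 'd) dvar \<Rightarrow> bool)
    \<Rightarrow> ('y, 'd, 'a::comm_ring_1) dpoly set \<Rightarrow> ('y, 'd, 'a) dpoly list \<Rightarrow> bool" where
  "canonical_char_set le I C \<longleftrightarrow>
     char_set le I C
     \<and> (\<forall>c\<in>set C. initial le c \<in> polys (non_leaders le C))
     \<and> (\<forall>c\<in>set C. (\<forall>q \<in> polys (non_leaders le C). q dvd c \<longrightarrow> q \<in> range const)
                  \<and> lex_coeff le (initial le c) = 1)"


section \<open>The algorithm\<close>

text \<open>$k(N)[L]$ as a subring of the fraction field of $k\{Y\}$, its elements being written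
  over a common denominator from $k[N]$.\<close>

definition fpolys :: "('y::linorder, 'd::linorder) dvar set \<Rightarrow> ('y, 'd) dvar set
    \<Rightarrow> ('y, 'd, 'a::field) dpoly fract set" where
  "fpolys N L = {Fract a b | a b. a \<in> polys (N \<union> L) \<and> b \<in> polys N \<and> b \<noteq> 0}"

text \<open>The ideal generated by \<open>B\<close> in $k(N)[L]$.\<close>

definition fideal :: "('y::linorder, 'd::linorder) dvar set \<Rightarrow> ('y, 'd) dvar set
    \<Rightarrow> ('y, 'd, 'a::field) dpoly list \<Rightarrow> ('y, 'd, 'a) dpoly fract set" where
  "fideal N L B = {\<Sum>c\<in>set B. q c * Fract c 1 | q. \<forall>c\<in>set B. q c \<in> fpolys N L}"

definition is_inverse :: "('y::linorder, 'd::linorder) dvar set \<Rightarrow> ('y, 'd) dvar set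
    \<Rightarrow> ('y, 'd, 'a::field) dpoly list \<Rightarrow> ('y, 'd, 'a) dpoly \<Rightarrow> ('y, 'd, 'a) dpoly \<Rightarrow> bool" where
  "is_inverse N L B f g \<longleftrightarrow>
     f \<in> polys (N \<union> L)
     \<and> vars g \<subseteq> vars f \<union> (\<Union>c\<in>set B. vars c)
     \<and> (\<exists>h \<in> polys N. h \<noteq> 0 \<and> Fract (f * g) 1 - Fract h 1 \<in> fideal N L B)"

text \<open>
  One pseudo-division of \<open>f\<close> by \<open>c\<close> with respect to the leader of \<open>c\<close>. The exponent of the
  initial is at most the number of division steps, which covers both the classical
  pseudo-division and the variants that multiply by the initial only when necessary; once the
  exponent is fixed, \<open>q\<close> and \<open>r\<close> are unique.
\<close>

definition pseudo_rem1 :: "(('y, 'd) dvar \<Rightarrow> ('y, 'd) dvar \<Rightarrow> bool)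
    \<Rightarrow> ('y, 'd, 'a::comm_ring_1) dpoly \<Rightarrow> ('y, 'd, 'a) dpoly \<Rightarrow> ('y, 'd, 'a) dpoly \<Rightarrow> bool" where
  "pseudo_rem1 le c f r \<longleftrightarrow>
     (\<exists>m q. m \<le> deg_in (leader le c) f + 1 - ldeg le c
            \<and> initial le c ^ m * f = q * c + r
            \<and> deg_in (leader le c) r < ldeg le c)"

primrec pseudo_rems :: "(('y, 'd) dvar \<Rightarrow> ('y, 'd) dvar \<Rightarrow> bool)
    \<Rightarrow> ('y, 'd, 'a::comm_ring_1) dpoly list \<Rightarrow> ('y, 'd, 'a) dpoly \<Rightarrow> ('y, 'd, 'a) dpoly \<Rightarrow> bool" where
  "pseudo_rems le [] f r \<longleftrightarrow> r = f"
| "pseudo_rems le (c # cs) f r \<longleftrightarrow> (\<exists>s. pseudo_rem1 le c f s \<and> pseudo_rems le cs s r)"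

text \<open>\<open>r\<close> is a pseudo-remainder of \<open>f\<close> with respect to $B = B_1,\dots,B_s$: divide by
  $B_s$ first and by $B_1$ last.\<close>

definition pseudo_rem :: "(('y, 'd) dvar \<Rightarrow> ('y, 'd) dvar \<Rightarrow> bool)
    \<Rightarrow> ('y, 'd, 'a::comm_ring_1) dpoly list \<Rightarrow> ('y, 'd, 'a) dpoly \<Rightarrow> ('y, 'd, 'a) dpoly \<Rightarrow> bool" where
  "pseudo_rem le B f r \<longleftrightarrow> pseudo_rems le (rev B) f r"

definition dvd_on :: "'r::comm_ring_1 set \<Rightarrow> 'r \<Rightarrow> 'r \<Rightarrow> bool" where
  "dvd_on R a b \<longleftrightarrow> (\<exists>q\<in>R. b = a * q)"

definition is_gcd_on :: "'r::comm_ring_1 set \<Rightarrow> 'r set \<Rightarrow> 'r \<Rightarrow> bool" where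
  "is_gcd_on R S d \<longleftrightarrow>
     d \<in> R \<and> (\<forall>s\<in>S. dvd_on R d s)
     \<and> (\<forall>e\<in>R. (\<forall>s\<in>S. dvd_on R e s) \<longrightarrow> dvd_on R e d)"

text \<open>
  The steps are relations between the current and the updated list, since inverses,
  pseudo-remainders and greatest common divisors are not unique. List positions start at \<open>0\<close>,
  so \<open>take i C\<close> consists of the elements preceding \<open>C ! i\<close>.
\<close>

definition step_a :: "(('y::linorder, 'd::linorder) dvar \<Rightarrow> ('y, 'd) dvar \<Rightarrow> bool)
    \<Rightarrow> ('y, 'd) dvar set \<Rightarrow> ('y, 'd) dvar set
    \<Rightarrow> nat \<Rightarrow> ('y, 'd, 'a::field) dpoly list \<Rightarrow> ('y, 'd, 'a) dpoly list \<Rightarrow> bool" where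
  "step_a le N L i C C' \<longleftrightarrow>
     (\<exists>g r. is_inverse N L (take i C) (initial le (C ! i)) g
            \<and> pseudo_rem le (take i C) (g * C ! i) r
            \<and> C' = C[i := r])"

definition step_b :: "(('y, 'd) dvar \<Rightarrow> ('y, 'd) dvar \<Rightarrow> bool)
    \<Rightarrow> ('y, 'd) dvar set \<Rightarrow> ('y, 'd) dvar set
    \<Rightarrow> nat \<Rightarrow> ('y, 'd, 'a::field) dpoly list \<Rightarrow> ('y, 'd, 'a) dpoly list \<Rightarrow> bool" where
  "step_b le N L i C C' \<longleftrightarrow>
     (\<exists>d q. is_gcd_on (polys (N \<union> L))
              {coeff_in (leader le (C ! i)) j (C ! i) | j. j \<le> ldeg le (C ! i)} d
            \<and> C ! i = d * q
            \<and> C' = C[i := const (1 / lex_coeff le q) * q])"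

primrec steps :: "(nat \<Rightarrow> 's \<Rightarrow> 's \<Rightarrow> bool) \<Rightarrow> nat list \<Rightarrow> 's \<Rightarrow> 's \<Rightarrow> bool" where
  "steps R [] s t \<longleftrightarrow> t = s"
| "steps R (i # is) s t \<longleftrightarrow> (\<exists>u. R i s u \<and> steps R is u t)"

definition algorithm_result :: "(('y::linorder, 'd::linorder) dvar \<Rightarrow> ('y, 'd) dvar \<Rightarrow> bool)
    \<Rightarrow> ('y, 'd, 'a::field) dpoly list \<Rightarrow> ('y, 'd, 'a) dpoly list \<Rightarrow> bool" where
  "algorithm_result le C C' \<longleftrightarrow>
     (let N = non_leaders le C; L = leaders le C; p = length C in
      \<exists>D. steps (step_a le N L) [1..<p] C D \<and> steps (step_b le N L) [0..<p] D C')"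

end

theory Submission
  imports Defs "HOL-Computational_Algebra.Polynomial"
begin

text \<open>
  The differential structure enters only to show \<open>1 \<notin> I\<close>; everything else rests on three
  properties of \<open>I\<close>: minimality of the rank of \<open>C\<close> means that \<open>I\<close> contains no nonzero element
  reduced with respect to \<open>C\<close>; since \<open>I\<close> is saturated, the initials of \<open>C\<close> are not zero divisors
  modulo \<open>I\<close>; pseudo-reducing by \<open>C\<close>, it follows that the nonzero elements of $k[N]$ are not
  zero divisors on $k[N \cup L]$ modulo \<open>I\<close>.

  Once the initials of \<open>C(i-1)\<close> lie in $k[N]$, the remainders of the powers of the initial \<open>f\<close> of \<open>C\<^sub>i\<close>
  modulo \<open>C(i-1)\<close> lie in a finitely generated module over $k[N]$, so they satisfy a linear relation;
  cancelling the lowest power of \<open>f\<close> turns it into an inverse of \<open>f\<close>. After step (a) the initial of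
  \<open>C\<^sub>i\<close> and a multiple of the polynomial \<open>h\<close> from the definition of the inverse are both reduced and
  congruent modulo \<open>I\<close>, hence equal, so the new initial lies in $k[N]$. Step (b) exists because
  gcds exist in polynomial rings, and it removes exactly the factors in $k[N]$. For two canonical
  characteristic sets, \<open>init(E) D - init(D) E\<close> is reduced and lies in \<open>I\<close> for corresponding elements
  \<open>D\<close>, \<open>E\<close>, hence vanishes; primitivity and the normalization of the leading coefficient give
  \<open>D = E\<close>.
\<close>

section \<open>Univariate views of a differential polynomial\<close>

text \<open>Membership in \<open>I\<close> forces only reduced elements to vanish, so variables and
  degrees have to be tracked everywhere. Two facts keep this cheap. In
  \<open>polys (N \<union> L)\<close> no proper derivative of a leader occurs, so reducedness is a
  matter of degrees in the leaders alone. And a divisor of a nonzero polynomial contains only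
  variables of that polynomial, so divisibility inside a polynomial subring can be tested in the
  whole ring; in particular the gcd of step (b) divides an initial in \<open>k[N]\<close>, hence
  lies in \<open>k[N]\<close>, can be cancelled modulo \<open>I\<close>, and contributes to no
  degree in a leader. That \<open>1\<close> is not in \<open>I\<close> matters because autoreduced
  sets contain no constants: minimality of rank says nothing about constants in \<open>I\<close>. An
  inverse may involve only variables of \<open>f\<close> and \<open>C(i-1)\<close>. The linear
  algebra therefore runs without fractions, over the polynomials in the non-leaders that occur
  there; \<open>k(N)\<close> enters only through \<open>is_inverse\<close>. Since the steps are
  relations, the invariants serve twice: they show that each step can be performed, and that every
  choice of inverse, remainder and gcd leads to a canonical result.\<close>

abbreviation "lkp \<equiv> Poly_Mapping.lookup"
abbreviation "sgl \<equiv> Poly_Mapping.single"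

lemma sum_sgl_lkp: "(\<Sum>m\<in>Poly_Mapping.keys p. sgl m (lkp p m)) = p"
  for p :: "'b \<Rightarrow>\<^sub>0 'a::comm_monoid_add"
  by (rule poly_mapping_eqI)
     (simp add: lookup_sum lookup_single when_def sum.delta' in_keys_iff)

lemma dpoly_induct [case_names single add]:
  fixes p :: "'b \<Rightarrow>\<^sub>0 'a::comm_monoid_add"
  assumes single: "\<And>m c. P (sgl m c)" and add: "\<And>p q. P p \<Longrightarrow> P q \<Longrightarrow> P (p + q)"
  shows "P p"
proof -
  have "P (\<Sum>m\<in>A. sgl m (lkp p m))" if "finite A" for A
    using that single[of _ 0]
    by (induction A rule: finite_induct) (auto intro: single add)
  from this[OF finite_keys[of p]] show ?thesis by (simp add: sum_sgl_lkp)
qed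

lemma coeff_in_alt:
  "coeff_in v j p = (\<Sum>m\<in>Poly_Mapping.keys p.
     if lkp m v = j then sgl (m - sgl v j) (lkp p m) else 0)"
  unfolding coeff_in_def by (simp flip: sum.inter_filter)

lemma coeff_in_single:
  "coeff_in v j (sgl m c) = (if lkp m v = j then sgl (m - sgl v j) c else 0)"
  by (cases "c = 0") (auto simp: coeff_in_alt)

lemma coeff_in_add: "coeff_in v j (p + q) = coeff_in v j p + coeff_in v j q"
  unfolding coeff_in_alt
  by (rule setsum_keys_plus_distrib[of "\<lambda>m c. if lkp m v = j then sgl (m - sgl v j) c else 0"])
     (auto simp: single_add)

text \<open>The same polynomial read as univariate in \<open>v\<close>. The coefficients keep the
  type of differential polynomials and merely avoid \<open>v\<close>, so facts about degrees and
  leading coefficients of \<open>poly\<close> transfer through \<open>coeff_up\<close> and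
  \<open>poly_up\<close>.\<close>

definition up :: "('y, 'd) dvar \<Rightarrow> ('y, 'd, 'a::comm_ring_1) dpoly \<Rightarrow> ('y, 'd, 'a) dpoly poly" where
  "up v p = (\<Sum>m\<in>Poly_Mapping.keys p.
     Polynomial.monom (sgl (m - sgl v (lkp m v)) (lkp p m)) (lkp m v))"

lemma coeff_up [simp]: "poly.coeff (up v p) j = coeff_in v j p"
  unfolding up_def coeff_in_alt coeff_sum by (rule sum.cong) auto

lemma up_single: "up v (sgl m c) = Polynomial.monom (sgl (m - sgl v (lkp m v)) c) (lkp m v)"
  by (rule poly_eqI) (auto simp: coeff_in_single)

lemma up_add: "up v (p + q) = up v p + up v q"
  by (rule poly_eqI) (simp add: coeff_in_add)

lemma up_0 [simp]: "up v 0 = 0"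
  by (simp add: up_def)

lemma up_mult: "up v (p * q) = up v p * up v q"
proof (induction p rule: dpoly_induct)
  case (single m c)
  show ?case
  proof (induction q rule: dpoly_induct)
    case (single m' c')
    have "m + m' - sgl v (lkp m v + lkp m' v) = (m - sgl v (lkp m v)) + (m' - sgl v (lkp m' v))"
      by (rule poly_mapping_eqI) (simp add: lookup_add lookup_minus lookup_single when_def)
    then show ?case
      by (simp add: up_single mult_single Polynomial.mult_monom lookup_add)
  qed (simp add: up_add algebra_simps)
qed (simp add: up_add algebra_simps)

lemma up_1 [simp]: "up v 1 = 1"
  using up_single[of v 0 1] by simp

lemma poly_up [simp]: "poly (up v p) (var v) = p"
proof (induction p rule: dpoly_induct)
  case (single m c)
  have pow: "var v ^ n = sgl (sgl v n) 1" for n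
    by (induction n) (simp_all add: var_def mult_single flip: single_add)
  have "m - sgl v (lkp m v) + sgl v (lkp m v) = m"
    by (rule poly_mapping_eqI) (simp add: lookup_add lookup_minus lookup_single when_def)
  then show ?case
    by (simp add: up_single poly_monom pow mult_single)
qed (simp add: up_add)

lemma up_inject: "up v p = up v q \<longleftrightarrow> p = q"
  by (metis poly_up)

lemma up_eq_0_iff [simp]: "up v p = 0 \<longleftrightarrow> p = 0"
  using up_inject[of v p 0] by simp

lemma up_uminus: "up v (- p) = - up v p"
  using up_add[of v p "- p"] by (simp add: minus_unique)

lemma up_diff: "up v (p - q) = up v p - up v q"
  using up_add[of v p "- q"] by (simp add: up_uminus)

lemma up_power: "up v (p ^ n) = up v p ^ n"
  by (induction n) (simp_all add: up_mult)

lemma coeff_in_diff: "coeff_in v j (p - q) = coeff_in v j p - coeff_in v j (q :: ('y, 'd, 'a::comm_ring_1) dpoly)"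
  by (metis coeff_up up_diff coeff_diff)

lemma coeff_in_0 [simp]: "coeff_in v j 0 = 0"
  by (simp add: coeff_in_def)

lemma coeff_in_sum: "coeff_in v j (\<Sum>x\<in>A. f x) = (\<Sum>x\<in>A. coeff_in v j (f x))"
  by (induction A rule: infinite_finite_induct) (simp_all add: coeff_in_add)

lemma coeff_in_mult:
  "coeff_in v j (p * q) = (\<Sum>i\<le>j. coeff_in v i p * coeff_in v (j - i) (q :: ('y, 'd, 'a::comm_ring_1) dpoly))"
  by (metis (no_types, lifting) coeff_mult coeff_up sum.cong up_mult)

lemma lookup_coeff_in:
  fixes p :: "('y, 'd, 'a::comm_monoid_add) dpoly"
  shows "lkp (coeff_in v j p) m = (if lkp m v = 0 then lkp p (m + sgl v j) else 0)"
proof (induction p rule: dpoly_induct)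
  case (single m' c)
  have "(lkp m' v = j \<and> m' - sgl v j = m) = (lkp m v = 0 \<and> m' = m + sgl v j)"
  proof safe
    assume "j = lkp m' v"
    show "m' = m' - sgl v (lkp m' v) + sgl v (lkp m' v)"
      by (rule poly_mapping_eqI) (simp add: lookup_add lookup_minus lookup_single when_def)
  qed (simp_all add: lookup_add lookup_minus lookup_single when_def)
  then show ?case
    by (auto simp: coeff_in_single lookup_single when_def)
qed (simp add: coeff_in_add lookup_add)

lemma keys_coeff_in:
  "Poly_Mapping.keys (coeff_in v j p) = {m. lkp m v = 0 \<and> m + sgl v j \<in> Poly_Mapping.keys p}"
  by (auto simp: in_keys_iff lookup_coeff_in split: if_splits)

lemma vars_coeff_in: "vars (coeff_in v j p) \<subseteq> vars p - {v}"
proof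
  fix w assume "w \<in> vars (coeff_in v j p)"
  then obtain m where m: "lkp m v = 0" "m + sgl v j \<in> Poly_Mapping.keys p" "lkp m w \<noteq> 0"
    by (auto simp: vars_def keys_coeff_in in_keys_iff)
  then have "lkp (m + sgl v j) w \<noteq> 0" by (simp add: lookup_add)
  then show "w \<in> vars p - {v}" using m by (auto simp: vars_def in_keys_iff)
qed

lemma deg_in_eq_degree: "deg_in v p = degree (up v p)"
proof (rule antisym)
  show "degree (up v p) \<le> deg_in v p"
  proof (rule degree_le, intro allI impI)
    fix i assume i: "deg_in v p < i"
    have "lkp m v \<noteq> i" if "m \<in> Poly_Mapping.keys p" for m
      using i that unfolding deg_in_def by (subst (asm) Max_less_iff) auto
    then show "poly.coeff (up v p) i = 0" by (simp add: coeff_in_alt)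
  qed
  show "deg_in v p \<le> degree (up v p)"
    unfolding deg_in_def
  proof (rule Max.boundedI)
    fix a assume "a \<in> insert 0 ((\<lambda>m. lkp m v) ` Poly_Mapping.keys p)"
    then consider "a = 0" | m where "m \<in> Poly_Mapping.keys p" "a = lkp m v" by auto
    then show "a \<le> degree (up v p)"
    proof cases
      case 2
      have "m - sgl v a + sgl v a = m"
        by (rule poly_mapping_eqI) (simp add: 2 lookup_add lookup_minus lookup_single when_def)
      then have "lkp (coeff_in v a p) (m - sgl v a) \<noteq> 0"
        using 2 by (simp add: lookup_coeff_in lookup_minus in_keys_iff)
      then show ?thesis by (intro le_degree) auto
    qed simp
  qed auto
qed

lemma coeff_in_eq_0: "deg_in v p < j \<Longrightarrow> coeff_in v j (p :: ('y, 'd, 'a::comm_ring_1) dpoly) = 0"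
  by (metis coeff_up coeff_eq_0 deg_in_eq_degree)

lemma deg_in_leI: "(\<And>j. j > n \<Longrightarrow> coeff_in v j (p :: ('y, 'd, 'a::comm_ring_1) dpoly) = 0) \<Longrightarrow> deg_in v p \<le> n"
  by (simp add: deg_in_eq_degree degree_le)

lemma le_deg_in: "coeff_in v j (p :: ('y, 'd, 'a::comm_ring_1) dpoly) \<noteq> 0 \<Longrightarrow> j \<le> deg_in v p"
  using coeff_in_eq_0 not_le by blast

lemma lead_coeff_in_eq_0_iff:
  "coeff_in v (deg_in v p) p = 0 \<longleftrightarrow> p = (0 :: ('y, 'd, 'a::comm_ring_1) dpoly)"
  by (metis coeff_up deg_in_eq_degree leading_coeff_0_iff up_eq_0_iff)

lemma dpoly_eq_sum_coeff_in:
  fixes p :: "('y, 'd, 'a::comm_ring_1) dpoly"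
  assumes "deg_in v p \<le> n"
  shows "p = (\<Sum>j\<le>n. coeff_in v j p * var v ^ j)"
proof -
  have "p = poly (up v p) (var v)" by simp
  also have "\<dots> = (\<Sum>j\<le>deg_in v p. coeff_in v j p * var v ^ j)"
    by (subst poly_altdef) (simp add: deg_in_eq_degree)
  also have "\<dots> = (\<Sum>j\<le>n. coeff_in v j p * var v ^ j)"
    using assms by (intro sum.mono_neutral_left) (auto simp: coeff_in_eq_0)
  finally show ?thesis .
qed

lemma deg_in_eq_0_iff: "deg_in v p = 0 \<longleftrightarrow> v \<notin> vars p"
proof -
  have "deg_in v p = 0 \<longleftrightarrow> (\<forall>m\<in>Poly_Mapping.keys p. lkp m v = 0)"
    unfolding deg_in_def by (subst Max_eq_iff) auto
  then show ?thesis by (auto simp: vars_def in_keys_iff)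
qed

lemma finite_vars [simp]: "finite (vars p)"
  by (simp add: vars_def)

lemma up_free:
  fixes p :: "('y, 'd, 'a::comm_ring_1) dpoly"
  assumes "v \<notin> vars p"
  shows "up v p = [:p:]"
proof -
  have "degree (up v p) = 0" using assms by (metis deg_in_eq_0_iff deg_in_eq_degree)
  then obtain a where "up v p = [:a:]" using degree0_coeffs by blast
  then show ?thesis using poly_up[of v p] by simp
qed

lemma coeff_in_mult_free:
  fixes p :: "('y, 'd, 'a::comm_ring_1) dpoly"
  assumes "v \<notin> vars p"
  shows "coeff_in v j (p * q) = p * coeff_in v j q"
proof -
  have "up v (p * q) = smult p (up v q)" by (simp add: up_mult up_free[OF assms])
  then show ?thesis by (metis coeff_up coeff_smult)
qed

lemma up_var: "up v (var v) = [:0, 1:]"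
  by (simp add: var_def up_single monom_altdef lookup_single)

lemma deg_in_0 [simp]: "deg_in v 0 = 0"
  by (simp add: deg_in_def)

lemma deg_in_mult:
  fixes p q :: "('y::linorder, 'd::linorder, 'a::idom) dpoly"
  shows "p \<noteq> 0 \<Longrightarrow> q \<noteq> 0 \<Longrightarrow> deg_in v (p * q) = deg_in v p + deg_in v q"
  by (simp add: deg_in_eq_degree up_mult degree_mult_eq)

lemma deg_in_mult_le:
  "deg_in v (p * q) \<le> deg_in v p + deg_in v (q :: ('y, 'd, 'a::comm_ring_1) dpoly)"
  by (simp add: deg_in_eq_degree up_mult degree_mult_le)

lemma deg_in_mult_free:
  fixes p :: "('y, 'd, 'a::comm_ring_1) dpoly"
  assumes "v \<notin> vars p"
  shows "deg_in v (p * q) \<le> deg_in v q"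
  using deg_in_mult_le[of v p q] assms by (simp flip: deg_in_eq_0_iff)

lemma deg_in_diff_le:
  "deg_in v p \<le> n \<Longrightarrow> deg_in v q \<le> n \<Longrightarrow> deg_in v (p - q) \<le> n"
  for p q :: "('y, 'd, 'a::comm_ring_1) dpoly"
  by (simp add: deg_in_eq_degree up_diff degree_diff_le)

lemma deg_in_diff_less:
  "deg_in v p < n \<Longrightarrow> deg_in v q < n \<Longrightarrow> deg_in v (p - q) < n"
  for p q :: "('y, 'd, 'a::comm_ring_1) dpoly"
  using deg_in_diff_le[of v p "n - 1" q] by linarith

lemma deg_in_coeff_in_le: "deg_in w (coeff_in v j p) \<le> deg_in w (p :: ('y, 'd, 'a::comm_ring_1) dpoly)"
proof -
  have "lkp m w \<le> deg_in w p" if "m \<in> Poly_Mapping.keys (coeff_in v j p)" for m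
  proof -
    have "m + sgl v j \<in> Poly_Mapping.keys p" using that by (simp add: keys_coeff_in)
    then have "lkp (m + sgl v j) w \<le> deg_in w p" unfolding deg_in_def by (intro Max_ge) auto
    then show ?thesis by (simp add: lookup_add)
  qed
  then show ?thesis unfolding deg_in_def[of w "coeff_in v j p"] by auto
qed

section \<open>Polynomial subrings\<close>

lemma vars_0 [simp]: "vars 0 = {}"
  and vars_const [simp]: "vars (const c) = {}"
  and vars_1 [simp]: "vars (1 :: ('y, 'd, 'a::zero_neq_one) dpoly) = {}"
  by (auto simp: vars_def const_def)

lemma vars_var [simp]: "vars (var v :: ('y, 'd, 'a::zero_neq_one) dpoly) = {v}"
  by (auto simp: vars_def var_def)

lemma vars_add: "vars (p + q) \<subseteq> vars p \<union> vars q"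
  using Poly_Mapping.keys_add[of p q] unfolding vars_def by blast

lemma vars_uminus [simp]: "vars (- p) = vars (p :: ('y, 'd, 'a::comm_ring_1) dpoly)"
  by (auto simp: vars_def in_keys_iff)

lemma vars_diff: "vars (p - q) \<subseteq> vars p \<union> vars (q :: ('y, 'd, 'a::comm_ring_1) dpoly)"
  using vars_add[of p "- q"] by simp

lemma vars_mult: "vars (p * q) \<subseteq> vars p \<union> vars (q :: ('y, 'd, 'a::comm_ring_1) dpoly)"
proof
  fix v assume "v \<in> vars (p * q)"
  then obtain a b where "a \<in> Poly_Mapping.keys p" "b \<in> Poly_Mapping.keys q" "v \<in> Poly_Mapping.keys (a + b)"
    using keys_mult[of p q] unfolding vars_def by blast
  then show "v \<in> vars p \<union> vars q"
    using Poly_Mapping.keys_add[of a b] unfolding vars_def by blast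
qed

lemma vars_mult_eq:
  fixes p q :: "('y::linorder, 'd::linorder, 'a::idom) dpoly"
  assumes "p \<noteq> 0" "q \<noteq> 0"
  shows "vars (p * q) = vars p \<union> vars q"
proof (intro set_eqI)
  fix v
  have "v \<in> vars (p * q) \<longleftrightarrow> deg_in v (p * q) \<noteq> 0" by (simp add: deg_in_eq_0_iff)
  also have "\<dots> \<longleftrightarrow> deg_in v p \<noteq> 0 \<or> deg_in v q \<noteq> 0" by (simp add: deg_in_mult assms)
  finally show "v \<in> vars (p * q) \<longleftrightarrow> v \<in> vars p \<union> vars q" by (simp add: deg_in_eq_0_iff)
qed

lemma vars_dvd:
  fixes p q :: "('y::linorder, 'd::linorder, 'a::idom) dpoly"
  assumes "p dvd q" "q \<noteq> 0"
  shows "vars p \<subseteq> vars q"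
proof -
  obtain k where k: "q = p * k" using assms(1) by (elim dvdE)
  then show ?thesis using assms(2) vars_mult_eq[of p k] by auto
qed

lemma vars_empty_iff: "vars p = {} \<longleftrightarrow> p \<in> range const"
proof
  assume e: "vars p = {}"
  have "p = const (lkp p 0)"
  proof (rule poly_mapping_eqI)
    fix m
    have "m = 0" if "m \<in> Poly_Mapping.keys p"
      using e that by (auto simp: vars_def)
    then show "lkp p m = lkp (const (lkp p 0)) m"
      by (cases "m = 0") (auto simp: const_def lookup_single when_def in_keys_iff)
  qed
  then show "p \<in> range const" by blast
qed auto

lemma const_mult: "const (a * b) = const a * const b"
  by (simp add: const_def mult_single)

lemma const_0 [simp]: "const 0 = 0" and const_1 [simp]: "const 1 = 1"
  by (simp_all add: const_def)

lemma const_eq_0_iff [simp]: "const c = 0 \<longleftrightarrow> c = 0"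
  by (metis const_0 const_def lookup_single_eq lookup_zero)

lemma const_dvd_1: "c \<noteq> 0 \<Longrightarrow> const c dvd (1 :: ('y, 'd, 'a::field) dpoly)"
  by (rule dvdI[of _ _ "const (1 / c)"]) (simp flip: const_mult)

lemma is_unit_dpoly_iff:
  fixes p :: "('y::linorder, 'd::linorder, 'a::field) dpoly"
  shows "p dvd 1 \<longleftrightarrow> p \<noteq> 0 \<and> p \<in> range const"
proof
  assume "p dvd 1"
  then show "p \<noteq> 0 \<and> p \<in> range const" using vars_dvd[of p 1] vars_empty_iff[of p] by auto
qed (auto intro: const_dvd_1)

lemma polysD: "p \<in> polys V \<Longrightarrow> v \<in> vars p \<Longrightarrow> v \<in> V"
  by (auto simp: polys_def)

lemma polys_mono: "V \<subseteq> W \<Longrightarrow> polys V \<subseteq> polys W"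
  by (auto simp: polys_def)

lemma polys_const [simp, intro]: "const c \<in> polys V"
  and polys_0 [simp, intro]: "0 \<in> polys V"
  and polys_1 [simp, intro]: "(1 :: ('y, 'd, 'b::zero_neq_one) dpoly) \<in> polys V"
  by (simp_all add: polys_def)

lemma polys_add [intro]: "p \<in> polys V \<Longrightarrow> q \<in> polys V \<Longrightarrow> p + q \<in> polys V"
  using vars_add[of p q] by (auto simp: polys_def)

context
  fixes V :: "('y, 'd) dvar set"
begin

lemma polys_uminus [intro]: "p \<in> polys V \<Longrightarrow> - (p :: ('y, 'd, 'a::comm_ring_1) dpoly) \<in> polys V"
  by (simp add: polys_def)

lemma polys_diff [intro]: "p \<in> polys V \<Longrightarrow> q \<in> polys V \<Longrightarrow> p - (q :: ('y, 'd, 'a::comm_ring_1) dpoly) \<in> polys V"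
  using vars_diff[of p q] by (auto simp: polys_def)

lemma polys_mult [intro]: "p \<in> polys V \<Longrightarrow> q \<in> polys V \<Longrightarrow> p * (q :: ('y, 'd, 'a::comm_ring_1) dpoly) \<in> polys V"
  using vars_mult[of p q] by (auto simp: polys_def)

lemma polys_power [intro]: "(p :: ('y, 'd, 'a::comm_ring_1) dpoly) \<in> polys V \<Longrightarrow> p ^ n \<in> polys V"
  by (induction n) auto

lemma polys_sum [intro]:
  "(\<And>x. x \<in> A \<Longrightarrow> f x \<in> polys V) \<Longrightarrow> (\<Sum>x\<in>A. f x :: ('y, 'd, 'a::comm_ring_1) dpoly) \<in> polys V"
  by (induction A rule: infinite_finite_induct) auto

lemma polys_var [intro]: "v \<in> V \<Longrightarrow> (var v :: ('y, 'd, 'a::comm_ring_1) dpoly) \<in> polys V"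
  by (simp add: polys_def)

lemma polys_coeff_in [intro]: "p \<in> polys V \<Longrightarrow> coeff_in v j p \<in> polys V"
  using vars_coeff_in[of v j p] by (auto simp: polys_def)

end

lemma polys_dvd:
  fixes p q :: "('y::linorder, 'd::linorder, 'a::idom) dpoly"
  shows "q \<in> polys V \<Longrightarrow> p dvd q \<Longrightarrow> q \<noteq> 0 \<Longrightarrow> p \<in> polys V"
  using vars_dvd[of p q] by (auto simp: polys_def)

section \<open>Pseudo-division\<close>

lemma deg_in_var_power_mult_le:
  fixes p :: "('y, 'd, 'a::comm_ring_1) dpoly"
  shows "deg_in v (var v ^ k * p) \<le> k + deg_in v p"
proof -
  have "degree ([:0, 1:] ^ k * up v p) \<le> k + degree (up v p)"
    using degree_mult_le[of "[:0, 1:] ^ k" "up v p"] degree_power_le[of "[:0, 1 :: ('y, 'd, 'a) dpoly:]" k]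
    by simp
  then show ?thesis by (simp add: deg_in_eq_degree up_mult up_power up_var)
qed

lemma coeff_in_var_power_mult:
  fixes p :: "('y, 'd, 'a::comm_ring_1) dpoly"
  shows "coeff_in v (k + j) (var v ^ k * p) = coeff_in v j p"
proof -
  have "up v (var v ^ k * p) = Polynomial.monom 1 k * up v p"
    by (simp add: up_mult up_power up_var monom_altdef)
  then have "poly.coeff (up v (var v ^ k * p)) (k + j) = poly.coeff (up v p) j"
    by (simp add: coeff_monom_mult)
  then show ?thesis by simp
qed

text \<open>Each step multiplies by the leading coefficient in \<open>v\<close> and cancels the top
  term. The alternative \<open>r = 0\<close> is there for divisors of degree 0 in \<open>v\<close>,
  where no remainder has smaller degree. That \<open>q\<close> and \<open>r\<close> stay in
  \<open>polys W\<close> is what the proof of Gauss's lemma needs.\<close>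

lemma pseudo_division:
  fixes c f :: "('y, 'd, 'a::comm_ring_1) dpoly"
  assumes "c \<in> polys W" "f \<in> polys W"
  obtains m q r where "m \<le> deg_in v f + 1 - deg_in v c"
    "coeff_in v (deg_in v c) c ^ m * f = q * c + r"
    "r = 0 \<or> deg_in v r < deg_in v c" "q \<in> polys W" "r \<in> polys W"
proof -
  let ?n = "deg_in v c"
  let ?l = "coeff_in v ?n c"
  have l: "?l \<in> polys W" "v \<notin> vars ?l" using assms vars_coeff_in[of v ?n c] by auto
  have "\<exists>m q r. m \<le> deg_in v f + 1 - ?n \<and> ?l ^ m * f = q * c + r \<and>
      (r = 0 \<or> deg_in v r < ?n) \<and> q \<in> polys W \<and> r \<in> polys W"
    using assms(2)
  proof (induction "deg_in v f" arbitrary: f rule: less_induct)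
    case less
    let ?d = "deg_in v f"
    show ?case
    proof (cases "f = 0 \<or> ?d < ?n")
      case True
      then show ?thesis using less.prems by (intro exI[of _ 0] exI[of _ f]) auto
    next
      case False
      let ?b = "coeff_in v ?d f * var v ^ (?d - ?n)"
      have b: "?b \<in> polys W"
      \<comment> \<open>For equal degrees \<open>?b\<close> contains no power of \<open>v\<close>,
        which then need not lie in \<open>W\<close>; otherwise \<open>v\<close> occurs in
        \<open>f\<close> and hence lies in \<open>W\<close>.\<close>
      proof (cases "?d = ?n")
        case False
        then have "v \<in> vars f" using \<open>\<not> (f = 0 \<or> ?d < ?n)\<close> deg_in_eq_0_iff[of v f] by auto
        then show ?thesis using less.prems by (auto dest: polysD)
      qed (use less.prems in auto)
      define g where "g = ?l * f - ?b * c"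
      have vf: "v \<notin> vars (coeff_in v ?d f)" using vars_coeff_in[of v ?d f] by auto
      have e: "?b * c = coeff_in v ?d f * (var v ^ (?d - ?n) * c)" by (simp add: mult.assoc)
      have g: "g \<in> polys W" using b l less.prems assms by (auto simp: g_def)
      have dg: "deg_in v g \<le> ?d"
        unfolding g_def e using False
        by (intro deg_in_diff_le order_trans[OF deg_in_mult_free[OF l(2)]] order_trans[OF deg_in_mult_free[OF vf]]
              order_trans[OF deg_in_var_power_mult_le]) auto
      have "coeff_in v ?d (var v ^ (?d - ?n) * c) = ?l"
        using coeff_in_var_power_mult[of v "?d - ?n" ?n c] False by simp
      then have cg: "coeff_in v ?d g = 0"
        unfolding g_def e by (simp add: coeff_in_diff coeff_in_mult_free[OF l(2)] coeff_in_mult_free[OF vf])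
      show ?thesis
      proof (cases "g = 0")
        case True
        then have "?l ^ 1 * f = ?b * c + 0" by (simp add: g_def)
        then show ?thesis using False b by (intro exI[of _ 1] exI[of _ ?b] exI[of _ 0]) auto
      next
        case g0: False
        then have "deg_in v g \<noteq> ?d" using cg lead_coeff_in_eq_0_iff[of v g] by auto
        with dg have "deg_in v g < ?d" by simp
        from less.hyps[OF this g] obtain m q r where
          m: "m \<le> deg_in v g + 1 - ?n" and r: "?l ^ m * g = q * c + r"
            "r = 0 \<or> deg_in v r < ?n" "q \<in> polys W" "r \<in> polys W"
          by blast
        have "?l ^ Suc m * f = ?l ^ m * (g + ?b * c)" by (simp add: g_def algebra_simps)
        also have "\<dots> = (q + ?l ^ m * ?b) * c + r" using r(1) by (simp add: algebra_simps)
        finally show ?thesis using m r(2-) b l \<open>deg_in v g < ?d\<close> False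
          by (intro exI[of _ "Suc m"] exI[of _ "q + ?l ^ m * ?b"] exI[of _ r]) auto
      qed
    qed
  qed
  then show ?thesis using that by blast
qed

section \<open>Divisibility\<close>

text \<open>The sum of the partial degrees rather than the usual total degree: it is additive on
  products because each \<open>deg_in\<close> is, and it vanishes exactly on constants. It measures
  progress in the inductions over factorizations.\<close>

definition total_deg :: "('y, 'd, 'a::zero) dpoly \<Rightarrow> nat" where
  "total_deg p = (\<Sum>v\<in>vars p. deg_in v p)"

lemma total_deg_eq_0_iff: "total_deg p = 0 \<longleftrightarrow> p \<in> range const"
  by (auto simp: total_deg_def deg_in_eq_0_iff simp flip: vars_empty_iff)


lemma total_deg_mult:
  fixes p q :: "('y::linorder, 'd::linorder, 'a::field) dpoly"
  assumes "p \<noteq> 0" "q \<noteq> 0"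
  shows "total_deg (p * q) = total_deg p + total_deg q"
proof -
  have *: "(\<Sum>v\<in>vars p \<union> vars q. deg_in v r) = total_deg r" if "vars r \<subseteq> vars p \<union> vars q"
    for r :: "('y, 'd, 'a) dpoly"
    unfolding total_deg_def using that
    by (intro sum.mono_neutral_right) (auto simp: deg_in_eq_0_iff)
  have "total_deg (p * q) = (\<Sum>v\<in>vars p \<union> vars q. deg_in v p + deg_in v q)"
    unfolding total_deg_def vars_mult_eq[OF assms] by (simp add: deg_in_mult assms)
  also have "\<dots> = total_deg p + total_deg q"
    by (simp add: sum.distrib *)
  finally show ?thesis .
qed

section \<open>Irreducible factors, Gauss's lemma and gcds\<close>

lemma exists_irreducible_dvd:
  fixes p :: "('y::linorder, 'd::linorder, 'a::field) dpoly"
  assumes "p \<noteq> 0" "\<not> p dvd 1"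
  shows "\<exists>q. irreducible q \<and> q dvd p"
  using assms
proof (induction "total_deg p" arbitrary: p rule: less_induct)
  case less
  show ?case
  proof (cases "irreducible p")
    case False
    then obtain a b where ab: "p = a * b" "\<not> a dvd 1" "\<not> b dvd 1"
      using less.prems by (auto simp: irreducible_def)
    then have nz: "a \<noteq> 0" "b \<noteq> 0" using less.prems by auto
    then have "total_deg b \<noteq> 0" using ab(3) by (simp add: total_deg_eq_0_iff is_unit_dpoly_iff)
    then have "total_deg a < total_deg p" using nz ab(1) by (simp add: total_deg_mult)
    from less.hyps[OF this nz(1) ab(2)] show ?thesis using ab(1) by auto
  qed auto
qed

text \<open>Only the factors \<open>f\<close> and \<open>g\<close> are confined to
  \<open>polys V\<close>; \<open>dvd\<close> is divisibility in the whole ring. Relativizing to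
  \<open>V\<close> allows an induction on the set of variables.\<close>

definition prime_on :: "('y, 'd) dvar set \<Rightarrow> ('y, 'd, 'a::comm_ring_1) dpoly \<Rightarrow> bool" where
  "prime_on V p \<longleftrightarrow> (\<forall>f\<in>polys V. \<forall>g\<in>polys V. p dvd f * g \<longrightarrow> p dvd f \<or> p dvd g)"

text \<open>Each irreducible factor of \<open>c\<close> is prime on \<open>polys W\<close>, so it
  divides \<open>q\<close> or \<open>m\<close> and can be moved there. This takes the place of
  clearing denominators in a fraction field.\<close>

lemma split_product:
  fixes c a q m :: "('y::linorder, 'd::linorder, 'a::field) dpoly"
  assumes "c \<noteq> 0" "\<And>p. irreducible p \<Longrightarrow> p dvd c \<Longrightarrow> prime_on W p"
    and "q \<in> polys W" "m \<in> polys W" "c * a = q * m"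
  shows "\<exists>c1 c2 q1 m1. c = c1 * c2 \<and> q = c1 * q1 \<and> m = c2 * m1 \<and> a = q1 * m1"
  using assms
proof (induction "total_deg c" arbitrary: c q m rule: less_induct)
  case less
  show ?case
  \<comment> \<open>Set apart because the induction needs the quotients of \<open>q\<close> and
    \<open>m\<close> in \<open>polys W\<close>, which is only known for divisors of nonzero
    elements.\<close>
  proof (cases "a = 0")
    case True
    then have "q = 0 \<or> m = 0" using less.prems by auto
    then show ?thesis
    proof
      assume "q = 0"
      then show ?thesis using True by (intro exI[of _ c] exI[of _ 1] exI[of _ 0] exI[of _ m]) auto
    next
      assume "m = 0"
      then show ?thesis using True by (intro exI[of _ 1] exI[of _ c] exI[of _ q] exI[of _ 0]) auto
    qed
  next
    case a0: False
    then have nz: "q \<noteq> 0" "m \<noteq> 0" using less.prems by auto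
    show ?thesis
    proof (cases "c dvd 1")
      case True
      then obtain u where u: "1 = c * u" by (elim dvdE)
      have "q = c * (u * q)" using u by (simp flip: mult.assoc)
      moreover have "a = u * q * m" using u less.prems(5) by (metis mult.assoc mult.commute mult_1)
      ultimately show ?thesis
        by (intro exI[of _ c] exI[of _ 1] exI[of _ "u * q"] exI[of _ m]) auto
    next
      case False
      with exists_irreducible_dvd less.prems(1) obtain p where p: "irreducible p" "p dvd c" by blast
      then obtain c' where c': "c = p * c'" by (elim dvdE)
      have c'0: "c' \<noteq> 0" "p \<noteq> 0" using c' less.prems(1) by auto
      have "\<not> p dvd 1" using p by (simp add: irreducible_def)
      then have lt: "total_deg c' < total_deg c"
        using c' c'0 total_deg_eq_0_iff[of p] by (auto simp: total_deg_mult is_unit_dpoly_iff)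
      have pr: "\<And>p. irreducible p \<Longrightarrow> p dvd c' \<Longrightarrow> prime_on W p"
        using less.prems(2) c' by (simp add: dvd_mult)
      have "p dvd q * m" by (simp flip: less.prems(5) add: p(2))
      then consider "p dvd q" | "p dvd m"
        using less.prems(2)[OF p] less.prems(3,4) by (auto simp: prime_on_def)
      then show ?thesis
      proof cases
        case 1
        then obtain q' where q': "q = p * q'" by (elim dvdE)
        have "c' * a = q' * m" using less.prems(5) c'0 unfolding c' q' by (simp add: mult.assoc)
        moreover have "q' \<in> polys W" using polys_dvd[OF less.prems(3)] q' nz by simp
        ultimately obtain c1 c2 q1 m1 where "c' = c1 * c2" "q' = c1 * q1" "m = c2 * m1" "a = q1 * m1"
          using less.hyps[OF lt c'0(1) pr] less.prems by blast
        then show ?thesis using c' q'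
          by (intro exI[of _ "p * c1"] exI[of _ c2] exI[of _ q1] exI[of _ m1]) (auto simp: mult_ac)
      next
        case 2
        then obtain m' where m': "m = p * m'" by (elim dvdE)
        have "p * (c' * a) = p * (q * m')" using less.prems(5) unfolding c' m' by (simp add: mult_ac)
        then have "c' * a = q * m'" using c'0 by simp
        moreover have "m' \<in> polys W" using polys_dvd[OF less.prems(4)] m' nz by simp
        ultimately obtain c1 c2 q1 m1 where "c' = c1 * c2" "q = c1 * q1" "m' = c2 * m1" "a = q1 * m1"
          using less.hyps[OF lt c'0(1) pr] less.prems by blast
        then show ?thesis using c' m'
          by (intro exI[of _ c1] exI[of _ "p * c2"] exI[of _ q1] exI[of _ m1]) (auto simp: mult_ac)
      qed
    qed
  qed
qed

lemma free_dvd_iff: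
  fixes p f :: "('y, 'd, 'b::comm_ring_1) dpoly"
  assumes "x \<notin> vars p"
  shows "p dvd f \<longleftrightarrow> (\<forall>j. p dvd coeff_in x j f)"
proof
  assume "p dvd f"
  then show "\<forall>j. p dvd coeff_in x j f" by (auto simp: coeff_in_mult_free[OF assms] elim!: dvdE)
next
  assume "\<forall>j. p dvd coeff_in x j f"
  then show "p dvd f"
    using dvd_sum[of "{..deg_in x f}" p "\<lambda>j. coeff_in x j f * var x ^ j"]
    by (simp flip: dpoly_eq_sum_coeff_in[of x f, OF order.refl])
qed

text \<open>As \<open>p\<close> does not contain \<open>x\<close>, it divides a polynomial iff it
  divides all its coefficients in \<open>x\<close>. If \<open>i\<close> and \<open>k\<close> are the
  least indices of coefficients of \<open>f\<close> and \<open>g\<close> not divisible by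
  \<open>p\<close>, the coefficient of index \<open>i + k\<close> in \<open>f * g\<close> is, modulo
  \<open>p\<close>, the product of these two.\<close>

lemma prime_on_insert:
  assumes "prime_on V p" "p \<in> polys V" "x \<notin> V"
  shows "prime_on (insert x V) p"
  unfolding prime_on_def
proof (intro ballI impI, rule ccontr)
  fix f g assume fg: "f \<in> polys (insert x V)" "g \<in> polys (insert x V)" "p dvd f * g"
    and n: "\<not> (p dvd f \<or> p dvd g)"
  have x: "x \<notin> vars p" using assms by (auto dest: polysD)
  have cV: "coeff_in x j h \<in> polys V" if "h \<in> polys (insert x V)" for j h
    using vars_coeff_in[of x j h] that by (auto simp: polys_def)
  define i where "i = (LEAST i. \<not> p dvd coeff_in x i f)"
  define k where "k = (LEAST k. \<not> p dvd coeff_in x k g)"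
  have "\<exists>i. \<not> p dvd coeff_in x i f" using n free_dvd_iff[OF x, of f] by blast
  then have i: "\<not> p dvd coeff_in x i f" unfolding i_def by (rule LeastI_ex)
  have "\<exists>k. \<not> p dvd coeff_in x k g" using n free_dvd_iff[OF x, of g] by blast
  then have k: "\<not> p dvd coeff_in x k g" unfolding k_def by (rule LeastI_ex)
  have li: "p dvd coeff_in x l f" if "l < i" for l using not_less_Least that unfolding i_def by blast
  have lk: "p dvd coeff_in x l g" if "l < k" for l using not_less_Least that unfolding k_def by blast
  have "p dvd coeff_in x (i + k) (f * g)" using fg(3) free_dvd_iff[OF x] by blast
  also have "coeff_in x (i + k) (f * g) = coeff_in x i f * coeff_in x k g
      + (\<Sum>l\<in>{..i+k} - {i}. coeff_in x l f * coeff_in x (i + k - l) g)"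
    unfolding coeff_in_mult by (subst sum.remove[of _ i]) auto
  finally have "p dvd coeff_in x i f * coeff_in x k g"
  proof (subst (asm) dvd_add_left_iff)
    show "p dvd (\<Sum>l\<in>{..i + k} - {i}. coeff_in x l f * coeff_in x (i + k - l) g)"
    proof (rule dvd_sum)
      fix l assume "l \<in> {..i + k} - {i}"
      then have "l < i \<or> i + k - l < k" by auto
      then show "p dvd coeff_in x l f * coeff_in x (i + k - l) g"
        using li lk by (auto intro: dvd_mult dvd_mult2)
    qed
  qed
  then show False using assms(1) cV fg i k unfolding prime_on_def by blast
qed

text \<open>Gauss's lemma, one variable at a time: a nonzero element of minimal degree in the
  ideal generated by \<open>p\<close> and \<open>f\<close> plays the role of their gcd over the fraction field.\<close>

lemma irreducible_imp_prime_on: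
  fixes p :: "('y::linorder, 'd::linorder, 'a::field) dpoly"
  assumes "finite V" "p \<in> polys V" "irreducible p"
  shows "prime_on V p"
  using assms
proof (induction V arbitrary: p rule: finite_induct)
  case empty
  then have "p dvd 1" by (auto simp: polys_def vars_empty_iff is_unit_dpoly_iff irreducible_def)
  then show ?case using empty by (simp add: irreducible_def)
next
  case (insert x V)
  let ?W = "insert x V"
  have pV: "prime_on ?W s" if "s \<in> polys V" "irreducible s" for s :: "('y, 'd, 'a) dpoly"
    using insert that by (intro prime_on_insert) auto
  show ?case
  proof (cases "x \<in> vars p")
    case False
    then have "p \<in> polys V" using insert by (auto simp: polys_def)
    then show ?thesis using pV insert by blast
  next
    case True
    have p0: "p \<noteq> 0" using insert by (auto simp: irreducible_def)
    \<comment> \<open>Factors free of \<open>x\<close> can be cancelled: the part \<open>c1\<close>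
      of \<open>p\<close> that comes from \<open>c\<close> is free of \<open>x\<close>, while
      \<open>p\<close> contains \<open>x\<close>, so irreducibility makes \<open>c1\<close> a
      unit.\<close>
    have cancel: "p dvd a" if c: "c \<noteq> 0" "c \<in> polys V" and a: "a \<in> polys ?W" and d: "p dvd c * a" for c a
    proof (cases "a = 0")
      case False
      obtain t where t: "c * a = p * t" using d by (elim dvdE)
      have cW: "c \<in> polys ?W" using c by (auto simp: polys_def)
      then have "c * a \<in> polys ?W" using a by (rule polys_mult)
      then have tW: "t \<in> polys ?W" using t c False by (intro polys_dvd[of "c * a" _ t]) auto
      have "prime_on ?W s" if "irreducible s" "s dvd c" for s
        using pV[of s] polys_dvd[OF c(2) that(2) c(1)] that by blast
      then obtain c1 c2 p1 t1 where s: "c = c1 * c2" "p = c1 * p1" "t = c2 * t1" "a = p1 * t1"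
        using split_product[OF c(1) _ insert.prems(1) tW t] by metis
      have "c1 \<in> polys V" using polys_dvd[OF c(2) _ c(1), of c1] s(1) by simp
      then have "\<not> p dvd c1" using vars_dvd[of p c1] True s(1) c insert.hyps by (auto simp: polys_def)
      then have "\<not> p1 dvd 1" using s(2) by auto
      then have "c1 dvd 1" using irreducibleD[OF insert.prems(2) s(2)] by blast
      then have "p dvd p1" using s(2) by simp
      then show ?thesis using s(4) by simp
    qed simp
    show ?thesis
      unfolding prime_on_def
    proof (intro ballI impI, rule disjCI)
      fix f g assume f: "f \<in> polys ?W" and g: "g \<in> polys ?W" and pfg: "p dvd f * g" and ng: "\<not> p dvd g"
      define J where "J = {s * p + t * f | s t. s \<in> polys ?W \<and> t \<in> polys ?W}"
      have Jsub: "a - q * b \<in> J" if ab: "a \<in> J" "b \<in> J" and q: "q \<in> polys ?W" for a b q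
      proof -
        from ab obtain s t s' t' where e: "a = s * p + t * f" "b = s' * p + t' * f"
          and W: "s \<in> polys ?W" "t \<in> polys ?W" "s' \<in> polys ?W" "t' \<in> polys ?W"
          unfolding J_def by blast
        have "a - q * b = (s - q * s') * p + (t - q * t') * f" by (simp add: e algebra_simps)
        moreover have "s - q * s' \<in> polys ?W" "t - q * t' \<in> polys ?W" using W q by auto
        ultimately show ?thesis unfolding J_def by blast
      qed
      have JW: "J \<subseteq> polys ?W" using f insert.prems unfolding J_def by auto
      have pJ: "p \<in> J" unfolding J_def by (intro CollectI exI[of _ 1] exI[of _ 0]) auto
      have fJ: "f \<in> J" unfolding J_def by (intro CollectI exI[of _ 0] exI[of _ 1]) auto
      have Jmult: "q * a \<in> J" if "a \<in> J" "q \<in> polys ?W" for a q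
      proof -
        have "0 \<in> J" using Jsub[OF pJ pJ, of 1] by auto
        from Jsub[OF this that(1), of "- q"] show ?thesis using that by auto
      qed
      obtain m where m: "m \<in> J" "m \<noteq> 0" and min: "\<And>b. b \<in> J \<Longrightarrow> b \<noteq> 0 \<Longrightarrow> deg_in x m \<le> deg_in x b"
        using ex_has_least_nat[of "\<lambda>m. m \<in> J \<and> m \<noteq> 0" p "deg_in x"] pJ p0 by blast
      have mW: "m \<in> polys ?W" using m JW by auto
      let ?l = "coeff_in x (deg_in x m) m"
      have l: "?l \<noteq> 0" "?l \<in> polys V"
        using m lead_coeff_in_eq_0_iff[of x m] mW vars_coeff_in[of x "deg_in x m" m] by (auto simp: polys_def)
      have div: "\<exists>e q. ?l ^ e * a = q * m \<and> q \<in> polys ?W" if a: "a \<in> J" for a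
      proof -
        have aW: "a \<in> polys ?W" using a JW by auto
        from pseudo_division[OF mW aW, of x] obtain e q r where
          er: "?l ^ e * a = q * m + r" "r = 0 \<or> deg_in x r < deg_in x m" "q \<in> polys ?W" "r \<in> polys ?W"
          by metis
        have "?l ^ e \<in> polys ?W" using mW by auto
        \<comment> \<open>The pseudo-remainder lies in \<open>J\<close> again, so minimality of the
          degree of \<open>m\<close> forces it to be 0.\<close>
        then have "?l ^ e * a - q * m \<in> J" using a m er by (intro Jsub Jmult)
        then have "r \<in> J" using er by simp
        then have "r = 0" using er(2) min[of r] by (metis leD)
        then show ?thesis using er by auto
      qed
      obtain e q where eq: "?l ^ e * p = q * m" "q \<in> polys ?W" using div[OF pJ] by blast
      have le: "?l ^ e \<noteq> 0" "?l ^ e \<in> polys V" for e using l by auto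
      have "prime_on ?W s" if "irreducible s" "s dvd ?l ^ e" for s
        using pV[of s] polys_dvd[OF le(2) that(2) le(1)] that by blast
      then obtain c1 c2 q1 m1 where s: "?l ^ e = c1 * c2" "q = c1 * q1" "m = c2 * m1" "p = q1 * m1"
        using split_product[OF le(1)[of e] _ eq(2) mW eq(1)] by metis
      \<comment> \<open>If \<open>q1\<close> is a unit, \<open>p\<close> divides \<open>m\<close>,
        hence a multiple of \<open>f\<close> by a factor free of \<open>x\<close>. If
        \<open>m1\<close> is a unit, \<open>m\<close> itself is free of \<open>x\<close>, and as a
        combination of \<open>p\<close> and \<open>f\<close> it satisfies
        \<open>p dvd m * g\<close>, which contradicts \<open>ng\<close> after cancellation.\<close>
      from irreducibleD[OF insert.prems(2) s(4)] show "p dvd f"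
      proof
        assume "q1 dvd 1"
        then have "p dvd m1" using s(4) by simp
        then have "p dvd m" using s(3) by simp
        obtain e' q' where "?l ^ e' * f = q' * m" using div[OF fJ] by blast
        then have "p dvd ?l ^ e' * f" using \<open>p dvd m\<close> by simp
        then show "p dvd f" using cancel[OF le f] by blast
      next
        assume "m1 dvd 1"
        then have "m1 \<in> polys V" by (auto simp: is_unit_dpoly_iff)
        moreover have "c2 \<in> polys V" using polys_dvd[OF le(2) _ le(1), of c2 e] s(1) by simp
        ultimately have mV: "m \<in> polys V" using s(3) by auto
        obtain s t where st: "m = s * p + t * f" using m unfolding J_def by blast
        have "m * g = (s * g) * p + t * (f * g)" by (simp add: st algebra_simps)
        then have "p dvd m * g" using pfg by simp
        with cancel[OF m(2) mV g] ng show "p dvd f" by blast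
      qed
    qed
  qed
qed

lemma irreducible_imp_prime:
  fixes p :: "('y::linorder, 'd::linorder, 'a::field) dpoly"
  assumes "irreducible p" "p dvd f * g"
  shows "p dvd f \<or> p dvd g"
proof -
  have "prime_on (vars p \<union> vars f \<union> vars g) p"
    using assms by (intro irreducible_imp_prime_on) (auto simp: polys_def)
  then show ?thesis using assms by (auto simp: prime_on_def polys_def)
qed

text \<open>Irreducible factors \<open>p\<close> are peeled off \<open>a\<close>. If
  \<open>p\<close> divides all of \<open>S\<close>, it is a factor of the gcd and the induction
  continues with \<open>S\<close> divided by \<open>p\<close>, which is why \<open>S\<close> varies.
  Otherwise no common divisor is divisible by \<open>p\<close>, so all of them already divide the
  cofactor. \<open>S\<close> may be infinite, since \<open>a\<close> alone bounds the
  process.\<close>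

lemma ex_gcd:
  fixes a :: "('y::linorder, 'd::linorder, 'a::field) dpoly"
  assumes "a \<noteq> 0"
  shows "\<exists>d. d dvd a \<and> (\<forall>s\<in>S. d dvd s) \<and> (\<forall>e. e dvd a \<longrightarrow> (\<forall>s\<in>S. e dvd s) \<longrightarrow> e dvd d)"
  using assms
proof (induction "total_deg a" arbitrary: a S rule: less_induct)
  case less
  show ?case
  proof (cases "a dvd 1")
    case True
    then show ?thesis by (intro exI[of _ 1]) (auto intro: dvd_trans)
  next
    case False
    with exists_irreducible_dvd less.prems obtain p where p: "irreducible p" "p dvd a" by blast
    then obtain a' where a': "a = p * a'" by (elim dvdE)
    have nz: "a' \<noteq> 0" "p \<noteq> 0" using a' less.prems by auto
    have "\<not> p dvd 1" using p by (simp add: irreducible_def)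
    then have lt: "total_deg a' < total_deg a"
      using a' nz total_deg_eq_0_iff[of p] by (auto simp: total_deg_mult is_unit_dpoly_iff)
    \<comment> \<open>By primality \<open>p\<close> divides \<open>e\<close> or its cofactor, and in
      the latter case it cancels.\<close>
    have split: "e dvd a' \<or> p dvd e" if e: "e dvd a" for e
    proof -
      obtain t where t: "p * a' = e * t" using e unfolding a' by (elim dvdE)
      have "p dvd e * t" unfolding t[symmetric] by simp
      then consider "p dvd e" | t' where "t = p * t'" using irreducible_imp_prime[OF p(1)] unfolding dvd_def by metis
      then show ?thesis
      proof cases
        case 2
        then have "p * a' = p * (e * t')" using t by (simp add: mult_ac)
        then show ?thesis using nz by simp
      qed simp
    qed
    show ?thesis
    proof (cases "\<forall>s\<in>S. p dvd s")
      case True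
      let ?S = "{s. p * s \<in> S}"
      obtain d where d: "d dvd a'" "\<forall>s\<in>?S. d dvd s" "\<And>e. e dvd a' \<Longrightarrow> \<forall>s\<in>?S. e dvd s \<Longrightarrow> e dvd d"
        using less.hyps[OF lt nz(1), of ?S] by blast
      have "e dvd p * d" if e: "e dvd a" "\<forall>s\<in>S. e dvd s" for e
      proof (cases "p dvd e")
        case True
        then obtain e' where e': "e = p * e'" by (elim dvdE)
        have "e' dvd a'" using e(1) nz by (simp add: e' a')
        moreover have "\<forall>s\<in>?S. e' dvd s" using e(2) nz by (auto simp: e')
        ultimately show ?thesis using d(3) by (auto simp: e')
      next
        case False
        then have "e dvd a'" using split e by blast
        moreover have "e dvd s" if s: "p * s \<in> S" for s
        proof -
          obtain t where t: "p * s = e * t" using e(2) s unfolding dvd_def by blast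
          have "p dvd e * t" unfolding t[symmetric] by simp
          then obtain t' where "t = p * t'" using irreducible_imp_prime[OF p(1)] False unfolding dvd_def by metis
          then have "p * s = p * (e * t')" using t by (simp add: mult_ac)
          then show ?thesis using nz by simp
        qed
        ultimately show ?thesis using d(3) by simp
      qed
      moreover have "p * d dvd s" if "s \<in> S" for s
      proof -
        obtain s' where "s = p * s'" using True \<open>s \<in> S\<close> unfolding dvd_def by blast
        then show ?thesis using d(2) that by auto
      qed
      moreover have "p * d dvd a" using d(1) a' by simp
      ultimately show ?thesis by blast
    next
      case False
      obtain d where d: "d dvd a'" "\<forall>s\<in>S. d dvd s" "\<And>e. e dvd a' \<Longrightarrow> \<forall>s\<in>S. e dvd s \<Longrightarrow> e dvd d"
        using less.hyps[OF lt nz(1), of S] by blast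
      have "e dvd d" if e: "e dvd a" "\<forall>s\<in>S. e dvd s" for e
      proof -
        have "\<not> p dvd e" using e False dvd_trans by blast
        then show ?thesis using split e d(3) by blast
      qed
      then show ?thesis using d a' by (intro exI[of _ d]) auto
    qed
  qed
qed

text \<open>Splitting \<open>a\<close> along \<open>b * g\<close> writes \<open>f\<close> as
  \<open>b1 * g1\<close> and \<open>g\<close> as \<open>c2 * g1\<close> with \<open>b1\<close> and
  \<open>c2\<close> dividing \<open>b\<close> and \<open>a\<close>. Both thus lie in
  \<open>polys N\<close>, and primitivity makes them constants.\<close>

lemma primitive_proportional:
  fixes f g :: "('y::linorder, 'd::linorder, 'a::field) dpoly"
  assumes "a \<in> polys N" "b \<in> polys N" "a \<noteq> 0" "b \<noteq> 0" "a * f = b * g"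
    and f: "\<And>q. q \<in> polys N \<Longrightarrow> q dvd f \<Longrightarrow> q \<in> range const"
    and g: "\<And>q. q \<in> polys N \<Longrightarrow> q dvd g \<Longrightarrow> q \<in> range const"
  shows "\<exists>c. f = const c * g"
proof -
  have "prime_on UNIV p" if "irreducible p" for p :: "('y, 'd, 'a) dpoly"
    using irreducible_imp_prime[OF that] by (simp add: prime_on_def)
  then obtain c1 c2 b1 g1 where s: "a = c1 * c2" "b = c1 * b1" "g = c2 * g1" "f = b1 * g1"
    using split_product[OF assms(3) _ _ _ assms(5), of UNIV] by (auto simp: polys_def)
  have "c2 \<in> polys N" "b1 \<in> polys N"
    using s(1,2) polys_dvd[OF assms(1) _ assms(3), of c2] polys_dvd[OF assms(2) _ assms(4), of b1] by auto
  then obtain x y where xy: "c2 = const x" "b1 = const y" using f[of b1] g[of c2] s by auto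
  have "x \<noteq> 0" using s(1) assms xy by auto
  then have "f = const (y / x) * g" using s xy by (simp flip: mult.assoc const_mult)
  then show ?thesis by blast
qed

section \<open>Pseudo-remainders\<close>

text \<open>The multiplicative monoid generated by \<open>A\<close>. Successive pseudo-divisions
  multiply by powers of different initials, and only membership in this monoid is recorded.\<close>

inductive_set products :: "'r::monoid_mult set \<Rightarrow> 'r set" for A where
  one: "1 \<in> products A"
| mult: "a \<in> A \<Longrightarrow> b \<in> products A \<Longrightarrow> a * b \<in> products A"

lemma products_subset:
  assumes "A \<subseteq> S" "1 \<in> S" "\<And>a b. a \<in> S \<Longrightarrow> b \<in> S \<Longrightarrow> a * b \<in> S"
  shows "products A \<subseteq> S"
proof
  show "x \<in> S" if "x \<in> products A" for x
    using that by induction (use assms in auto)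
qed

lemma products_mult: "a \<in> products A \<Longrightarrow> b \<in> products A \<Longrightarrow> a * b \<in> products A"
  by (induction a rule: products.induct) (auto simp: mult.assoc intro: products.intros)

lemma products_power: "a \<in> A \<Longrightarrow> a ^ n \<in> products A"
  by (induction n) (auto intro: products.intros)

lemma products_mono: "A \<subseteq> B \<Longrightarrow> products A \<subseteq> products B"
  by (rule products_subset) (use products.mult[OF _ products.one, of _ B] in \<open>auto intro: products.one products_mult\<close>)

text \<open>The span of the finite set \<open>B\<close> over \<open>polys W\<close>. For
  \<open>B\<close> inside \<open>polys W\<close> it is the ideal generated there, as in
  pseudo-division; for other \<open>B\<close> it is just a finitely generated module, as in the
  elimination argument.\<close>

definition lincombs :: "('y, 'd) dvar set \<Rightarrow> ('y, 'd, 'a::comm_ring_1) dpoly set \<Rightarrow> ('y, 'd, 'a) dpoly set" where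
  "lincombs W B = {\<Sum>c\<in>B. q c * c | q. \<forall>c. q c \<in> polys W}"

lemma lincombs_0: "0 \<in> lincombs W B"
  unfolding lincombs_def by (auto intro!: exI[of _ "\<lambda>_. 0"])

lemma lincombs_add: "x \<in> lincombs W B \<Longrightarrow> y \<in> lincombs W B \<Longrightarrow> x + y \<in> lincombs W B"
proof -
  assume "x \<in> lincombs W B" "y \<in> lincombs W B"
  then obtain q r where "x = (\<Sum>c\<in>B. q c * c)" "y = (\<Sum>c\<in>B. r c * c)"
    "\<And>c. q c \<in> polys W" "\<And>c. r c \<in> polys W"
    unfolding lincombs_def by blast
  then show ?thesis unfolding lincombs_def
    by (intro CollectI exI[of _ "\<lambda>c. q c + r c"]) (auto simp: distrib_right sum.distrib)
qed

lemma lincombs_mult: "x \<in> lincombs W B \<Longrightarrow> a \<in> polys W \<Longrightarrow> a * x \<in> lincombs W B"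
proof -
  assume "x \<in> lincombs W B" "a \<in> polys W"
  then obtain q where "x = (\<Sum>c\<in>B. q c * c)" "\<And>c. q c \<in> polys W" "a \<in> polys W"
    unfolding lincombs_def by blast
  then show ?thesis unfolding lincombs_def
    by (intro CollectI exI[of _ "\<lambda>c. a * q c"]) (auto simp: sum_distrib_left mult.assoc)
qed

lemma lincombs_gen: "finite B \<Longrightarrow> c \<in> B \<Longrightarrow> c \<in> lincombs W B"
  unfolding lincombs_def
  by (intro CollectI exI[of _ "\<lambda>d. if d = c then 1 else 0"]) (auto simp: if_distrib[of "\<lambda>x. x * _"] cong: if_cong)

lemma lincombs_mono: "finite B \<Longrightarrow> A \<subseteq> B \<Longrightarrow> lincombs W A \<subseteq> lincombs W B"
proof
  fix x assume "finite B" "A \<subseteq> B" "x \<in> lincombs W A"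
  then obtain q where "x = (\<Sum>c\<in>A. q c * c)" "\<And>c. q c \<in> polys W"
    unfolding lincombs_def by blast
  then show "x \<in> lincombs W B" using \<open>finite B\<close> \<open>A \<subseteq> B\<close> unfolding lincombs_def
    by (intro CollectI exI[of _ "\<lambda>c. if c \<in> A then q c else 0"])
       (auto intro!: sum.mono_neutral_cong_left)
qed

text \<open>With generators free of \<open>v\<close>, taking a coefficient in \<open>v\<close> acts
  on the multipliers only. In step (a) this turns a congruence between polynomials into one between
  their initials.\<close>

lemma lincombs_coeff_in:
  assumes "x \<in> lincombs W B" "\<And>c. c \<in> B \<Longrightarrow> v \<notin> vars c"
  shows "coeff_in v j x \<in> lincombs W B"
proof -
  obtain q where q: "x = (\<Sum>c\<in>B. q c * c)" "\<And>c. q c \<in> polys W"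
    using assms(1) unfolding lincombs_def by blast
  have "coeff_in v j x = (\<Sum>c\<in>B. coeff_in v j (q c) * c)"
    unfolding q(1) coeff_in_sum using assms(2)
    by (intro sum.cong refl) (simp add: mult.commute[of "q _"] mult.commute[of "coeff_in v j _"] coeff_in_mult_free)
  then show ?thesis using q(2) unfolding lincombs_def
    by (intro CollectI exI[of _ "\<lambda>c. coeff_in v j (q c)"]) auto
qed

lemma lincombs_ideal:
  assumes "x \<in> lincombs W B" "is_ideal J" "B \<subseteq> J"
  shows "x \<in> J"
proof -
  obtain q where q: "x = (\<Sum>c\<in>B. q c * c)" using assms(1) unfolding lincombs_def by blast
  have "(\<Sum>c\<in>A. q c * c) \<in> J" if "A \<subseteq> B" for A
    using that
  proof (induction A rule: infinite_finite_induct)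
    case (insert c A)
    then show ?case using assms(2,3) unfolding is_ideal_def by auto
  qed (use assms(2) in \<open>auto simp: is_ideal_def\<close>)
  then show ?thesis using q by simp
qed

lemma pseudo_rem1_ex:
  fixes c f :: "('y, 'd, 'a::comm_ring_1) dpoly"
  assumes "0 < ldeg le c"
  shows "\<exists>r. pseudo_rem1 le c f r"
proof -
  obtain m q r where "m \<le> deg_in (leader le c) f + 1 - deg_in (leader le c) c"
    "coeff_in (leader le c) (deg_in (leader le c) c) c ^ m * f = q * c + r"
    "r = 0 \<or> deg_in (leader le c) r < deg_in (leader le c) c"
    using pseudo_division[of c UNIV f "leader le c"] by (auto simp: polys_def)
  moreover from this(3) have "deg_in (leader le c) r < deg_in (leader le c) c"
    using assms by (auto simp: ldeg_def)
  ultimately show ?thesis unfolding pseudo_rem1_def initial_def ldeg_def by blast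
qed

lemma pseudo_rems_ex:
  fixes f :: "('y, 'd, 'a::comm_ring_1) dpoly"
  assumes "\<And>c. c \<in> set cs \<Longrightarrow> 0 < ldeg le c"
  shows "\<exists>r. pseudo_rems le cs f r"
  using assms
proof (induction cs arbitrary: f)
  case (Cons c cs)
  obtain s where "pseudo_rem1 le c f s" using pseudo_rem1_ex Cons.prems by (metis list.set_intros(1))
  moreover obtain r where "pseudo_rems le cs s r" using Cons by fastforce
  ultimately show ?case by auto
qed auto

lemma vars_initial: "vars (initial le c) \<subseteq> vars c - {leader le c}"
  unfolding initial_def by (rule vars_coeff_in)

text \<open>Compare the coefficients of $v^j$ on both sides of \<open>I\<^sup>m f = q c + r\<close> for \<open>j > deg\<^sub>v f\<close>.\<close>

lemma pseudo_rem1_deg_aux: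
  fixes c :: "('y::linorder, 'd::linorder, 'a::idom) dpoly"
  assumes eq: "initial le c ^ m * f = q * c + r" and deg: "deg_in (leader le c) r < ldeg le c"
    and v: "v \<notin> vars c"
  shows "deg_in v q \<le> deg_in v f \<and> deg_in v r \<le> deg_in v f"
proof -
  let ?u = "leader le c"
  have "coeff_in v j q = 0 \<and> coeff_in v j r = 0" if j: "j > deg_in v f" for j
  proof -
    have "v \<notin> vars (initial le c ^ m)"
      using v vars_initial[of le c] polys_power[of "initial le c" "- {v}" m] by (auto simp: polys_def)
    then have "coeff_in v j (initial le c ^ m * f) = 0"
      using j by (simp add: coeff_in_mult_free coeff_in_eq_0)
    then have e: "c * coeff_in v j q + coeff_in v j r = 0"
      unfolding eq coeff_in_add by (simp add: mult.commute[of q] coeff_in_mult_free[OF v])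
    have less: "deg_in ?u (coeff_in v j r) < deg_in ?u c"
      using deg deg_in_coeff_in_le[of ?u v j r] by (simp add: ldeg_def)
    have c0: "c \<noteq> 0" using less by auto
    \<comment> \<open>A nonzero multiple of \<open>c\<close> has at least the degree of
      \<open>c\<close> in the leader, which is too much for a coefficient of
      \<open>r\<close>.\<close>
    have "coeff_in v j q = 0"
    proof (rule ccontr)
      assume "coeff_in v j q \<noteq> 0"
      then have "deg_in ?u (c * coeff_in v j q) \<ge> deg_in ?u c" using c0 by (simp add: deg_in_mult)
      moreover have "coeff_in v j r = - (c * coeff_in v j q)" using e by (simp add: eq_neg_iff_add_eq_0 add.commute)
      ultimately show False using less by (simp add: deg_in_eq_degree up_uminus)
    qed
    then show ?thesis using e by simp
  qed
  then show ?thesis by (auto intro!: deg_in_leI)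
qed

lemma pseudo_rem1_deg:
  fixes c :: "('y::linorder, 'd::linorder, 'a::idom) dpoly"
  assumes "pseudo_rem1 le c f r" "v \<notin> vars c"
  shows "deg_in v r \<le> deg_in v f"
  using assms pseudo_rem1_deg_aux unfolding pseudo_rem1_def by blast

text \<open>The definition of \<open>pseudo_rem1\<close> leaves the variables of \<open>q\<close>
  and \<open>r\<close> free. A variable outside \<open>W\<close> is absent from \<open>c\<close> and
  has degree 0 in \<open>f\<close>, so the degree bound excludes it from \<open>q\<close> and
  \<open>r\<close>.\<close>

lemma pseudo_rem1_lincombs:
  fixes c :: "('y::linorder, 'd::linorder, 'a::idom) dpoly"
  assumes "pseudo_rem1 le c f r" "c \<in> polys W" "f \<in> polys W"
  shows "\<exists>m. initial le c ^ m * f - r \<in> lincombs W {c}" "r \<in> polys W"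
proof -
  obtain m q where mq: "initial le c ^ m * f = q * c + r" "deg_in (leader le c) r < ldeg le c"
    using assms(1) unfolding pseudo_rem1_def by blast
  have "v \<in> W" if "v \<in> vars q \<union> vars r" for v
  proof (rule ccontr)
    assume "v \<notin> W"
    then have "v \<notin> vars c" "v \<notin> vars f" using assms by (auto dest: polysD)
    with pseudo_rem1_deg_aux[OF mq] have "deg_in v q = 0 \<and> deg_in v r = 0" by (metis deg_in_eq_0_iff le_zero_eq)
    then show False using that by (auto simp: deg_in_eq_0_iff)
  qed
  then have W: "q \<in> polys W" "r \<in> polys W" by (auto simp: polys_def)
  then show "r \<in> polys W" by simp
  have "q * c \<in> lincombs W {c}" using W by (intro lincombs_mult lincombs_gen) auto
  then show "\<exists>m. initial le c ^ m * f - r \<in> lincombs W {c}" using mq(1) by (intro exI[of _ m]) simp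
qed

lemma pseudo_rems_lincombs:
  fixes f :: "('y::linorder, 'd::linorder, 'a::idom) dpoly"
  assumes "pseudo_rems le cs f r" "set cs \<subseteq> polys W" "f \<in> polys W"
  shows "\<exists>M\<in>products (initial le ` set cs). M * f - r \<in> lincombs W (set cs)" "r \<in> polys W"
proof -
  have "(\<exists>M\<in>products (initial le ` set cs). M * f - r \<in> lincombs W (set cs)) \<and> r \<in> polys W"
    using assms
  proof (induction cs arbitrary: f)
    case Nil
    then show ?case by (auto intro!: bexI[of _ 1] products.one lincombs_0)
  next
    case (Cons c cs)
    then obtain s where s: "pseudo_rem1 le c f s" "pseudo_rems le cs s r" by auto
    have cW: "c \<in> polys W" "set cs \<subseteq> polys W" using Cons.prems by auto
    obtain m where m: "initial le c ^ m * f - s \<in> lincombs W {c}" and sW: "s \<in> polys W"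
      using pseudo_rem1_lincombs[OF s(1) cW(1) Cons.prems(3)] by blast
    obtain M where M: "M \<in> products (initial le ` set cs)" "M * s - r \<in> lincombs W (set cs)"
      and r: "r \<in> polys W"
      using Cons.IH[OF s(2) cW(2) sW] by blast
    have "products (initial le ` set cs) \<subseteq> polys W"
      using cW(2) by (intro products_subset) (auto simp: initial_def)
    then have MW: "M \<in> polys W" using M by auto
    have "initial le c ^ m * f - s \<in> lincombs W (set (c # cs))" "M * s - r \<in> lincombs W (set (c # cs))"
      using m M(2) lincombs_mono[of "set (c # cs)" "{c}" W] lincombs_mono[of "set (c # cs)" "set cs" W] by auto
    then have "M * (initial le c ^ m * f - s) + (M * s - r) \<in> lincombs W (set (c # cs))"
      using MW by (intro lincombs_add lincombs_mult)
    moreover have "M * (initial le c ^ m * f - s) + (M * s - r) = (initial le c ^ m * M) * f - r"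
      by (simp add: algebra_simps)
    moreover have "initial le c ^ m * M \<in> products (initial le ` set (c # cs))"
      using M(1) products_mono[of "initial le ` set cs" "initial le ` set (c # cs)"]
      by (intro products_mult products_power) auto
    ultimately show ?case using r by metis
  qed
  then show "\<exists>M\<in>products (initial le ` set cs). M * f - r \<in> lincombs W (set cs)" "r \<in> polys W"
    by auto
qed

lemma pseudo_rems_deg:
  fixes f :: "('y::linorder, 'd::linorder, 'a::idom) dpoly"
  assumes "pseudo_rems le cs f r" "\<And>c. c \<in> set cs \<Longrightarrow> v \<notin> vars c"
  shows "deg_in v r \<le> deg_in v f"
  using assms
proof (induction cs arbitrary: f)
  case (Cons c cs)
  then obtain s where s: "pseudo_rem1 le c f s" "pseudo_rems le cs s r" by auto
  have "deg_in v r \<le> deg_in v s" using Cons s by auto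
  also have "\<dots> \<le> deg_in v f" using pseudo_rem1_deg[OF s(1)] Cons.prems(2) by auto
  finally show ?case .
qed simp

text \<open>Division by \<open>c\<close> makes the degree in its leader small, and the later
  divisors do not contain this leader, so the later divisions cannot raise the degree again.\<close>

lemma pseudo_rems_reduced:
  fixes f :: "('y::linorder, 'd::linorder, 'a::idom) dpoly"
  assumes "pseudo_rems le cs f r" "sorted_wrt (\<lambda>c d. leader le c \<notin> vars d) cs" "c \<in> set cs"
  shows "deg_in (leader le c) r < ldeg le c"
  using assms
proof (induction cs arbitrary: f)
  case (Cons d cs)
  then obtain s where s: "pseudo_rem1 le d f s" "pseudo_rems le cs s r" by auto
  show ?case
  proof (cases "c \<in> set cs")
    case False
    then have "c = d" using Cons.prems by auto
    then have "deg_in (leader le c) r \<le> deg_in (leader le c) s" using s(2) Cons.prems by (intro pseudo_rems_deg) auto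
    also have "\<dots> < ldeg le c" using s(1) \<open>c = d\<close> by (auto simp: pseudo_rem1_def)
    finally show ?thesis .
  qed (use Cons s in auto)
qed simp

section \<open>Linear dependence over a polynomial subring\<close>

text \<open>Fraction-free elimination.\<close>

lemma linear_dependence:
  fixes r :: "'i \<Rightarrow> ('y::linorder, 'd::linorder, 'a::idom) dpoly"
  assumes "finite E" "finite K" "card K > card E" "\<And>j. j \<in> K \<Longrightarrow> r j \<in> lincombs W E"
  shows "\<exists>a. (\<forall>j. a j \<in> polys W) \<and> (\<exists>j\<in>K. a j \<noteq> 0) \<and> (\<Sum>j\<in>K. a j * r j) = 0"
  using assms
proof (induction E arbitrary: K r rule: finite_induct)
  case empty
  then have "K \<noteq> {}" by auto
  then show ?case using empty by (intro exI[of _ "\<lambda>_. 1"]) (auto simp: lincombs_def)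
next
  case (insert b E)
  have "\<exists>c s. c \<in> polys W \<and> s \<in> lincombs W E \<and> r j = c * b + s" if j: "j \<in> K" for j
  proof -
    obtain q where q: "r j = (\<Sum>c\<in>insert b E. q c * c)" "\<forall>c. q c \<in> polys W"
      using insert.prems(3)[OF j] unfolding lincombs_def by blast
    then have "r j = q b * b + (\<Sum>c\<in>E. q c * c)" using insert.hyps by simp
    then show ?thesis using q(2) unfolding lincombs_def by blast
  qed
  then obtain c s where cs: "\<And>j. j \<in> K \<Longrightarrow> c j \<in> polys W" "\<And>j. j \<in> K \<Longrightarrow> s j \<in> lincombs W E"
    "\<And>j. j \<in> K \<Longrightarrow> r j = c j * b + s j"
    by metis
  show ?case
  proof (cases "\<forall>j\<in>K. c j = 0")
    case True
    then show ?thesis using insert.IH[of K r] insert.prems insert.hyps cs by auto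
  next
    case False
    then obtain k where k: "k \<in> K" "c k \<noteq> 0" by blast
    let ?K = "K - {k}"
    \<comment> \<open>Cross-multiplication with the pivot \<open>r k\<close> eliminates the
      generator \<open>b\<close>.\<close>
    define r' where "r' j = c k * s j + (- c j) * s k" for j
    have r': "c k * r j - c j * r k = r' j" if "j \<in> K" for j
      using that k by (simp add: cs(3) r'_def algebra_simps)
    have "r' j \<in> lincombs W E" if "j \<in> ?K" for j
      using that k cs unfolding r'_def by (intro lincombs_add lincombs_mult) auto
    moreover have "card ?K > card E" using insert k by simp
    ultimately obtain a where a: "\<forall>j. a j \<in> polys W" "\<exists>j\<in>?K. a j \<noteq> 0" "(\<Sum>j\<in>?K. a j * r' j) = 0"
      using insert.IH[of ?K r'] insert.prems by auto
    \<comment> \<open>A relation among the \<open>r' j\<close> is rewritten in terms of the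
      \<open>r j\<close>: the coefficient at \<open>k\<close> collects all multiples of the pivot.
      It stays nontrivial because \<open>c k\<close> is not 0.\<close>
    define d where "d j = (if j \<in> ?K then a j * c k else if j = k then - (\<Sum>j\<in>?K. a j * c j) else 0)" for j
    have "(\<Sum>j\<in>K. d j * r j) = d k * r k + (\<Sum>j\<in>?K. d j * r j)"
      using k insert.prems by (subst sum.remove[of _ k]) auto
    also have "\<dots> = (\<Sum>j\<in>?K. a j * (c k * r j - c j * r k))"
      by (simp add: d_def sum_distrib_right right_diff_distrib sum_subtractf) (simp add: mult_ac)
    also have "\<dots> = (\<Sum>j\<in>?K. a j * r' j)" using r' by (intro sum.cong) auto
    finally have "(\<Sum>j\<in>K. d j * r j) = 0" using a(3) by simp
    moreover have "\<exists>j\<in>K. d j \<noteq> 0" using a(2) k by (auto simp: d_def)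
    moreover have "d j \<in> polys W" for j using a(1) cs(1) k by (auto simp: d_def intro!: polys_sum)
    ultimately show ?thesis by blast
  qed
qed

lemma lincombs_mult_gen:
  assumes "finite A" "x \<in> lincombs W A" "\<And>a. a \<in> A \<Longrightarrow> a * y \<in> B" "finite B"
  shows "x * y \<in> lincombs W B"
proof -
  obtain q where q: "x = (\<Sum>c\<in>A. q c * c)" "\<And>c. q c \<in> polys W"
    using assms(2) unfolding lincombs_def by blast
  have "(\<Sum>c\<in>A'. q c * (c * y)) \<in> lincombs W B" if "A' \<subseteq> A" for A'
    using that finite_subset[OF that assms(1)]
  proof (induction A' rule: infinite_finite_induct)
    case (insert c A')
    have "q c * (c * y) \<in> lincombs W B" using insert.prems assms q(2) by (intro lincombs_mult lincombs_gen) auto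
    then show ?case using insert by (auto intro: lincombs_add)
  qed (auto intro: lincombs_0)
  from this[OF order.refl] show ?thesis by (simp add: q(1) sum_distrib_right mult.assoc)
qed

lemma lincombs_sum:
  "(\<And>x. x \<in> A \<Longrightarrow> f x \<in> lincombs W B) \<Longrightarrow> (\<Sum>x\<in>A. f x) \<in> lincombs W B"
  by (induction A rule: infinite_finite_induct) (auto intro: lincombs_add lincombs_0)

text \<open>Power products of the variables in \<open>U\<close> with bounded exponents generate. The
  exponent \<open>d u\<close> is included although degrees are below it; only finiteness
  matters.\<close>

lemma reduced_polys_finitely_generated:
  fixes W :: "('y, 'd) dvar set" and d :: "('y, 'd) dvar \<Rightarrow> nat"
  assumes "finite U"
  shows "\<exists>E :: ('y, 'd, 'a::comm_ring_1) dpoly set. finite E \<and>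
    (\<forall>f\<in>polys (W \<union> U). (\<forall>u\<in>U. deg_in u f < d u) \<longrightarrow> f \<in> lincombs W E)"
  using assms
proof (induction U rule: finite_induct)
  case empty
  have "f \<in> lincombs W {1}" if "f \<in> polys W" for f :: "('y, 'd, 'a) dpoly"
    using lincombs_mult[OF lincombs_gen[of "{1}" 1] that] by simp
  then show ?case by (intro exI[of _ "{1}"]) auto
next
  case (insert u U)
  obtain E :: "('y, 'd, 'a) dpoly set" where E: "finite E"
    "\<forall>f\<in>polys (W \<union> U). (\<forall>u\<in>U. deg_in u f < d u) \<longrightarrow> f \<in> lincombs W E"
    using insert.IH by blast
  let ?E = "(\<lambda>(e, j). e * var u ^ j) ` (E \<times> {..d u})"
  have "f \<in> lincombs W ?E"
    if f: "f \<in> polys (W \<union> insert u U)" "\<And>w. w \<in> insert u U \<Longrightarrow> deg_in w f < d w" for f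
  proof -
    have "coeff_in u j f * var u ^ j \<in> lincombs W ?E" if "j \<le> d u" for j
    proof (rule lincombs_mult_gen[OF E(1)])
      show "coeff_in u j f \<in> lincombs W E"
      proof (rule E(2)[rule_format])
        show "coeff_in u j f \<in> polys (W \<union> U)" using vars_coeff_in[of u j f] f(1) by (auto simp: polys_def)
        show "deg_in w (coeff_in u j f) < d w" if "w \<in> U" for w
          using deg_in_coeff_in_le[of w u j f] f(2)[of w] that by simp
      qed
    qed (use that E in auto)
    then have "(\<Sum>j\<le>d u. coeff_in u j f * var u ^ j) \<in> lincombs W ?E" by (intro lincombs_sum) auto
    moreover have "f = (\<Sum>j\<le>d u. coeff_in u j f * var u ^ j)"
      using f(2)[of u] by (intro dpoly_eq_sum_coeff_in) auto
    ultimately show ?thesis by simp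
  qed
  then show ?case using E(1) by (intro exI[of _ ?E]) auto
qed

section \<open>Rankings and autoreduced sets\<close>

lemma dapply_0 [simp]: "dapply 0 v = v"
  by (simp add: dapply_def)

lemma dapply_neq: "\<theta> \<noteq> 0 \<Longrightarrow> dapply \<theta> v \<noteq> v"
  by (auto simp: dapply_def prod_eq_iff)

context ranking
begin

lemma le_refl: "le u u"
  using le_dapply[of u 0] by simp

lemma le_trans: "le u v \<Longrightarrow> le v w \<Longrightarrow> le u w"
proof -
  have t: "trans {(u, v). le u v}"
    using le_linear_order unfolding linear_order_on_def partial_order_on_def preorder_on_def by simp
  show "le u v \<Longrightarrow> le v w \<Longrightarrow> le u w"
    using transD[OF t, of u v w] by simp
qed

lemma le_antisym: "le u v \<Longrightarrow> le v u \<Longrightarrow> u = v"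
  using le_linear_order
  unfolding linear_order_on_def partial_order_on_def antisym_def by blast

lemma le_total: "le u v \<or> le v u"
proof (cases "u = v")
  case False
  then show ?thesis using le_linear_order unfolding linear_order_on_def total_on_def by blast
qed (simp add: le_refl)

lemma ex_greatest: "finite A \<Longrightarrow> A \<noteq> {} \<Longrightarrow> \<exists>u\<in>A. \<forall>v\<in>A. le v u"
proof (induction A rule: finite_ne_induct)
  case (insert x A)
  then obtain u where "u \<in> A" "\<forall>v\<in>A. le v u" by blast
  then show ?case using le_total[of x u] le_trans le_refl by blast
qed (auto intro: le_refl)

lemma leader_eqI: "u \<in> vars f \<Longrightarrow> (\<And>v. v \<in> vars f \<Longrightarrow> le v u) \<Longrightarrow> leader le f = u"
  unfolding leader_def using le_antisym by (intro the_equality) auto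

lemma leader_in_vars: "vars f \<noteq> {} \<Longrightarrow> leader le f \<in> vars f"
  and le_leader: "v \<in> vars f \<Longrightarrow> le v (leader le f)"
proof -
  have *: "\<exists>u. leader le f = u \<and> u \<in> vars f \<and> (\<forall>v\<in>vars f. le v u)" if "vars f \<noteq> {}"
    using ex_greatest[OF finite_vars that] leader_eqI by blast
  show "vars f \<noteq> {} \<Longrightarrow> leader le f \<in> vars f" "v \<in> vars f \<Longrightarrow> le v (leader le f)"
    using * by blast+
qed

lemma ldeg_pos: "vars f \<noteq> {} \<Longrightarrow> 0 < ldeg le f"
  using leader_in_vars[of f] unfolding ldeg_def by (metis deg_in_eq_0_iff gr0I)

lemma initial_nonzero: "vars f \<noteq> {} \<Longrightarrow> initial le f \<noteq> (0 :: ('y, 'd, 'a::comm_ring_1) dpoly)"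
  unfolding initial_def ldeg_def lead_coeff_in_eq_0_iff by auto

lemma autoreduced_list_nonconst:
  "autoreduced_list le C \<Longrightarrow> c \<in> set C \<Longrightarrow> vars c \<noteq> {}"
  unfolding autoreduced_list_def autoreduced_def by (auto simp: vars_empty_iff)

lemma autoreduced_list_reduced:
  "autoreduced_list le C \<Longrightarrow> c \<in> set C \<Longrightarrow> d \<in> set C \<Longrightarrow> c \<noteq> d \<Longrightarrow> reduced le c d"
  unfolding autoreduced_list_def autoreduced_def by auto

text \<open>Increasing rank alone would permit a repeated leader with growing degree, but then the
  later element would not be reduced with respect to the earlier one.\<close>

lemma autoreduced_list_leaders:
  assumes "autoreduced_list le C" "i < j" "j < length C"
  shows "le (leader le (C ! i)) (leader le (C ! j))" "leader le (C ! i) \<noteq> leader le (C ! j)"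
proof -
  have r: "rank_less le (C ! i) (C ! j)"
    using assms sorted_wrt_nth_less unfolding autoreduced_list_def by blast
  show "leader le (C ! i) \<noteq> leader le (C ! j)"
  proof
    assume e: "leader le (C ! i) = leader le (C ! j)"
    then have l: "ldeg le (C ! i) < ldeg le (C ! j)" using r by (simp add: rank_less_def)
    then have "reduced le (C ! j) (C ! i)" using assms by (intro autoreduced_list_reduced) auto
    then show False using l e by (simp add: reduced_def ldeg_def)
  qed
  then show "le (leader le (C ! i)) (leader le (C ! j))" using r by (auto simp: rank_less_def)
qed

lemma autoreduced_list_leader_notin:
  assumes "autoreduced_list le C" "i < j" "j < length C"
  shows "leader le (C ! j) \<notin> vars (C ! i)"
  using autoreduced_list_leaders[OF assms] le_antisym le_leader by blast

text \<open>A proper derivative of the leader of \<open>c\<close> ranks above every variable of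
  \<open>c\<close>, and proper derivatives of the other leaders are excluded by reducedness.\<close>

lemma autoreduced_list_polys:
  assumes ar: "autoreduced_list le C" and c: "c \<in> set C"
  shows "c \<in> polys (non_leaders le C \<union> leaders le C)"
proof -
  have "v \<in> non_leaders le C \<union> leaders le C" if "v \<in> vars c" for v
  proof (rule ccontr)
    assume "v \<notin> non_leaders le C \<union> leaders le C"
    then obtain \<theta> d where d: "d \<in> set C" "v = dapply \<theta> (leader le d)" "v \<notin> leaders le C"
      by (auto simp: non_leaders_def derivs_def leaders_def)
    then have "\<theta> \<noteq> 0" by (auto simp: leaders_def)
    show False
    proof (cases "c = d")
      case True
      then have "le v (leader le d)" using that le_leader by blast
      then have "v = leader le d" using le_dapply d(2) le_antisym by metis
      then show False using d by (auto simp: leaders_def)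
    next
      case False
      then show False using autoreduced_list_reduced[OF ar c d(1)] d \<open>\<theta> \<noteq> 0\<close> that by (auto simp: reduced_def)
    qed
  qed
  then show ?thesis by (auto simp: polys_def)
qed

text \<open>Appending \<open>f\<close> to the elements of \<open>C\<close> of lower rank and
  discarding the rest gives an autoreduced set in \<open>I\<close>. It is lower than
  \<open>C\<close>, either because \<open>f\<close> ranks below the first discarded element or
  because nothing was discarded and the new list is longer.\<close>

lemma char_set_not_reduced:
  assumes C: "char_set le I C" and f: "f \<in> I" "vars f \<noteq> {}"
    and red: "\<And>c. c \<in> set C \<Longrightarrow> reduced le f c"
  shows False
proof -
  have ar: "autoreduced_list le C" and CI: "set C \<subseteq> I" using C by (auto simp: char_set_def)
  define A where "A = takeWhile (\<lambda>c. rank_less le c f) C"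
  define k where "k = length A"
  have A: "A = take k C" unfolding A_def k_def by (rule takeWhile_eq_take)
  have kC: "k \<le> length C" unfolding A_def k_def by (rule length_takeWhile_le)
  have rA: "rank_less le c f" if "c \<in> set A" for c using that unfolding A_def by (auto dest: set_takeWhileD)
  have AC: "set A \<subseteq> set C" using A by (metis set_take_subset)
  have less: "le (leader le c) (leader le f)" "leader le c \<noteq> leader le f" if "c \<in> set A" for c
  proof -
    have "reduced le f c" using red that AC by auto
    then show "leader le c \<noteq> leader le f" using rA[OF that] by (auto simp: rank_less_def reduced_def ldeg_def)
    then show "le (leader le c) (leader le f)" using rA[OF that] by (auto simp: rank_less_def)
  qed
  have notin: "v \<notin> vars c" if "c \<in> set A" "le (leader le f) v" for c v
  proof
    assume "v \<in> vars c"
    then have "le v (leader le c)" by (rule le_leader)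
    then show False using less[OF that(1)] that(2) le_trans le_antisym by blast
  qed
  have "reduced le c f" if "c \<in> set A" for c
    unfolding reduced_def using notin[OF that] le_dapply le_refl[of "leader le f"] ldeg_pos[OF f(2)]
    by (metis deg_in_eq_0_iff)
  moreover have "reduced le c d" if "c \<in> set A" "d \<in> set A" "c \<noteq> d" for c d
    using autoreduced_list_reduced[OF ar] AC that by blast
  ultimately have "autoreduced le (set (A @ [f]))"
    using ar red f(2) AC unfolding autoreduced_list_def autoreduced_def vars_empty_iff
    by (auto dest: subsetD[OF AC])
  moreover have "sorted_wrt (rank_less le) (A @ [f])"
    using ar rA unfolding A by (auto simp: sorted_wrt_append autoreduced_list_def sorted_wrt_take)
  ultimately have "autoreduced_list le (A @ [f])" by (simp add: autoreduced_list_def)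
  moreover have "set (A @ [f]) \<subseteq> I" using CI AC f by auto
  moreover have "lower_rank le (A @ [f]) C"
  proof (cases "k < length C")
    case True
    have "\<not> rank_less le (C ! k) f" using True nth_length_takeWhile[of _ C] unfolding k_def A_def by blast
    moreover have "leader le f = leader le (C ! k) \<Longrightarrow> ldeg le f < ldeg le (C ! k)"
      using red[of "C ! k"] True by (simp add: reduced_def ldeg_def)
    ultimately have "rank_less le f (C ! k)"
      using le_total[of "leader le f" "leader le (C ! k)"] by (auto simp: rank_less_def)
    then show ?thesis using True unfolding lower_rank_def
      by (intro disjI1 exI[of _ k]) (auto simp: A nth_append same_rank_def)
  next
    case False
    then show ?thesis using kC unfolding lower_rank_def A by (auto simp: nth_append same_rank_def)
  qed
  ultimately show False using C by (auto simp: char_set_def)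
qed

end

section \<open>Ideals\<close>

context
  fixes J :: "'r::comm_ring_1 set"
  assumes J: "is_ideal J"
begin

lemma ideal_0: "0 \<in> J"
  and ideal_add: "a \<in> J \<Longrightarrow> b \<in> J \<Longrightarrow> a + b \<in> J"
  and ideal_mult: "a \<in> J \<Longrightarrow> r * a \<in> J"
  using J by (auto simp: is_ideal_def)

lemma ideal_uminus: "a \<in> J \<Longrightarrow> - a \<in> J"
  using ideal_mult[of a "- 1"] by simp

lemma ideal_diff: "a \<in> J \<Longrightarrow> b \<in> J \<Longrightarrow> a - b \<in> J"
  using ideal_add[of a "- b"] ideal_uminus by simp

end

lemma saturation_cancel:
  assumes "is_ideal (saturation J h)" "a dvd h" "a * f \<in> saturation J h"
  shows "f \<in> saturation J h"
proof -
  obtain b where b: "h = a * b" using assms(2) by (elim dvdE)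
  have "h * f \<in> saturation J h" using ideal_mult[OF assms(1,3), of b] by (simp add: b mult_ac)
  then obtain m where "h ^ m * (h * f) \<in> J" unfolding saturation_def by blast
  then have "h ^ Suc m * f \<in> J" by (simp add: mult_ac)
  then show ?thesis unfolding saturation_def by blast
qed

lemma initial_dvd_H_prod: "c \<in> set C \<Longrightarrow> initial le c dvd H_prod le C"
  unfolding H_prod_def by (induction C) auto

section \<open>Reduced elements of a characterizable ideal\<close>

locale chain = ranking le
  for le :: "('y::linorder, 'd::linorder) dvar \<Rightarrow> ('y, 'd) dvar \<Rightarrow> bool" +
  fixes I :: "('y, 'd, 'a::field) dpoly set" and C :: "('y, 'd, 'a) dpoly list"
  assumes ideal: "is_ideal I"
    and C: "char_set le I C"
    and proper: "1 \<notin> I"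
    and initial_cancel: "c \<in> set C \<Longrightarrow> initial le c * f \<in> I \<Longrightarrow> f \<in> I"
begin

abbreviation "N \<equiv> non_leaders le C"
abbreviation "L \<equiv> leaders le C"

lemma C_autoreduced: "autoreduced_list le C" and C_subset: "set C \<subseteq> I"
  using C by (auto simp: char_set_def)

lemma N_L_disjoint: "N \<inter> L = {}"
proof -
  have "u \<in> derivs L" if "u \<in> L" for u unfolding derivs_def using that
    by (intro CollectI exI[of _ 0] exI[of _ u]) simp
  then show ?thesis by (auto simp: non_leaders_def)
qed

lemma leader_notin_polys_N: "h \<in> polys N \<Longrightarrow> c \<in> set C \<Longrightarrow> leader le c \<notin> vars h"
  using N_L_disjoint by (auto simp: leaders_def dest: polysD)

text \<open>Inside \<open>polys (N \<union> L)\<close> the condition on derivatives in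
  \<open>reduced\<close> is thus automatic. A proper derivative of a leader is not in
  \<open>N\<close>, and if it were itself a leader, \<open>C\<close> would not be
  autoreduced.\<close>

lemma proper_deriv_notin:
  assumes "f \<in> polys (N \<union> L)" "c \<in> set C" "\<theta> \<noteq> 0"
  shows "dapply \<theta> (leader le c) \<notin> vars f"
proof
  let ?v = "dapply \<theta> (leader le c)"
  assume "?v \<in> vars f"
  then have "?v \<in> N \<union> L" using assms(1) by (rule polysD[rotated])
  moreover have "?v \<notin> N" using assms(2) unfolding non_leaders_def derivs_def leaders_def by blast
  ultimately obtain d where d: "d \<in> set C" "?v = leader le d" by (auto simp: leaders_def)
  then have "d \<noteq> c" using dapply_neq[OF assms(3)] by metis
  then have "reduced le d c" using autoreduced_list_reduced[OF C_autoreduced] d assms by auto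
  moreover have "?v \<in> vars d" using d leader_in_vars[OF autoreduced_list_nonconst[OF C_autoreduced]] by simp
  ultimately show False using assms(3) by (auto simp: reduced_def)
qed

lemma C_polys: "set C \<subseteq> polys (N \<union> L)"
  using autoreduced_list_polys[OF C_autoreduced] by blast

lemma const_in_ideal: "const x \<in> I \<Longrightarrow> x = 0"
proof (rule ccontr)
  assume "const x \<in> I" "x \<noteq> 0"
  then have "const (1 / x) * const x \<in> I" using ideal_mult[OF ideal] by blast
  then show False using proper \<open>x \<noteq> 0\<close> by (simp flip: const_mult)
qed

lemma reduced_in_ideal:
  assumes "f \<in> I" "f \<in> polys (N \<union> L)" "\<And>c. c \<in> set C \<Longrightarrow> deg_in (leader le c) f < ldeg le c"
  shows "f = 0"
proof (cases "vars f = {}")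
  case True
  then show ?thesis using const_in_ideal assms(1) by (auto simp: vars_empty_iff)
next
  case False
  have "reduced le f c" if "c \<in> set C" for c
    using assms that proper_deriv_notin by (auto simp: reduced_def)
  then show ?thesis using char_set_not_reduced[OF C assms(1) False] by blast
qed

lemma products_cancel: "M \<in> products (initial le ` set C) \<Longrightarrow> M * f \<in> I \<Longrightarrow> f \<in> I"
  by (induction M arbitrary: f rule: products.induct) (auto simp: mult.assoc intro: initial_cancel)

text \<open>Let \<open>r\<close> be the pseudo-remainder of \<open>f\<close> by \<open>C\<close>.
  Then \<open>h * r\<close> is in \<open>I\<close>, and it is still reduced since \<open>h\<close>
  contains no leader. Hence it is 0, so \<open>r\<close> is 0, and the initials cancel from
  \<open>M * f\<close>.\<close>

lemma nonleader_cancel: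
  assumes h: "h \<in> polys N" "h \<noteq> 0" and f: "f \<in> polys (N \<union> L)" and hf: "h * f \<in> I"
  shows "f \<in> I"
proof -
  have "0 < ldeg le c" if "c \<in> set (rev C)" for c
    using that ldeg_pos[OF autoreduced_list_nonconst[OF C_autoreduced]] by auto
  from pseudo_rems_ex[OF this] obtain r where r: "pseudo_rems le (rev C) f r" by blast
  have "set (rev C) \<subseteq> polys (N \<union> L)" using C_polys by simp
  from pseudo_rems_lincombs[OF r this f] obtain M where
    M: "M \<in> products (initial le ` set C)" "M * f - r \<in> lincombs (N \<union> L) (set C)" and rp: "r \<in> polys (N \<union> L)"
    by auto
  have MI: "M * f - r \<in> I" using lincombs_ideal[OF M(2) ideal C_subset] .
  have s: "sorted_wrt (\<lambda>c d. leader le c \<notin> vars d) (rev C)"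
    unfolding sorted_wrt_rev using autoreduced_list_leader_notin[OF C_autoreduced]
    by (auto simp: sorted_wrt_iff_nth_less)
  have "h * r = M * (h * f) - h * (M * f - r)" by (simp add: algebra_simps)
  then have "h * r \<in> I" using ideal_diff[OF ideal ideal_mult[OF ideal hf] ideal_mult[OF ideal MI]] by simp
  moreover have "h * r \<in> polys (N \<union> L)" using h rp polys_mono[of N "N \<union> L"] by auto
  moreover have "deg_in (leader le c) (h * r) < ldeg le c" if "c \<in> set C" for c
  proof -
    have "deg_in (leader le c) (h * r) \<le> deg_in (leader le c) r"
      by (rule deg_in_mult_free[OF leader_notin_polys_N[OF h(1) that]])
    then show ?thesis using pseudo_rems_reduced[OF r s, of c] that by simp
  qed
  ultimately have "h * r = 0" by (rule reduced_in_ideal)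
  then have "M * f \<in> I" using h MI by simp
  then show ?thesis using M products_cancel by blast
qed

end

section \<open>Evaluation at a differential point\<close>

text \<open>The index set is explicit so that several monomials can be evaluated over one common
  finite set of variables.\<close>

definition mon_eval :: "('y, 'd) dvar set \<Rightarrow> (('y, 'd) dvar \<Rightarrow> 'a) \<Rightarrow> ('y, 'd) dmon \<Rightarrow> 'a::comm_semiring_1" where
  "mon_eval A x m = (\<Prod>v\<in>A. x v ^ lkp m v)"

definition eval_at :: "(('y, 'd) dvar \<Rightarrow> 'a) \<Rightarrow> ('y, 'd, 'a::comm_ring_1) dpoly \<Rightarrow> 'a" where
  "eval_at x p = (\<Sum>m\<in>Poly_Mapping.keys p. lkp p m * mon_eval (Poly_Mapping.keys m) x m)"

lemma mon_eval_superset: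
  "finite A \<Longrightarrow> Poly_Mapping.keys m \<subseteq> A \<Longrightarrow> mon_eval (Poly_Mapping.keys m) x m = mon_eval A x m"
  unfolding mon_eval_def by (rule prod.mono_neutral_left) (auto simp: in_keys_iff)

lemma mon_eval_add:
  "mon_eval (Poly_Mapping.keys (m + m')) x (m + m') =
    mon_eval (Poly_Mapping.keys m) x m * mon_eval (Poly_Mapping.keys m') x m'"
proof -
  let ?A = "Poly_Mapping.keys m \<union> Poly_Mapping.keys m'"
  have "mon_eval ?A x (m + m') = mon_eval ?A x m * mon_eval ?A x m'"
    by (simp add: mon_eval_def lookup_add power_add prod.distrib)
  then show ?thesis
    using mon_eval_superset[of ?A "m + m'" x] mon_eval_superset[of ?A m x] mon_eval_superset[of ?A m' x]
      Poly_Mapping.keys_add[of m m'] by simp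
qed

lemma eval_at_add: "eval_at x (p + q) = eval_at x p + eval_at x q"
  unfolding eval_at_def
  by (rule setsum_keys_plus_distrib[of "\<lambda>m c. c * mon_eval (Poly_Mapping.keys m) x m"]) (auto simp: distrib_right)

lemma eval_at_single: "eval_at x (sgl m c) = c * mon_eval (Poly_Mapping.keys m) x m"
  by (simp add: eval_at_def)

lemma eval_at_0 [simp]: "eval_at x 0 = 0"
  by (simp add: eval_at_def)

lemma eval_at_mult: "eval_at x (p * q) = eval_at x p * eval_at x q"
proof (induction p rule: dpoly_induct)
  case (single m c)
  show ?case
  proof (induction q rule: dpoly_induct)
    case (single m' c')
    show ?case by (simp add: mult_single eval_at_single mon_eval_add mult_ac)
  qed (simp add: eval_at_add distrib_left)
qed (simp add: eval_at_add distrib_right)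

lemma eval_at_const [simp]: "eval_at x (const c) = c"
  by (simp add: const_def eval_at_single mon_eval_def)

lemma eval_at_1 [simp]: "eval_at x 1 = 1"
  using eval_at_const[of x 1] by simp

lemma eval_at_var [simp]: "eval_at x (var v) = x v"
  by (simp add: var_def eval_at_single mon_eval_def)

lemma eval_at_sum: "eval_at x (\<Sum>i\<in>A. f i) = (\<Sum>i\<in>A. eval_at x (f i))"
  by (induction A rule: infinite_finite_induct) (simp_all add: eval_at_add)

lemma eval_at_power: "eval_at x (p ^ n) = eval_at x p ^ n"
  by (induction n) (simp_all add: eval_at_mult)

section \<open>Evaluation and the derivations\<close>

lemma pdiff_add: "pdiff v (p + q) = pdiff v p + pdiff v q"
  unfolding pdiff_def
  by (rule setsum_keys_plus_distrib[of "\<lambda>m c. sgl (m - sgl v 1) (of_nat (lkp m v) * c)"])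
     (auto simp: distrib_left single_add)

lemma pdiff_single: "pdiff v (sgl m c) = sgl (m - sgl v 1) (of_nat (lkp m v) * c)"
  by (cases "c = 0") (simp_all add: pdiff_def)

lemma pdiff_free: "v \<notin> vars p \<Longrightarrow> pdiff v p = 0"
  unfolding pdiff_def by (rule sum.neutral) (auto simp: vars_def in_keys_iff)

context differential_field
begin

lemma der_0 [simp]: "der i 0 = 0"
  using der_add[of i 0 0] by simp

lemma der_1 [simp]: "der i 1 = 0"
  using der_mult[of i 1 1] by simp

lemma der_power: "der i (a ^ n) = of_nat n * a ^ (n - 1) * der i a"
proof (induction n)
  case (Suc n)
  have "a * a ^ (n - 1) = a ^ n" if "n > 0" using that by (cases n) auto
  then have "a * (of_nat n * a ^ (n - 1) * der i a) = of_nat n * a ^ n * der i a"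
    by (cases "n > 0") (auto simp: mult_ac)
  then show ?case by (simp add: der_mult Suc algebra_simps)
qed simp

lemma der_prod:
  "finite A \<Longrightarrow> der i (\<Prod>v\<in>A. f v) = (\<Sum>v\<in>A. der i (f v) * (\<Prod>w\<in>A - {v}. f w))"
proof (induction A rule: finite_induct)
  case (insert u A)
  have "(\<Prod>w\<in>insert u A - {v}. f w) = f u * (\<Prod>w\<in>A - {v}. f w)" if "v \<in> A" for v
  proof -
    have "insert u A - {v} = insert u (A - {v})" using that insert by auto
    then show ?thesis using insert by simp
  qed
  then have "(\<Sum>v\<in>A. der i (f v) * (\<Prod>w\<in>insert u A - {v}. f w)) = f u * (\<Sum>v\<in>A. der i (f v) * (\<Prod>w\<in>A - {v}. f w))"
    by (simp add: sum_distrib_left mult_ac)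
  moreover have "insert u A - {u} = A" using insert by auto
  ultimately show ?case using insert by (simp add: der_mult)
qed simp

lemma lookup_map_der: "lkp (Poly_Mapping.map (der i) p) m = der i (lkp p m)"
  by (simp add: Poly_Mapping.map.rep_eq when_def)

lemma dder_superset:
  assumes "finite A" "vars p \<subseteq> A"
  shows "dder der i p = Poly_Mapping.map (der i) p
    + (\<Sum>v\<in>A. pdiff v p * var (dapply (sgl i 1) v))"
  unfolding dder_def using assms
  by (intro arg_cong2[of _ _ _ _ plus] refl sum.mono_neutral_left) (auto simp: pdiff_free)

lemma dder_add: "dder der i (p + q) = dder der i p + dder der i q"
proof -
  let ?A = "vars p \<union> vars q"
  have "Poly_Mapping.map (der i) (p + q) = Poly_Mapping.map (der i) p + Poly_Mapping.map (der i) q"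
    by (rule poly_mapping_eqI) (simp add: lookup_map_der lookup_add der_add)
  then show ?thesis
    using vars_add[of p q]
    by (simp add: dder_superset[of ?A] pdiff_add distrib_right sum.distrib)
qed

text \<open>The hypothesis makes \<open>x\<close> a differential point, so evaluation commutes with
  the derivations by the product rule, monomial by monomial. Hence the polynomials vanishing at
  \<open>x\<close> form a differential ideal.\<close>

lemma eval_at_dder:
  assumes x: "\<And>v. der i (x v) = x (dapply (sgl i 1) v)"
  shows "eval_at x (dder der i p) = der i (eval_at x p)"
proof (induction p rule: dpoly_induct)
  case (single m c)
  let ?A = "Poly_Mapping.keys m"
  have map: "Poly_Mapping.map (der i) (sgl m c) = sgl m (der i c)"
    by (rule poly_mapping_eqI) (simp add: lookup_map_der lookup_single when_def)
  have "vars (sgl m c) \<subseteq> ?A" by (simp add: vars_def)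
  then have "eval_at x (dder der i (sgl m c)) = der i c * mon_eval ?A x m
      + (\<Sum>v\<in>?A. eval_at x (pdiff v (sgl m c)) * der i (x v))"
    by (subst dder_superset[of ?A]) (simp_all add: eval_at_add map eval_at_single eval_at_sum eval_at_mult x)
  also have "(\<Sum>v\<in>?A. eval_at x (pdiff v (sgl m c)) * der i (x v)) = c * der i (mon_eval ?A x m)"
    unfolding mon_eval_def der_prod[OF finite_keys] sum_distrib_left
  proof (rule sum.cong[OF refl])
    fix v assume v: "v \<in> ?A"
    have "Poly_Mapping.keys (m - sgl v 1) \<subseteq> ?A" by (auto simp: in_keys_iff lookup_minus)
    then have "eval_at x (pdiff v (sgl m c)) = of_nat (lkp m v) * c * (\<Prod>w\<in>?A. x w ^ lkp (m - sgl v 1) w)"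
      using mon_eval_superset[of ?A "m - sgl v 1" x]
      by (simp add: pdiff_single eval_at_single mon_eval_def)
    also have "(\<Prod>w\<in>?A. x w ^ lkp (m - sgl v 1) w) = x v ^ (lkp m v - 1) * (\<Prod>w\<in>?A - {v}. x w ^ lkp (m - sgl v 1) w)"
      using v by (subst prod.remove[of _ v]) (auto simp: lookup_minus)
    also have "(\<Prod>w\<in>?A - {v}. x w ^ lkp (m - sgl v 1) w) = (\<Prod>w\<in>?A - {v}. x w ^ lkp m w)"
      by (rule prod.cong) (auto simp: lookup_minus lookup_single when_def)
    finally show "eval_at x (pdiff v (sgl m c)) * der i (x v) =
        c * (der i (x v ^ lkp m v) * (\<Prod>w\<in>?A - {v}. x w ^ lkp m w))"
      by (simp add: der_power mult_ac)
  qed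
  also have "der i c * mon_eval ?A x m + c * der i (mon_eval ?A x m) = der i (eval_at x (sgl m c))"
    by (simp add: eval_at_single der_mult)
  finally show ?case .
qed (simp add: dder_add eval_at_add der_add)

lemma der_funpow_commute: "der i ((der j ^^ n) a) = (der j ^^ n) (der i a)"
  by (induction n) (simp_all add: der_commute[of i j])

text \<open>The derivative operator with exponent vector \<open>\<theta>\<close> acting on the base
  field, with the derivations applied along a list. As they commute, an additional derivation can be
  moved to its place in the list.\<close>

definition apply_op :: "'d list \<Rightarrow> ('d \<Rightarrow>\<^sub>0 nat) \<Rightarrow> 'a \<Rightarrow> 'a" where
  "apply_op js \<theta> a = foldr (\<lambda>j. der j ^^ lkp \<theta> j) js a"

lemma apply_op_notin: "i \<notin> set js \<Longrightarrow> apply_op js (sgl i 1 + \<theta>) a = apply_op js \<theta> a"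
  unfolding apply_op_def by (induction js) (auto simp: lookup_add lookup_single)

lemma der_apply_op:
  "distinct js \<Longrightarrow> i \<in> set js \<Longrightarrow> der i (apply_op js \<theta> a) = apply_op js (sgl i 1 + \<theta>) a"
proof (induction js)
  case (Cons j js)
  show ?case
  proof (cases "i = j")
    case True
    then show ?thesis using Cons.prems apply_op_notin[of i js \<theta> a]
      by (simp add: apply_op_def lookup_add)
  next
    case False
    then show ?thesis using Cons
      by (simp add: apply_op_def der_funpow_commute lookup_add lookup_single)
  qed
qed simp

lemma apply_op_0 [simp]: "apply_op js 0 a = a"
  unfolding apply_op_def by (induction js) auto

end

text \<open>If \<open>1 \<in> I\<close>, then minimality of the rank forces \<open>C\<close> to consist of polynomials
  \<open>a y + b\<close> with \<open>a\<close>, \<open>b\<close> constant, one for each \<open>y\<close>; but these have the common zero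
  \<open>y = - b / a\<close> in the base field, at which \<open>H\<close> does not vanish.\<close>

lemma saturation_proper:
  fixes der :: "'d::{finite,linorder} \<Rightarrow> 'a::field_char_0 \<Rightarrow> 'a"
    and le :: "('y::linorder, 'd) dvar \<Rightarrow> ('y, 'd) dvar \<Rightarrow> bool"
    and I :: "('y, 'd, 'a) dpoly set"
  assumes "differential_field der" "ranking le" and ideal: "is_ideal I"
    and C: "char_set le I C" and I: "I = saturation (diff_ideal_gen der (set C)) (H_prod le C)"
  shows "1 \<notin> I"
proof
  interpret differential_field der by fact
  interpret ranking le by fact
  assume "1 \<in> I"
  then have all: "f \<in> I" for f using ideal_mult[OF ideal, of 1 f] by simp
  have ar: "autoreduced_list le C" using C by (simp add: char_set_def)
  \<comment> \<open>The variable \<open>y\<close> itself lies in \<open>I\<close>, so it is not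
    reduced with respect to some element of \<open>C\<close>. Not being a proper derivative of
    anything, it must fail the degree condition, which forces leader \<open>y\<close> and degree
    1.\<close>
  have "\<exists>c\<in>set C. leader le c = (y, 0) \<and> ldeg le c = 1" for y
  proof -
    let ?f = "var (y, 0) :: ('y, 'd, 'a) dpoly"
    obtain c where c: "c \<in> set C" "\<not> reduced le ?f c"
      using char_set_not_reduced[OF C all, of ?f] by auto
    have pos: "0 < ldeg le c" using ldeg_pos[OF autoreduced_list_nonconst[OF ar c(1)]] .
    have "dapply \<theta> u \<noteq> (y, 0)" if "\<theta> \<noteq> 0" for \<theta> and u :: "('y, 'd) dvar"
    proof
      assume "dapply \<theta> u = (y, 0)"
      then have "\<theta> + snd u = 0" by (simp add: dapply_def)
      then have "lkp \<theta> i = lkp 0 i" for i by (metis add_is_0 lookup_add lookup_zero)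
      then show False using that poly_mapping_eqI by blast
    qed
    then have d: "ldeg le c \<le> deg_in (leader le c) ?f" using c(2) by (auto simp: reduced_def)
    then have "leader le c = (y, 0)" using pos by (metis deg_in_eq_0_iff singletonD vars_var le_zero_eq not_gr0)
    moreover have "deg_in (y, 0) ?f = 1" by (simp add: deg_in_eq_degree up_var)
    ultimately show ?thesis using c d pos by (intro bexI[of _ c]) auto
  qed
  then obtain c where c: "\<And>y. c y \<in> set C" "\<And>y. leader le (c y) = (y, 0)" "\<And>y. ldeg le (c y) = 1"
    by metis
  \<comment> \<open>Every variable is a derivative of the leader of some \<open>c y\<close>, so
    reducedness excludes it from all other elements of \<open>C\<close>.\<close>
  have vars_C: "d = c (fst v) \<and> snd v = 0" if d: "d \<in> set C" and v: "v \<in> vars d" for d v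
  proof -
    have e: "v = dapply (snd v) (leader le (c (fst v)))" by (simp add: c dapply_def prod_eq_iff)
    show ?thesis
    proof (cases "d = c (fst v)")
      case True
      then have "le v (leader le (c (fst v)))" using v le_leader by blast
      then have "v = leader le (c (fst v))" using e le_dapply le_antisym by metis
      then show ?thesis using True c(2)[of "fst v"] by (metis snd_conv)
    next
      case False
      then have "reduced le d (c (fst v))" using autoreduced_list_reduced[OF ar d c(1)] by blast
      then have r: "\<And>\<theta>. \<theta> \<noteq> 0 \<Longrightarrow> dapply \<theta> (fst v, 0) \<notin> vars d" "(fst v, 0) \<notin> vars d"
        by (auto simp: reduced_def c deg_in_eq_0_iff)
      have "dapply (snd v) (fst v, 0) = v" using e by (simp add: c)
      then show ?thesis using r v by (metis dapply_0)
    qed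
  qed
  have C_c: "d \<in> range c" if "d \<in> set C" for d
    using vars_C[OF that leader_in_vars[OF autoreduced_list_nonconst[OF ar that]]] by auto
  have vars_c: "vars (c y) \<subseteq> {(y, 0)}" for y
  proof
    fix v assume v: "v \<in> vars (c y)"
    from vars_C[OF c(1) v] have "c y = c (fst v)" "snd v = 0" by auto
    then have "y = fst v" by (metis c(2) fst_conv)
    then show "v \<in> {(y, 0)}" using \<open>snd v = 0\<close> by (auto simp: prod_eq_iff)
  qed
  have "coeff_in (y, 0) j (c y) \<in> range const" for y j
    using vars_c[of y] vars_coeff_in[of "(y, 0)" j "c y"] by (auto simp flip: vars_empty_iff)
  then have "\<forall>y. \<exists>a b. coeff_in (y, 0) 1 (c y) = const a \<and> coeff_in (y, 0) 0 (c y) = const b" by blast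
  then obtain a b where ab: "\<And>y. coeff_in (y, 0) 1 (c y) = const (a y)" "\<And>y. coeff_in (y, 0) 0 (c y) = const (b y)"
    by metis
  have init: "initial le (c y) = const (a y)" for y unfolding initial_def c by (rule ab)
  have a: "a y \<noteq> 0" for y
    using initial_nonzero[OF autoreduced_list_nonconst[OF ar c(1)], of y] init[of y] by auto
  have cy: "c y = const (b y) + const (a y) * var (y, 0)" for y
    using dpoly_eq_sum_coeff_in[of "(y, 0)" "c y" 1] c(2,3)[of y] ab[of y] by (simp add: ldeg_def)
  have sep: "separant le (c y) = const (a y)" for y
    unfolding separant_def c(2) by (subst cy) (simp add: pdiff_add const_def var_def mult_single pdiff_single)
  define js where "js = sorted_list_of_set (UNIV :: 'd set)"
  \<comment> \<open>The point sends \<open>y\<close> to the root \<open>- b / a\<close> and every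
    derivative of \<open>y\<close> to the corresponding derivative of that root.\<close>
  define x where "x v = apply_op js (snd v) (- b (fst v) / a (fst v))" for v
  have x: "der i (x v) = x (dapply (sgl i 1) v)" for i v
    unfolding x_def dapply_def by (simp add: der_apply_op js_def)
  have ev_c: "eval_at x d = 0" if "d \<in> set C" for d
  proof -
    obtain y where "d = c y" using C_c \<open>d \<in> set C\<close> by blast
    then show ?thesis using a[of y] by (simp add: cy eval_at_add eval_at_mult x_def)
  qed
  have "is_diff_ideal der {p. eval_at x p = 0}"
    unfolding is_diff_ideal_def is_ideal_def by (auto simp: eval_at_add eval_at_mult eval_at_dder[where x = x, OF x])
  then have K: "diff_ideal_gen der (set C) \<subseteq> {p. eval_at x p = 0}"
    unfolding diff_ideal_gen_def using ev_c by (intro Inter_lower) auto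
  obtain m where "H_prod le C ^ m * 1 \<in> diff_ideal_gen der (set C)"
    using \<open>1 \<in> I\<close> unfolding I saturation_def by blast
  then have "eval_at x (H_prod le C ^ m) = 0" using K by auto
  then have H0: "eval_at x (H_prod le C) = 0" by (auto simp: eval_at_power)
  have "eval_at x (\<Prod>c\<leftarrow>D. initial le c * separant le c) \<noteq> 0" if "set D \<subseteq> set C" for D
    using that
  proof (induction D)
    case (Cons d D)
    then obtain y where "d = c y" using C_c by fastforce
    then show ?case using Cons by (simp add: eval_at_mult init sep a)
  qed simp
  then show False using H0 unfolding H_prod_def by blast
qed

section \<open>Leading coefficients and ranks\<close>

lemma lookup_const_mult: "lkp (const x * p) m = x * lkp p (m :: ('y, 'd) dmon)"
  for p :: "('y, 'd, 'a::comm_ring_1) dpoly"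
proof -
  have "const x * p = Poly_Mapping.map ((*) x) p"
    by (simp add: const_def mult_map_scale_conv_mult)
  then show ?thesis by (simp add: Poly_Mapping.map.rep_eq when_def)
qed

lemma keys_const_mult:
  "x \<noteq> 0 \<Longrightarrow> Poly_Mapping.keys (const x * p) = Poly_Mapping.keys (p :: ('y, 'd, 'a::field) dpoly)"
  by (auto simp: in_keys_iff lookup_const_mult)

lemma vars_const_mult: "x \<noteq> 0 \<Longrightarrow> vars (const x * p) = vars (p :: ('y, 'd, 'a::field) dpoly)"
  by (simp add: vars_def keys_const_mult)

lemma deg_in_const_mult: "x \<noteq> 0 \<Longrightarrow> deg_in v (const x * p) = deg_in v (p :: ('y, 'd, 'a::field) dpoly)"
  by (simp add: deg_in_def keys_const_mult)

lemma leader_const_mult: "x \<noteq> 0 \<Longrightarrow> leader le (const x * p) = leader le (p :: ('y, 'd, 'a::field) dpoly)"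
  by (simp add: leader_def vars_const_mult)

lemma ldeg_const_mult: "x \<noteq> 0 \<Longrightarrow> ldeg le (const x * p) = ldeg le (p :: ('y, 'd, 'a::field) dpoly)"
  by (simp add: ldeg_def leader_const_mult deg_in_const_mult)

lemma initial_const_mult: "x \<noteq> 0 \<Longrightarrow> initial le (const x * p) = const x * initial le (p :: ('y, 'd, 'a::field) dpoly)"
  by (simp add: initial_def leader_const_mult ldeg_const_mult coeff_in_mult_free)

lemma lex_coeff_const_mult: "lex_coeff le (const x * p) = x * lex_coeff le (p :: ('y, 'd, 'a::field) dpoly)"
proof (cases "x = 0")
  case False
  then show ?thesis by (simp add: lex_coeff_def lead_mon_def keys_const_mult lookup_const_mult)
qed (simp add: lex_coeff_def)

context ranking
begin

section \<open>Leading monomials in the lexicographic order\<close>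

lemma lex_less_trans: "lex_less le m m' \<Longrightarrow> lex_less le m' m'' \<Longrightarrow> lex_less le m m''"
proof -
  assume "lex_less le m m'" "lex_less le m' m''"
  then obtain v v' where
    v: "lkp m v < lkp m' v" "\<And>w. le v w \<Longrightarrow> w \<noteq> v \<Longrightarrow> lkp m w = lkp m' w" and
    v': "lkp m' v' < lkp m'' v'" "\<And>w. le v' w \<Longrightarrow> w \<noteq> v' \<Longrightarrow> lkp m' w = lkp m'' w"
    unfolding lex_less_def by metis
  show ?thesis
  proof (cases "le v v'")
    case True
    have "lkp m v' < lkp m'' v'" using v v' True by (cases "v = v'") auto
    moreover have "lkp m w = lkp m'' w" if w: "le v' w" "w \<noteq> v'" for w
    proof -
      have "le v w" "w \<noteq> v" using le_trans[OF True w(1)] le_antisym[OF True] w by auto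
      then show ?thesis using v(2) v'(2) w by simp
    qed
    ultimately show ?thesis unfolding lex_less_def by blast
  next
    case False
    then have *: "le v' v" "v' \<noteq> v" using le_total[of v v'] le_refl[of v] by auto
    have "lkp m v < lkp m'' v" using v(1) v'(2)[of v] * by auto
    moreover have "lkp m w = lkp m'' w" if w: "le v w" "w \<noteq> v" for w
    proof -
      have "le v' w" "w \<noteq> v'" using le_trans[OF *(1) w(1)] le_antisym[OF *(1)] w by auto
      then show ?thesis using v(2) v'(2) w by simp
    qed
    ultimately show ?thesis unfolding lex_less_def by blast
  qed
qed

lemma lex_less_irrefl: "\<not> lex_less le m m"
  by (auto simp: lex_less_def)

lemma lex_less_total: "m \<noteq> m' \<Longrightarrow> lex_less le m m' \<or> lex_less le m' m"
proof -
  assume "m \<noteq> m'"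
  let ?A = "{v. lkp m v \<noteq> lkp m' v}"
  have "?A \<subseteq> Poly_Mapping.keys m \<union> Poly_Mapping.keys m'" by (auto simp: in_keys_iff)
  then have "finite ?A" by (rule finite_subset) simp
  moreover have "?A \<noteq> {}"
  proof
    assume "?A = {}"
    then have "m = m'" by (intro poly_mapping_eqI) auto
    then show False using \<open>m \<noteq> m'\<close> by simp
  qed
  ultimately obtain v where v: "v \<in> ?A" "\<forall>w\<in>?A. le w v" using ex_greatest by blast
  then have eq: "lkp m w = lkp m' w" if "le v w" "w \<noteq> v" for w
    using that le_antisym[OF that(1)] by blast
  consider "lkp m v < lkp m' v" | "lkp m' v < lkp m v" using v(1) by fastforce
  then show ?thesis
  proof cases
    case 1
    then have "lex_less le m m'" using eq unfolding lex_less_def by blast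
    then show ?thesis ..
  next
    case 2
    then have "lex_less le m' m" using eq[symmetric] unfolding lex_less_def by blast
    then show ?thesis ..
  qed
qed

lemma lead_mon_eqI:
  assumes "m \<in> Poly_Mapping.keys p" "\<And>m'. m' \<in> Poly_Mapping.keys p \<Longrightarrow> m' \<noteq> m \<Longrightarrow> lex_less le m' m"
  shows "lead_mon le p = m"
  unfolding lead_mon_def
proof (rule the_equality)
  fix m' assume m': "m' \<in> Poly_Mapping.keys p \<and> (\<forall>k\<in>Poly_Mapping.keys p. k \<noteq> m' \<longrightarrow> lex_less le k m')"
  show "m' = m"
  proof (rule ccontr)
    assume "m' \<noteq> m"
    then have "lex_less le m' m" "lex_less le m m'" using m' assms by auto
    then show False using lex_less_trans[of m m' m] lex_less_irrefl by simp
  qed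
qed (use assms in auto)

lemma lead_mon_greatest:
  assumes "p \<noteq> (0 :: ('y, 'd, 'a::ab_group_add) dpoly)"
  shows "lead_mon le p \<in> Poly_Mapping.keys p"
    "m \<in> Poly_Mapping.keys p \<Longrightarrow> m \<noteq> lead_mon le p \<Longrightarrow> lex_less le m (lead_mon le p)"
proof -
  have "\<exists>m\<in>A. \<forall>m'\<in>A. m' \<noteq> m \<longrightarrow> lex_less le m' m" if "finite A" "A \<noteq> {}" for A
    using that
  proof (induction A rule: finite_ne_induct)
    case (insert x A)
    then obtain m where m: "m \<in> A" "\<forall>m'\<in>A. m' \<noteq> m \<longrightarrow> lex_less le m' m" by blast
    then have "x \<noteq> m" using insert by auto
    then consider "lex_less le x m" | "lex_less le m x" using lex_less_total by blast
    then show ?case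
    proof cases
      case 1
      then show ?thesis using m by (intro bexI[of _ m]) auto
    next
      case 2
      then have "lex_less le k x" if "k \<in> A" for k
        using m that lex_less_trans[of k m x] by (cases "k = m") auto
      then show ?thesis by (intro bexI[of _ x]) auto
    qed
  qed simp
  from this[of "Poly_Mapping.keys p"] obtain k where
    k: "k \<in> Poly_Mapping.keys p" "\<And>m'. m' \<in> Poly_Mapping.keys p \<Longrightarrow> m' \<noteq> k \<Longrightarrow> lex_less le m' k"
    using assms by (metis finite_keys keys_eq_empty)
  then have "lead_mon le p = k" by (rule lead_mon_eqI)
  then show "lead_mon le p \<in> Poly_Mapping.keys p"
    "m \<in> Poly_Mapping.keys p \<Longrightarrow> m \<noteq> lead_mon le p \<Longrightarrow> lex_less le m (lead_mon le p)"
    using k by auto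
qed

lemma lex_coeff_nonzero: "p \<noteq> (0 :: ('y, 'd, 'a::ab_group_add) dpoly) \<Longrightarrow> lex_coeff le p \<noteq> 0"
  using lead_mon_greatest(1)[of p] by (simp add: lex_coeff_def in_keys_iff)

text \<open>The order compares exponents of the highest variable first, so the leading monomial of
  \<open>f\<close> is that of its initial times the top power of the leader. This links the
  normalization in \<open>step_b\<close>, which divides by \<open>lex_coeff\<close> of the whole
  polynomial, with the condition on the initial in \<open>canonical_char_set\<close>.\<close>

lemma lex_coeff_initial:
  fixes f :: "('y, 'd, 'a::comm_ring_1) dpoly"
  assumes f: "vars f \<noteq> {}"
  shows "lex_coeff le (initial le f) = lex_coeff le f"
proof -
  define u where "u = leader le f"
  define n where "n = ldeg le f"
  define m where "m = lead_mon le (initial le f)"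
  have keys: "Poly_Mapping.keys (initial le f) = {m. lkp m u = 0 \<and> m + sgl u n \<in> Poly_Mapping.keys f}"
    unfolding initial_def u_def n_def by (rule keys_coeff_in)
  have m: "m \<in> Poly_Mapping.keys (initial le f)"
    unfolding m_def using initial_nonzero[OF f] by (rule lead_mon_greatest)
  have above: "lkp k w = 0" if "k \<in> Poly_Mapping.keys f" "le u w" "w \<noteq> u" for k w
  proof (rule ccontr)
    assume "lkp k w \<noteq> 0"
    then have "w \<in> vars f" using that(1) unfolding vars_def by (auto simp: in_keys_iff)
    then have "le w u" unfolding u_def by (rule le_leader)
    then show False using le_antisym[OF that(2)] that(3) by simp
  qed
  have "lead_mon le f = m + sgl u n"
  proof (rule lead_mon_eqI)
    show mk: "m + sgl u n \<in> Poly_Mapping.keys f" using m keys by auto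
    fix k assume k: "k \<in> Poly_Mapping.keys f" "k \<noteq> m + sgl u n"
    have mu: "lkp (m + sgl u n) u = n" using m keys by (simp add: lookup_add)
    have "lkp k u \<le> deg_in u f" using k unfolding deg_in_def by (intro Max_ge) auto
    then consider "lkp k u < n" | "lkp k u = n" unfolding n_def ldeg_def u_def by linarith
    then show "lex_less le k (m + sgl u n)"
    proof cases
      case 1
      then show ?thesis unfolding lex_less_def using above[OF k(1)] above[OF mk] mu
        by (intro exI[of _ u]) auto
    next
      case 2
      define k' where "k' = k - sgl u n"
      have kk: "k = k' + sgl u n"
        by (rule poly_mapping_eqI) (use 2 in \<open>auto simp: k'_def lookup_add lookup_minus lookup_single when_def\<close>)
      then have "k' \<in> Poly_Mapping.keys (initial le f)" using k 2 by (simp add: keys lookup_add)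
      moreover have "k' \<noteq> m" using k kk by auto
      ultimately have "lex_less le k' m"
        unfolding m_def using initial_nonzero[OF f] by (intro lead_mon_greatest) auto
      then show ?thesis unfolding kk lex_less_def by (auto simp: lookup_add)
    qed
  qed
  then have "lex_coeff le f = lkp f (m + sgl u n)" by (simp add: lex_coeff_def)
  also have "\<dots> = lkp (initial le f) m"
    using m keys unfolding initial_def u_def[symmetric] n_def[symmetric] by (auto simp: lookup_coeff_in)
  finally show ?thesis by (simp add: lex_coeff_def m_def)
qed

text \<open>Neither list is lower than the other; at a first position with different ranks, or at
  the end of a shorter list, one of them would be.\<close>

lemma char_sets_same_rank:
  assumes C: "char_set le I C" and D: "char_set le I D"
  shows "length C = length D" "i < length C \<Longrightarrow> same_rank le (C ! i) (D ! i)"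
proof -
  have n: "\<not> lower_rank le C D" "\<not> lower_rank le D C" using assms by (auto simp: char_set_def)
  have same: "same_rank le (C ! i) (D ! i)" if "i < length C" "i < length D" for i
    using that
  proof (induction i rule: less_induct)
    case (less i)
    have s: "\<forall>j<i. same_rank le (C ! j) (D ! j)" using less by auto
    then have s': "\<forall>j<i. same_rank le (D ! j) (C ! j)" by (simp add: same_rank_def)
    have "\<not> rank_less le (C ! i) (D ! i)" using n(1) s less.prems unfolding lower_rank_def by blast
    moreover have "\<not> rank_less le (D ! i) (C ! i)" using n(2) s' less.prems unfolding lower_rank_def by blast
    ultimately show ?case using le_total[of "leader le (C ! i)" "leader le (D ! i)"]
      unfolding rank_less_def same_rank_def by (metis linorder_neqE_nat)
  qed
  then have same': "\<And>i. i < length C \<Longrightarrow> i < length D \<Longrightarrow> same_rank le (D ! i) (C ! i)"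
    by (auto simp: same_rank_def)
  show len: "length C = length D"
  proof (cases "length C" "length D" rule: linorder_cases)
    case less
    then have "lower_rank le D C" using same' unfolding lower_rank_def by auto
    then show ?thesis using n by simp
  next
    case greater
    then have "lower_rank le C D" using same unfolding lower_rank_def by auto
    then show ?thesis using n by simp
  qed
  show "i < length C \<Longrightarrow> same_rank le (C ! i) (D ! i)" using same len by simp
qed

end

section \<open>Step (a)\<close>

context chain
begin

abbreviation "u i \<equiv> leader le (C ! i)"
abbreviation "n i \<equiv> ldeg le (C ! i)"

text \<open>What replacements of \<open>C ! i\<close> retain throughout: its rank and its
  reducedness with respect to the other elements. Derivatives of leaders are taken care of by
  membership in \<open>polys (N \<union> L)\<close>.\<close>

definition compat :: "nat \<Rightarrow> ('y, 'd, 'a) dpoly \<Rightarrow> bool" where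
  "compat i f \<longleftrightarrow> f \<in> I \<and> f \<in> polys (N \<union> L) \<and> vars f \<noteq> {} \<and> leader le f = u i \<and> ldeg le f = n i
     \<and> (\<forall>j<length C. j \<noteq> i \<longrightarrow> deg_in (u j) f < n j)"

definition good :: "nat \<Rightarrow> ('y, 'd, 'a) dpoly \<Rightarrow> bool" where
  "good i f \<longleftrightarrow> compat i f \<and> initial le f \<in> polys N"

lemma n_pos: "i < length C \<Longrightarrow> 0 < n i"
  using ldeg_pos[OF autoreduced_list_nonconst[OF C_autoreduced]] by simp

lemma u_less: "i < j \<Longrightarrow> j < length C \<Longrightarrow> le (u i) (u j) \<and> u i \<noteq> u j"
  using autoreduced_list_leaders[OF C_autoreduced] by blast

lemma u_inj: "i < length C \<Longrightarrow> j < length C \<Longrightarrow> u i = u j \<Longrightarrow> i = j"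
  using u_less by (metis linorder_neqE_nat)

lemma u_notin_polys_N: "h \<in> polys N \<Longrightarrow> j < length C \<Longrightarrow> u j \<notin> vars h"
  using leader_notin_polys_N[of h "C ! j"] by simp

lemma polys_N_subset: "h \<in> polys N \<Longrightarrow> h \<in> polys (N \<union> L)"
  using polys_mono[of N "N \<union> L"] by auto

lemma L_eq: "L = {u j | j. j < length C}"
  by (auto simp: leaders_def set_conv_nth)

lemma reduced_in_ideal_nth:
  assumes "f \<in> I" "f \<in> polys (N \<union> L)" "\<And>j. j < length C \<Longrightarrow> deg_in (u j) f < n j"
  shows "f = 0"
  using assms(1,2) by (rule reduced_in_ideal) (use assms(3) in \<open>auto simp: in_set_conv_nth\<close>)

lemma compat_nth: "i < length C \<Longrightarrow> compat i (C ! i)"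
proof -
  assume i: "i < length C"
  have "deg_in (u j) (C ! i) < n j" if "j < length C" "j \<noteq> i" for j
  proof -
    have "C ! i \<noteq> C ! j" using that i u_inj by metis
    then have "reduced le (C ! i) (C ! j)" using autoreduced_list_reduced[OF C_autoreduced] i that by simp
    then show ?thesis by (simp add: reduced_def)
  qed
  then show ?thesis using i C_subset C_polys autoreduced_list_nonconst[OF C_autoreduced]
    by (auto simp: compat_def)
qed

lemma compat_le: "compat i f \<Longrightarrow> v \<in> vars f \<Longrightarrow> le v (u i)"
  using le_leader unfolding compat_def by metis

lemma compat_notin: "compat i f \<Longrightarrow> i < j \<Longrightarrow> j < length C \<Longrightarrow> u j \<notin> vars f"
  using compat_le u_less le_antisym by blast

lemma initial_polys_below:
  assumes "compat i f" "i < length C" "v \<in> vars (initial le f)"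
  shows "v \<in> N \<union> L" "le v (u i)" "v \<noteq> u i"
proof -
  have "v \<in> vars f - {leader le f}" using vars_initial assms(3) by blast
  then show "v \<in> N \<union> L" "le v (u i)" "v \<noteq> u i"
    using assms(1) compat_le[OF assms(1)] unfolding compat_def by (auto dest: polysD)
qed

text \<open>The variables of the first initial lie strictly below the lowest leader, so none of them
  is a leader. This is why step (a) can skip the first element.\<close>

lemma good_0: "0 < length C \<Longrightarrow> good 0 (C ! 0)"
proof -
  assume l: "0 < length C"
  have "v \<in> N" if v: "v \<in> vars (initial le (C ! 0))" for v
  proof (rule ccontr)
    assume "v \<notin> N"
    note b = initial_polys_below[OF compat_nth[OF l] l v]
    with \<open>v \<notin> N\<close> obtain j where "j < length C" "v = u j" by (auto simp: L_eq)
    then show False using b u_less[of 0 j] le_antisym by (cases "j = 0") auto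
  qed
  then show ?thesis using compat_nth[OF l] by (auto simp: good_def polys_def)
qed

end

text \<open>The situation in round \<open>i\<close> of step (a): \<open>B\<close> holds the updated
  elements before position \<open>i\<close>, all with initials in \<open>polys N\<close>.\<close>

locale processed = chain le I C
  for le :: "('y::linorder, 'd::linorder) dvar \<Rightarrow> ('y, 'd) dvar \<Rightarrow> bool"
  and I :: "('y, 'd, 'a::field) dpoly set" and C +
  fixes i :: nat and B :: "('y, 'd, 'a) dpoly list"
  assumes i: "i < length C" and length_B: "length B = i" and good_B: "j < i \<Longrightarrow> good j (B ! j)"
begin

lemma B_good: "c \<in> set B \<Longrightarrow> \<exists>j<i. c = B ! j \<and> good j c"
  using good_B length_B by (metis in_set_conv_nth)

lemma B_subset: "set B \<subseteq> I" and B_polys: "set B \<subseteq> polys (N \<union> L)"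
  using B_good by (auto simp: good_def compat_def)

lemma B_below:
  assumes "c \<in> set B" "v \<in> vars c"
  shows "v \<in> N \<union> L" "le v (u i)" "v \<noteq> u i"
proof -
  obtain j where j: "j < i" "good j c" using B_good[OF assms(1)] by blast
  then have "le v (u j)" using compat_le[of j c v] assms(2) by (simp add: good_def)
  then show "le v (u i)" "v \<noteq> u i" using u_less[OF j(1) i] le_trans le_antisym by blast+
  show "v \<in> N \<union> L" using B_polys assms by (auto dest: polysD)
qed

lemma u_notin_below:
  assumes "le v (u i)" "v \<noteq> u i" "i \<le> j" "j < length C"
  shows "v \<noteq> u j"
proof
  assume v: "v = u j"
  then have "i < j" using assms by (cases "i = j") auto
  then show False using u_less[of i j] le_antisym[of "u i" "u j"] assms v by blast
qed

lemma u_notin_B: "c \<in> set B \<Longrightarrow> i \<le> j \<Longrightarrow> j < length C \<Longrightarrow> u j \<notin> vars c"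
  using B_below u_notin_below by blast

lemma products_initials:
  assumes "M \<in> products (initial le ` set B)" "\<And>c. c \<in> set B \<Longrightarrow> c \<in> polys W"
  shows "M \<in> polys (N \<inter> W)" "M \<noteq> 0"
proof -
  have "initial le c \<in> polys (N \<inter> W) \<and> initial le c \<noteq> 0" if "c \<in> set B" for c
  proof -
    have "initial le c \<in> polys N" "initial le c \<noteq> 0"
      using B_good[OF that] initial_nonzero[of c] by (auto simp: good_def compat_def)
    moreover have "initial le c \<in> polys W" using assms(2)[OF that] by (auto simp: initial_def)
    ultimately show ?thesis by (auto simp: polys_def)
  qed
  then have "products (initial le ` set B) \<subseteq> {M. M \<in> polys (N \<inter> W) \<and> M \<noteq> 0}"
    by (intro products_subset) auto
  then show "M \<in> polys (N \<inter> W)" "M \<noteq> 0" using assms(1) by auto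
qed

lemma pseudo_rem_ex: "\<exists>r. pseudo_rem le B f r"
proof -
  have "0 < ldeg le c" if "c \<in> set (rev B)" for c
    using that B_good[of c] ldeg_pos[of c] by (metis compat_def good_def set_rev)
  then show ?thesis unfolding pseudo_rem_def by (rule pseudo_rems_ex)
qed

lemma pseudo_rem_props:
  assumes r: "pseudo_rem le B f r" and f: "f \<in> polys W" and B: "\<And>c. c \<in> set B \<Longrightarrow> c \<in> polys W"
  shows "\<exists>M. M \<in> polys (N \<inter> W) \<and> M \<noteq> 0 \<and> M * f - r \<in> lincombs W (set B)"
    "r \<in> polys W" "\<And>j. j < i \<Longrightarrow> deg_in (u j) r < n j"
    "\<And>v. (\<And>c. c \<in> set B \<Longrightarrow> v \<notin> vars c) \<Longrightarrow> deg_in v r \<le> deg_in v f"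
proof -
  have r: "pseudo_rems le (rev B) f r" using r by (simp add: pseudo_rem_def)
  have "set (rev B) \<subseteq> polys W" using B by auto
  from pseudo_rems_lincombs[OF r this f] obtain M where
    M: "M \<in> products (initial le ` set B)" "M * f - r \<in> lincombs W (set B)" and rW: "r \<in> polys W"
    by auto
  show "\<exists>M. M \<in> polys (N \<inter> W) \<and> M \<noteq> 0 \<and> M * f - r \<in> lincombs W (set B)"
    using M products_initials[OF M(1) B] by blast
  show "r \<in> polys W" by fact
  show "deg_in v r \<le> deg_in v f" if "\<And>c. c \<in> set B \<Longrightarrow> v \<notin> vars c" for v
    using pseudo_rems_deg[OF r] that by auto
  show "deg_in (u j) r < n j" if j: "j < i" for j
  proof -
    have lead: "leader le (B ! k) = u k" "ldeg le (B ! k) = n k" if "k < i" for k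
      using good_B[OF that] by (auto simp: good_def compat_def)
    have "leader le (B ! l) \<notin> vars (B ! k)" if "k < l" "l < i" for k l
      using that good_B[of k] compat_notin[of k "B ! k" l] i by (simp add: lead good_def)
    then have "sorted_wrt (\<lambda>c d. leader le c \<notin> vars d) (rev B)"
      unfolding sorted_wrt_rev by (auto simp: sorted_wrt_iff_nth_less length_B)
    from pseudo_rems_reduced[OF r this, of "B ! j"] show ?thesis
      using j length_B by (simp add: lead)
  qed
qed

text \<open>The pseudo-remainder of \<open>f\<close> by \<open>B\<close> lies in \<open>I\<close>
  and is reduced with respect to all of \<open>C\<close>, because the leaders from position
  \<open>i\<close> on do not occur. Hence it is 0, and division by the multiplier \<open>M\<close>
  from \<open>polys N\<close> gives the membership. This turns congruences modulo \<open>I\<close>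
  into the algebraic ones that \<open>is_inverse\<close> asks for.\<close>

lemma ideal_imp_fideal:
  assumes f: "f \<in> I" "f \<in> polys (N \<union> L)" and v: "\<And>j. i \<le> j \<Longrightarrow> j < length C \<Longrightarrow> u j \<notin> vars f"
  shows "Fraction_Field.Fract f 1 \<in> fideal N L B"
proof -
  obtain r where r: "pseudo_rem le B f r" using pseudo_rem_ex by blast
  note p = pseudo_rem_props[OF r f(2) subsetD[OF B_polys]]
  obtain M where M: "M \<in> polys N" "M \<noteq> 0" "M * f - r \<in> lincombs (N \<union> L) (set B)"
    using p(1) by (auto simp: polys_def)
  have MI: "M * f - r \<in> I" using lincombs_ideal[OF M(3) ideal B_subset] .
  have "r = M * f - (M * f - r)" by simp
  also have "\<dots> \<in> I" by (rule ideal_diff[OF ideal ideal_mult[OF ideal f(1)] MI])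
  finally have "r \<in> I" .
  moreover have "deg_in (u j) r < n j" if j: "j < length C" for j
  proof (cases "j < i")
    case False
    then have "deg_in (u j) r \<le> deg_in (u j) f" using u_notin_B j by (intro p(4)) auto
    also have "\<dots> = 0" using v[of j] False j by (simp add: deg_in_eq_0_iff)
    finally show ?thesis using n_pos[OF j] by simp
  qed (rule p(3))
  ultimately have "r = 0" using p(2) by (intro reduced_in_ideal_nth)
  then obtain q where q: "M * f = (\<Sum>c\<in>set B. q c * c)" "\<And>c. q c \<in> polys (N \<union> L)"
    using M(3) unfolding lincombs_def by auto
  have Fsum: "Fraction_Field.Fract (\<Sum>c\<in>A. g c) 1 = (\<Sum>c\<in>A. Fraction_Field.Fract (g c) 1)" for A and g :: "('y, 'd, 'a) dpoly \<Rightarrow> ('y, 'd, 'a) dpoly"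
  proof (induction A rule: infinite_finite_induct)
    case (insert c A)
    have "Fraction_Field.Fract (g c + (\<Sum>c\<in>A. g c)) 1 = Fraction_Field.Fract (g c) 1 + Fraction_Field.Fract (\<Sum>c\<in>A. g c) 1"
      by simp
    then show ?case using insert by (simp only: sum.insert simp_thms)
  qed (simp_all add: fract_collapse)
  have "Fraction_Field.Fract f 1 = Fraction_Field.Fract 1 M * Fraction_Field.Fract (M * f) 1" using M(2) by (simp add: eq_fract)
  also have "\<dots> = (\<Sum>c\<in>set B. Fraction_Field.Fract 1 M * Fraction_Field.Fract (q c * c) 1)" by (simp add: q(1) Fsum sum_distrib_left)
  also have "\<dots> = (\<Sum>c\<in>set B. Fraction_Field.Fract (q c) M * Fraction_Field.Fract c 1)" using M(2) by (simp add: eq_fract)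
  finally show ?thesis using q(2) M unfolding fideal_def fpolys_def
    by (intro CollectI exI[of _ "\<lambda>c. Fraction_Field.Fract (q c) M"]) auto
qed

text \<open>The common denominator lies in \<open>polys N\<close> and is cancelled modulo
  \<open>I\<close> by \<open>nonleader_cancel\<close>.\<close>

lemma fideal_imp_ideal:
  assumes f: "f \<in> polys (N \<union> L)" and fi: "Fraction_Field.Fract f 1 \<in> fideal N L B"
  shows "f \<in> I"
proof -
  obtain q where q: "Fraction_Field.Fract f 1 = (\<Sum>c\<in>set B. q c * Fraction_Field.Fract c 1)" "\<forall>c\<in>set B. q c \<in> fpolys N L"
    using fi unfolding fideal_def by blast
  have "\<exists>b y. b \<in> polys N \<and> b \<noteq> 0 \<and> y \<in> I \<and> (\<Sum>c\<in>A. q c * Fraction_Field.Fract c 1) = Fraction_Field.Fract y b" if "A \<subseteq> set B" for A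
    using that finite_subset[OF that finite_set]
  proof (induction A rule: infinite_finite_induct)
    case empty
    then show ?case using ideal_0[OF ideal] by (intro exI[of _ 1] exI[of _ 0]) (auto simp: fract_collapse)
  next
    case (insert c A)
    then obtain b y where bfrac: "b \<in> polys N" "b \<noteq> 0" "y \<in> I" "(\<Sum>c\<in>A. q c * Fraction_Field.Fract c 1) = Fraction_Field.Fract y b" by auto
    obtain s t where st: "q c = Fraction_Field.Fract s t" "t \<in> polys N" "t \<noteq> 0"
      using q(2) insert.prems unfolding fpolys_def by blast
    have "c \<in> I" using insert.prems B_subset by auto
    have "(\<Sum>c\<in>insert c A. q c * Fraction_Field.Fract c 1) = Fraction_Field.Fract ((b * s) * c + t * y) (t * b)"
      using insert.hyps bfrac st by (simp add: mult_ac)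
    moreover have "(b * s) * c + t * y \<in> I"
      using \<open>c \<in> I\<close> bfrac(3) by (intro ideal_add[OF ideal] ideal_mult[OF ideal])
    ultimately show ?case using bfrac st by (intro exI[of _ "t * b"] exI[of _ "b * s * c + t * y"]) auto
  qed auto
  from this[OF order.refl] obtain b y where "b \<in> polys N" "b \<noteq> 0" "y \<in> I" "Fraction_Field.Fract f 1 = Fraction_Field.Fract y b"
    using q(1) by auto
  moreover from this have "b * f = y" by (simp add: eq_fract mult.commute)
  ultimately show ?thesis using nonleader_cancel f by blast
qed

lemma inverse_ex:
  assumes vf: "\<And>v. v \<in> vars f \<Longrightarrow> v \<in> N \<union> L \<and> le v (u i) \<and> v \<noteq> u i"
    and cancel: "\<And>x. f * x \<in> I \<Longrightarrow> x \<in> I"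
  shows "\<exists>g. is_inverse N L B f g"
proof -
  \<comment> \<open>\<open>V\<close> contains the variables permitted in an inverse,
    \<open>W\<close> the non-leaders among them, and \<open>U\<close> the leaders below position
    \<open>i\<close>. Elimination over \<open>polys W\<close> instead of \<open>polys N\<close>
    keeps the inverse inside \<open>V\<close>.\<close>
  define V where "V = vars f \<union> (\<Union>c\<in>set B. vars c)"
  define W where "W = N \<inter> V"
  define U where "U = u ` {..<i}"
  have V: "v \<in> N \<union> L" "le v (u i)" "v \<noteq> u i" if "v \<in> V" for v
    using that vf B_below unfolding V_def by blast+
  have VWU: "V \<subseteq> W \<union> U"
  proof
    fix v assume v: "v \<in> V"
    show "v \<in> W \<union> U"
    proof (cases "v \<in> N")
      case False
      then obtain j where j: "j < length C" "v = u j" using V(1)[OF v] by (auto simp: L_eq)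
      then have "j < i" using u_notin_below[OF V(2,3)[OF v]] not_le by blast
      then show ?thesis using j by (auto simp: U_def)
    qed (use v in \<open>auto simp: W_def\<close>)
  qed
  have fV: "f \<in> polys V" and BV: "\<And>c. c \<in> set B \<Longrightarrow> c \<in> polys V" by (auto simp: V_def polys_def)
  have WN: "polys W \<subseteq> polys N" "polys W \<subseteq> polys V" and VNL: "polys V \<subseteq> polys (N \<union> L)"
    using V(1) by (auto intro!: polys_mono simp: W_def)
  define idx where "idx v = (THE j. j < i \<and> u j = v)" for v
  have idx: "idx (u j) = j" if "j < i" for j
    unfolding idx_def using that u_inj[of _ j] i by (intro the_equality) auto
  obtain E :: "('y, 'd, 'a) dpoly set" where E: "finite E"
    "\<forall>f\<in>polys (W \<union> U). (\<forall>v\<in>U. deg_in v f < n (idx v)) \<longrightarrow> f \<in> lincombs W E"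
    using reduced_polys_finitely_generated[of U W "\<lambda>v. n (idx v)"] unfolding U_def by auto
  have "\<exists>r M. r \<in> lincombs W E \<and> M \<in> polys W \<and> M \<noteq> 0 \<and> M * f ^ k - r \<in> I" for k
  proof -
    obtain r where r: "pseudo_rem le B (f ^ k) r" using pseudo_rem_ex by blast
    note p = pseudo_rem_props[OF r polys_power[OF fV] BV]
    obtain M where M: "M \<in> polys W" "M \<noteq> 0" "M * f ^ k - r \<in> lincombs V (set B)"
      using p(1) unfolding W_def by auto
    have "r \<in> lincombs W E"
    proof (rule E(2)[rule_format])
      show "r \<in> polys (W \<union> U)" using p(2) polys_mono[OF VWU] by auto
      show "deg_in v r < n (idx v)" if "v \<in> U" for v using that p(3) by (auto simp: U_def idx)
    qed
    then show ?thesis using M lincombs_ideal[OF M(3) ideal B_subset] by blast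
  qed
  then obtain r M where rM: "\<And>k. r k \<in> lincombs W E" "\<And>k. M k \<in> polys W" "\<And>k. M k \<noteq> 0"
    "\<And>k. M k * f ^ k - r k \<in> I"
    by metis
  \<comment> \<open>The powers from 0 to \<open>D\<close> are \<open>card E + 1\<close> many, one
    more than the generators.\<close>
  define D where "D = card E"
  obtain a where a: "\<And>k. a k \<in> polys W" "\<exists>k\<in>{..D}. a k \<noteq> 0" "(\<Sum>k\<le>D. a k * r k) = 0"
    using linear_dependence[of E "{..D}" r W] E(1) rM(1) by (auto simp: D_def)
  define e where "e k = a k * M k" for k
  have eW: "e k \<in> polys W" for k using a(1) rM(2) by (auto simp: e_def)
  have sumI: "(\<Sum>k\<in>A. a k * (M k * f ^ k - r k)) \<in> I" for A :: "nat set"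
    by (induction A rule: infinite_finite_induct)
       (auto intro!: ideal_add[OF ideal] ideal_mult[OF ideal] ideal_0[OF ideal] rM(4))
  have "(\<Sum>k\<le>D. e k * f ^ k) = (\<Sum>k\<le>D. a k * (M k * f ^ k - r k)) + (\<Sum>k\<le>D. a k * r k)"
    by (simp add: e_def right_diff_distrib sum_subtractf mult.assoc)
  then have eI: "(\<Sum>k\<le>D. e k * f ^ k) \<in> I" using sumI a(3) by simp
  define m where "m = (LEAST k. k \<le> D \<and> e k \<noteq> 0)"
  have ex: "\<exists>k. k \<le> D \<and> e k \<noteq> 0" using a(2) rM(3) by (auto simp: e_def)
  then have m: "m \<le> D" "e m \<noteq> 0" using LeastI_ex[OF ex] by (auto simp: m_def)
  have less: "e k = 0" if "k < m" for k
    using not_less_Least[of k "\<lambda>k. k \<le> D \<and> e k \<noteq> 0"] that m(1) unfolding m_def by auto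
  define y where "y = (\<Sum>k\<in>{m..D}. e k * f ^ (k - m))"
  have "f ^ m * y = (\<Sum>k\<in>{m..D}. e k * f ^ k)"
    unfolding y_def sum_distrib_left
    by (rule sum.cong) (auto simp: mult.left_commute simp flip: power_add)
  also have "\<dots> = (\<Sum>k\<le>D. e k * f ^ k)" using less by (intro sum.mono_neutral_left) auto
  finally have "f ^ m * y \<in> I" using eI by simp
  then have yI: "y \<in> I" by (induction m) (auto simp: mult.assoc intro: cancel)
  \<comment> \<open>Splitting off the lowest term gives \<open>y = e m - f * g\<close>, so the
    nonzero \<open>e m\<close> serves as the element \<open>h\<close> of an inverse.\<close>
  define g where "g = - (\<Sum>k\<in>{m<..D}. e k * f ^ (k - m - 1))"
  have "(\<Sum>k\<in>{m<..D}. e k * f ^ (k - m)) = f * (\<Sum>k\<in>{m<..D}. e k * f ^ (k - m - 1))"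
    unfolding sum_distrib_left
  proof (rule sum.cong[OF refl])
    fix k assume "k \<in> {m<..D}"
    then have "k - m = Suc (k - m - 1)" by auto
    then have "f ^ (k - m) = f * f ^ (k - m - 1)" by (metis power_Suc)
    then show "e k * f ^ (k - m) = f * (e k * f ^ (k - m - 1))" by (simp add: mult_ac)
  qed
  moreover have "y = e m + (\<Sum>k\<in>{m<..D}. e k * f ^ (k - m))"
    unfolding y_def using m(1) by (subst sum.head) auto
  ultimately have "y = - (f * g - e m)" by (simp add: g_def)
  then have "f * g - e m \<in> I" using ideal_uminus[OF ideal yI] by simp
  have gV: "g \<in> polys V" unfolding g_def using eW WN(2) fV by (intro polys_uminus polys_sum polys_mult polys_power) auto
  then have fgV: "f * g - e m \<in> polys V" using fV eW[of m] WN by auto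
  have "Fraction_Field.Fract (f * g - e m) 1 \<in> fideal N L B"
  proof (rule ideal_imp_fideal)
    show "u j \<notin> vars (f * g - e m)" if "i \<le> j" "j < length C" for j
      using u_notin_below[OF V(2,3) that] polysD[OF fgV] by blast
  qed (use \<open>f * g - e m \<in> I\<close> fgV VNL in auto)
  moreover have "Fraction_Field.Fract (f * g - e m) 1 = Fraction_Field.Fract (f * g) 1 - Fraction_Field.Fract (e m) 1" by simp
  ultimately have "Fraction_Field.Fract (f * g) 1 - Fraction_Field.Fract (e m) 1 \<in> fideal N L B" by (simp only:)
  moreover have "e m \<in> polys N" using eW WN(1) by blast
  ultimately have "\<exists>h\<in>polys N. h \<noteq> 0 \<and> Fraction_Field.Fract (f * g) 1 - Fraction_Field.Fract h 1 \<in> fideal N L B"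
    using m(2) by blast
  moreover have "f \<in> polys (N \<union> L)" using fV VNL by blast
  moreover have "vars g \<subseteq> vars f \<union> (\<Union>c\<in>set B. vars c)" using gV by (simp add: V_def polys_def)
  ultimately show ?thesis unfolding is_inverse_def by blast
qed

text \<open>The coefficient of the leader in \<open>r\<close> and \<open>M h\<close> are both reduced and congruent modulo \<open>I\<close>,
  hence equal.\<close>

lemma step_a_good:
  assumes f0: "compat i f0" and inv: "is_inverse N L B (initial le f0) g"
    and rem: "pseudo_rem le B (g * f0) r"
  shows "good i r"
proof -
  define f where "f = initial le f0"
  define V where "V = vars f \<union> (\<Union>c\<in>set B. vars c)"
  define W where "W = V \<union> vars f0"
  obtain h where f: "f \<in> polys (N \<union> L)" and gV: "vars g \<subseteq> V" and h: "h \<in> polys N" "h \<noteq> 0"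
    and fid: "Fraction_Field.Fract (f * g) 1 - Fraction_Field.Fract h 1 \<in> fideal N L B"
    using inv unfolding is_inverse_def f_def V_def by blast
  have V: "v \<in> N \<union> L" "le v (u i)" "v \<noteq> u i" if "v \<in> V" for v
    using that initial_polys_below[OF f0 i] B_below unfolding V_def f_def by blast+
  have f0': "f0 \<in> I" "f0 \<in> polys (N \<union> L)" "leader le f0 = u i" "ldeg le f0 = n i" "f0 \<noteq> 0"
    using f0 by (auto simp: compat_def)
  have W: "v \<in> N \<union> L" "le v (u i)" if "v \<in> W" for v
    using that V(1,2)[of v] compat_le[OF f0, of v] polysD[OF f0'(2), of v] unfolding W_def by blast+
  have gW: "g \<in> polys W" "f0 \<in> polys W" "\<And>c. c \<in> set B \<Longrightarrow> c \<in> polys W"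
    using gV by (auto simp: W_def V_def polys_def)
  have WNL: "polys W \<subseteq> polys (N \<union> L)" using W(1) by (intro polys_mono) auto
  have ug: "u i \<notin> vars g" using gV V(3) by blast
  note p = pseudo_rem_props[OF rem polys_mult[OF gW(1,2)] gW(3)]
  obtain M where M: "M \<in> polys N" "M \<noteq> 0" and Ml: "M * (g * f0) - r \<in> lincombs W (set B)"
    using p(1) by (auto simp: polys_def)
  have MI: "M * (g * f0) - r \<in> I" using lincombs_ideal[OF Ml ideal B_subset] .
  have "r = (M * g) * f0 - (M * (g * f0) - r)" by (simp add: mult.assoc)
  then have rI: "r \<in> I" using ideal_diff[OF ideal ideal_mult[OF ideal f0'(1)] MI, of "M * g"] by simp
  have rNL: "r \<in> polys (N \<union> L)" using p(2) WNL by auto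
  define \<rho> where "\<rho> = coeff_in (u i) (n i) r"
  \<comment> \<open>Neither \<open>M\<close> nor \<open>g\<close> contains \<open>u i\<close>, so
    both pass through coefficient extraction. As \<open>B\<close> avoids \<open>u i\<close> too, the
    coefficient remains a combination of \<open>B\<close> and hence lies in
    \<open>I\<close>.\<close>
  have "coeff_in (u i) (n i) (M * (g * f0) - r) = M * (g * f) - \<rho>"
    using f0' u_notin_polys_N[OF M(1) i] ug
    by (simp add: coeff_in_diff coeff_in_mult_free f_def initial_def \<rho>_def)
  then have "M * (g * f) - \<rho> \<in> I"
    using lincombs_coeff_in[OF Ml, of "u i" "n i"] lincombs_ideal[OF _ ideal B_subset] u_notin_B[OF _ order.refl i] by auto
  moreover have "f * g - h \<in> I"
    using fid f h WNL gW(1) polys_N_subset by (intro fideal_imp_ideal) auto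
  ultimately have "(M * (g * f) - \<rho>) - M * (f * g - h) \<in> I"
    using ideal_diff[OF ideal] ideal_mult[OF ideal] by blast
  then have "M * h - \<rho> \<in> I" by (simp add: algebra_simps)
  moreover have "M * h - \<rho> \<in> polys (N \<union> L)"
    using rNL polys_N_subset M h by (auto simp: \<rho>_def)
  moreover have high: "u j \<notin> vars r" if "i < j" "j < length C" for j
    using p(2) W(2) u_less[OF that] le_antisym by (meson polysD)
  have "deg_in (u j) (M * h - \<rho>) < n j" if j: "j < length C" for j
  proof (rule deg_in_diff_less)
    have "M * h \<in> polys N" using M h by auto
    then show "deg_in (u j) (M * h) < n j"
      using u_notin_polys_N[of "M * h", OF _ j] n_pos[OF j] deg_in_eq_0_iff[of "u j" "M * h"] by simp
    show "deg_in (u j) \<rho> < n j"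
    proof (cases j i rule: linorder_cases)
      case less
      then show ?thesis using p(3) deg_in_coeff_in_le[of "u j" "u i" "n i" r] by (fastforce simp: \<rho>_def)
    next
      case equal
      then have "u j \<notin> vars \<rho>" using vars_coeff_in[of "u i" "n i" r] by (auto simp: \<rho>_def)
      then have "deg_in (u j) \<rho> = 0" by (simp add: deg_in_eq_0_iff)
      then show ?thesis using n_pos[OF j] by simp
    next
      case greater
      then have "u j \<notin> vars \<rho>" using vars_coeff_in[of "u i" "n i" r] high[OF _ j] by (auto simp: \<rho>_def)
      then have "deg_in (u j) \<rho> = 0" by (simp add: deg_in_eq_0_iff)
      then show ?thesis using n_pos[OF j] by simp
    qed
  qed
  ultimately have "M * h - \<rho> = 0" by (intro reduced_in_ideal_nth)
  then have \<rho>: "\<rho> = M * h" by simp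
  have "deg_in (u i) r \<le> deg_in (u i) (g * f0)" using u_notin_B[OF _ order.refl i] by (intro p(4)) auto
  also have "\<dots> \<le> n i" using deg_in_mult_free[OF ug, of f0] f0' by (simp add: ldeg_def)
  finally have "deg_in (u i) r \<le> n i" .
  \<comment> \<open>The coefficient \<open>M * h\<close> is nonzero, so the degree in
    \<open>u i\<close> has not dropped and the rank survives.\<close>
  moreover have "n i \<le> deg_in (u i) r" using \<rho> M h by (intro le_deg_in) (auto simp: \<rho>_def)
  ultimately have deg: "deg_in (u i) r = n i" by simp
  then have ur: "u i \<in> vars r" using n_pos[OF i] deg_in_eq_0_iff[of "u i" r] by auto
  then have lead: "leader le r = u i" using p(2) W(2) by (intro leader_eqI) (auto dest: polysD)
  have "deg_in (u j) r < n j" if j: "j < length C" "j \<noteq> i" for j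
  proof (cases "j < i")
    case False
    then have "deg_in (u j) r = 0" using high[of j] j by (simp add: deg_in_eq_0_iff)
    then show ?thesis using n_pos j by simp
  qed (rule p(3))
  moreover have "initial le r = \<rho>" by (simp add: initial_def ldeg_def lead deg \<rho>_def)
  moreover have "\<rho> \<in> polys N" using \<rho> M h by auto
  ultimately show ?thesis using rI rNL ur lead deg by (auto simp: good_def compat_def ldeg_def)
qed

lemma step_a_ex:
  "\<exists>g r. is_inverse N L B (initial le (C ! i)) g \<and> pseudo_rem le B (g * C ! i) r"
proof -
  have "\<exists>g. is_inverse N L B (initial le (C ! i)) g"
    using initial_polys_below[OF compat_nth[OF i] i] i
    by (intro inverse_ex) (blast, metis initial_cancel nth_mem)
  then show ?thesis using pseudo_rem_ex by blast
qed

end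

section \<open>Step (b)\<close>

lemma dvd_onI:
  fixes a b :: "('y::linorder, 'd::linorder, 'a::field) dpoly"
  assumes "a dvd b" "b \<in> polys V"
  shows "dvd_on (polys V) a b"
proof (cases "b = 0")
  case True
  then show ?thesis by (auto simp: dvd_on_def intro!: bexI[of _ 0])
next
  case False
  obtain q where q: "b = a * q" using assms(1) by (elim dvdE)
  then have "q \<in> polys V" using polys_dvd[OF assms(2) _ False, of q] by simp
  then show ?thesis using q by (auto simp: dvd_on_def)
qed

lemma dvd_onD: "dvd_on R a b \<Longrightarrow> a dvd b"
  by (auto simp: dvd_on_def)

context chain
begin

definition primitive :: "('y, 'd, 'a) dpoly \<Rightarrow> bool" where
  "primitive f \<longleftrightarrow> (\<forall>q\<in>polys N. q dvd f \<longrightarrow> q \<in> range const)"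

definition canonical :: "nat \<Rightarrow> ('y, 'd, 'a) dpoly \<Rightarrow> bool" where
  "canonical i f \<longleftrightarrow> good i f \<and> primitive f \<and> lex_coeff le (initial le f) = 1"

text \<open>The nonzero initial is one of the coefficients, so it can play the role of
  \<open>a\<close> in \<open>ex_gcd\<close>. The gcd divides it and thus lies in
  \<open>polys N\<close>; being free of the leader, it divides \<open>f\<close> as soon as it
  divides all coefficients.\<close>

lemma step_b_ex:
  assumes f: "good i f" and i: "i < length C"
  shows "\<exists>d q. is_gcd_on (polys (N \<union> L)) {coeff_in (leader le f) j f | j. j \<le> ldeg le f} d \<and> f = d * q"
proof -
  let ?S = "{coeff_in (leader le f) j f | j. j \<le> ldeg le f}"
  have f': "f \<in> polys (N \<union> L)" "vars f \<noteq> {}" "leader le f = u i" "initial le f \<in> polys N"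
    using f by (auto simp: good_def compat_def)
  have init: "initial le f \<in> ?S" "initial le f \<noteq> 0" "initial le f \<in> polys (N \<union> L)"
    using initial_nonzero[OF f'(2)] polys_N_subset[OF f'(4)] by (auto simp: initial_def)
  have S: "?S \<subseteq> polys (N \<union> L)" using f'(1) by auto
  obtain d where d: "d dvd initial le f" "\<forall>s\<in>?S. d dvd s"
    "\<And>e. e dvd initial le f \<Longrightarrow> \<forall>s\<in>?S. e dvd s \<Longrightarrow> e dvd d"
    using ex_gcd[OF init(2), of ?S] by blast
  have dN: "d \<in> polys N" using polys_dvd[OF f'(4) d(1) init(2)] .
  have "is_gcd_on (polys (N \<union> L)) ?S d"
    unfolding is_gcd_on_def
  proof (intro conjI ballI impI)
    show "d \<in> polys (N \<union> L)" using dN by (rule polys_N_subset)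
    show "dvd_on (polys (N \<union> L)) d s" if "s \<in> ?S" for s
    proof (rule dvd_onI)
      show "d dvd s" using d(2) that by blast
      show "s \<in> polys (N \<union> L)" using S that by blast
    qed
    show "dvd_on (polys (N \<union> L)) e d" if e: "\<forall>s\<in>?S. dvd_on (polys (N \<union> L)) e s" for e
    proof (rule dvd_onI)
      have "\<forall>s\<in>?S. e dvd s" using e dvd_onD by blast
      then show "e dvd d" using d(3) init(1) by blast
    qed (rule polys_N_subset[OF dN])
  qed
  moreover have "d dvd coeff_in (u i) j f" for j
  proof (cases "j \<le> ldeg le f")
    case True
    then have "coeff_in (u i) j f \<in> ?S" using f'(3) by auto
    then show ?thesis using d(2) by blast
  next
    case False
    then show ?thesis using f'(3) by (simp add: coeff_in_eq_0 ldeg_def)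
  qed
  then have "d dvd f" using free_dvd_iff[OF u_notin_polys_N[OF dN i]] by blast
  ultimately show ?thesis unfolding dvd_def by blast
qed

text \<open>Since \<open>d\<close> divides the initial, it is a nonzero element of
  \<open>polys N\<close>: it cancels modulo \<open>I\<close> and contains no leader, so
  \<open>q\<close> is in \<open>I\<close> and has the same degrees in all leaders as
  \<open>f\<close>.\<close>

lemma step_b_canonical:
  assumes f: "good i f" and i: "i < length C"
    and gcd: "is_gcd_on (polys (N \<union> L)) {coeff_in (leader le f) j f | j. j \<le> ldeg le f} d"
    and fdq: "f = d * q"
  shows "canonical i (const (1 / lex_coeff le q) * q)"
proof -
  have f': "f \<in> I" "f \<in> polys (N \<union> L)" "vars f \<noteq> {}" "leader le f = u i" "ldeg le f = n i"
    "initial le f \<in> polys N" "\<And>j. j < length C \<Longrightarrow> j \<noteq> i \<Longrightarrow> deg_in (u j) f < n j"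
    using f by (auto simp: good_def compat_def)
  have init0: "initial le f \<noteq> 0" using initial_nonzero[OF f'(3)] .
  have "d dvd initial le f" using gcd unfolding is_gcd_on_def initial_def by (blast dest: dvd_onD)
  then have dN: "d \<in> polys N" using polys_dvd[OF f'(6) _ init0] by blast
  have nz: "f \<noteq> 0" "d \<noteq> 0" "q \<noteq> 0" using f'(3) fdq by auto
  have ud: "u j \<notin> vars d" if "j < length C" for j using u_notin_polys_N[OF dN that] .
  have coeff: "coeff_in (u i) j f = d * coeff_in (u i) j q" for j
    unfolding fdq by (rule coeff_in_mult_free[OF ud[OF i]])
  have qNL: "q \<in> polys (N \<union> L)" using polys_dvd[OF f'(2) _ nz(1), of q] fdq by simp
  have qI: "q \<in> I" using nonleader_cancel[OF dN nz(2) qNL] f'(1) fdq by simp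
  have deg: "deg_in (u j) q = deg_in (u j) f" if "j < length C" for j
    using deg_in_mult[OF nz(2,3), of "u j"] ud[OF that] by (simp add: fdq flip: deg_in_eq_0_iff)
  have uq: "u i \<in> vars q"
    using deg[OF i] n_pos[OF i] f'(4,5) deg_in_eq_0_iff[of "u i" q] by (auto simp: ldeg_def)
  have "le v (u i)" if "v \<in> vars q" for v
    using le_leader[of v f] vars_mult_eq[OF nz(2,3)] that f'(4) fdq by auto
  then have lead: "leader le q = u i" using uq by (intro leader_eqI) auto
  then have ldeg: "ldeg le q = n i" using deg[OF i] f'(4,5) by (simp add: ldeg_def)
  have init: "initial le f = d * initial le q" unfolding initial_def lead ldeg f'(4,5) by (rule coeff)
  then have "initial le q \<in> polys N" using polys_dvd[OF f'(6) _ init0] by simp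
  then have good: "good i q" using qI qNL uq lead ldeg deg f'(7) by (auto simp: good_def compat_def)
  have prim: "primitive q"
    unfolding primitive_def
  proof (intro ballI impI)
    fix t assume t: "t \<in> polys N" "t dvd q"
    \<comment> \<open>A divisor \<open>t\<close> of \<open>q\<close> in \<open>polys N\<close> makes
      \<open>d * t\<close> a common divisor of the coefficients of \<open>f\<close>, hence a divisor
      of their gcd \<open>d\<close>, and so \<open>t\<close> is a unit.\<close>
    have "dvd_on (polys (N \<union> L)) (d * t) (coeff_in (u i) j f)" for j
    proof (rule dvd_onI)
      have "t dvd coeff_in (u i) j q" using free_dvd_iff[OF u_notin_polys_N[OF t(1) i]] t(2) by blast
      then show "d * t dvd coeff_in (u i) j f" by (simp add: coeff mult_dvd_mono)
      show "coeff_in (u i) j f \<in> polys (N \<union> L)" using f'(2) by auto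
    qed
    moreover have "d * t \<in> polys (N \<union> L)" using polys_N_subset dN t(1) by blast
    ultimately have "d * t dvd d" using gcd unfolding is_gcd_on_def f'(4) by (blast dest: dvd_onD)
    then have "t dvd 1" using nz(2) by (auto elim!: dvdE)
    then show "t \<in> range const" by (simp add: is_unit_dpoly_iff)
  qed
  define x where "x = 1 / lex_coeff le q"
  have lc: "lex_coeff le q \<noteq> 0" using lex_coeff_nonzero[OF nz(3)] .
  then have x: "x \<noteq> 0" by (simp add: x_def)
  have "good i (const x * q)"
    using good x ideal_mult[OF ideal] unfolding good_def compat_def
    by (auto simp: vars_const_mult deg_in_const_mult leader_const_mult ldeg_const_mult initial_const_mult)
  moreover have "primitive (const x * q)"
    unfolding primitive_def
  proof (intro ballI impI)
    fix t assume t: "t \<in> polys N" "t dvd const x * q"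
    from t(2) have "t dvd const (1 / x) * (const x * q)" by (rule dvd_mult)
    also have "const (1 / x) * (const x * q) = q" using x by (simp flip: mult.assoc const_mult)
    finally show "t \<in> range const" using prim t(1) by (auto simp: primitive_def)
  qed
  moreover have "lex_coeff le (initial le q) = lex_coeff le q" using uq by (intro lex_coeff_initial) auto
  then have "lex_coeff le (initial le (const x * q)) = 1"
    using x lc by (simp add: initial_const_mult lex_coeff_const_mult x_def)
  ultimately show ?thesis by (simp add: canonical_def x_def)
qed

section \<open>Canonical characteristic sets\<close>

text \<open>Lower rank depends only on leaders and degrees, which \<open>D\<close> shares with
  \<open>C\<close>; so a set lower than \<open>D\<close> would also be lower than
  \<open>C\<close>.\<close>

lemma compat_char_set:
  assumes len: "length D = length C" and D: "\<And>i. i < length C \<Longrightarrow> compat i (D ! i)"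
  shows "char_set le I D" "leaders le D = L" "non_leaders le D = N"
proof -
  have lead: "leader le (D ! i) = u i" "ldeg le (D ! i) = n i" if "i < length C" for i
    using D[OF that] by (auto simp: compat_def)
  have L: "leaders le D = (\<lambda>i. leader le (D ! i)) ` {..<length C}"
    unfolding leaders_def by (auto simp: set_conv_nth len)
  also have "\<dots> = L" by (auto simp: lead L_eq)
  finally show "leaders le D = L" .
  then show "non_leaders le D = N" by (simp add: non_leaders_def)
  have "reduced le (D ! i) (D ! j)" if "i < length C" "j < length C" "i \<noteq> j" for i j
    using D[OF that(1)] that proper_deriv_notin[of "D ! i" "C ! j"]
    by (auto simp: reduced_def lead compat_def)
  moreover have "D ! i \<notin> range const" if "i < length C" for i
    using D[OF that] by (auto simp: compat_def)
  ultimately have "autoreduced le (set D)"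
    unfolding autoreduced_def set_conv_nth len by blast
  moreover have "sorted_wrt (rank_less le) D"
    unfolding sorted_wrt_iff_nth_less using u_less by (auto simp: len rank_less_def lead)
  moreover have "set D \<subseteq> I" using D unfolding set_conv_nth len by (auto simp: compat_def)
  moreover have "lower_rank le B C" if "lower_rank le B D" for B
    using that unfolding lower_rank_def same_rank_def rank_less_def len by (auto simp: lead)
  ultimately show "char_set le I D"
    using C unfolding char_set_def autoreduced_list_def by blast
qed

text \<open>Characteristic sets of \<open>I\<close> have the same ranks, hence the same leaders and
  non-leaders. The definition, which refers to the non-leaders of \<open>D\<close> itself, thus
  becomes a condition on each position relative to the fixed \<open>C\<close>.\<close>

lemma canonical_char_set_iff:
  "canonical_char_set le I D \<longleftrightarrow> length D = length C \<and> (\<forall>i<length C. canonical i (D ! i))"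
proof
  assume can: "canonical_char_set le I D"
  then have D: "char_set le I D" by (simp add: canonical_char_set_def)
  then have ar: "autoreduced_list le D" and DI: "set D \<subseteq> I" by (auto simp: char_set_def)
  have len: "length D = length C" using char_sets_same_rank(1)[OF C D] by simp
  have lead: "leader le (D ! i) = u i" "ldeg le (D ! i) = n i" if "i < length C" for i
    using char_sets_same_rank(2)[OF C D that] by (auto simp: same_rank_def)
  have L: "leaders le D = (\<lambda>i. leader le (D ! i)) ` {..<length C}"
    unfolding leaders_def by (auto simp: set_conv_nth len)
  also have "\<dots> = L" by (auto simp: lead L_eq)
  finally have L: "leaders le D = L" .
  then have N: "non_leaders le D = N" by (simp add: non_leaders_def)
  have "canonical i (D ! i)" if i: "i < length C" for i
  proof -
    have Di: "D ! i \<in> set D" using i len by simp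
    have "D ! i \<in> polys (N \<union> L)" using autoreduced_list_polys[OF ar Di] L N by simp
    moreover have "deg_in (u j) (D ! i) < n j" if j: "j < length C" "j \<noteq> i" for j
    proof -
      have "D ! i \<noteq> D ! j" using lead(1)[OF i] lead(1)[OF j(1)] u_inj[OF i j(1)] j(2) by metis
      then have "reduced le (D ! i) (D ! j)" using autoreduced_list_reduced[OF ar Di] j len by simp
      then show ?thesis using lead[OF j(1)] by (simp add: reduced_def)
    qed
    ultimately have "compat i (D ! i)"
      using DI Di autoreduced_list_nonconst[OF ar Di] lead[OF i] by (auto simp: compat_def)
    then show ?thesis using can Di N unfolding canonical_def good_def primitive_def canonical_char_set_def by auto
  qed
  then show "length D = length C \<and> (\<forall>i<length C. canonical i (D ! i))" using len by blast
next
  assume D: "length D = length C \<and> (\<forall>i<length C. canonical i (D ! i))"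
  then have cs: "char_set le I D" "non_leaders le D = N"
    using compat_char_set[of D] by (auto simp: canonical_def good_def)
  have "canonical i (D ! i)" if "i < length D" for i using D that by simp
  then have "\<exists>i. canonical i c" if "c \<in> set D" for c using that by (metis in_set_conv_nth)
  then show "canonical_char_set le I D"
    using cs unfolding canonical_char_set_def canonical_def good_def primitive_def by metis
qed

lemma canonical_unique:
  assumes i: "i < length C" and f: "canonical i f" and g: "canonical i g"
  shows "f = g"
proof -
  let ?a = "initial le g" and ?b = "initial le f"
  have f': "f \<in> I" "f \<in> polys (N \<union> L)" "vars f \<noteq> {}" "leader le f = u i" "ldeg le f = n i" "?b \<in> polys N"
    "primitive f" "lex_coeff le ?b = 1" "\<And>j. j < length C \<Longrightarrow> j \<noteq> i \<Longrightarrow> deg_in (u j) f < n j"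
    using f by (auto simp: canonical_def good_def compat_def)
  have g': "g \<in> I" "g \<in> polys (N \<union> L)" "vars g \<noteq> {}" "leader le g = u i" "ldeg le g = n i" "?a \<in> polys N"
    "primitive g" "lex_coeff le ?a = 1" "\<And>j. j < length C \<Longrightarrow> j \<noteq> i \<Longrightarrow> deg_in (u j) g < n j"
    using g by (auto simp: canonical_def good_def compat_def)
  let ?h = "?a * f - ?b * g"
  have ua: "u j \<notin> vars ?a" "u j \<notin> vars ?b" if "j < length C" for j
    using u_notin_polys_N that f'(6) g'(6) by auto
  have "?h = 0"
  proof (rule reduced_in_ideal_nth)
    show "?h \<in> I" using ideal_diff[OF ideal ideal_mult[OF ideal f'(1)] ideal_mult[OF ideal g'(1)]] .
    show "?h \<in> polys (N \<union> L)"
      using polys_N_subset[OF f'(6)] polys_N_subset[OF g'(6)] f'(2) g'(2) by (intro polys_diff polys_mult)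
    show "deg_in (u j) ?h < n j" if j: "j < length C" for j
    proof (cases "j = i")
      case False
      then show ?thesis
        using f'(9)[OF j] g'(9)[OF j] deg_in_mult_free[OF ua(1)[OF j], of f] deg_in_mult_free[OF ua(2)[OF j], of g]
        by (intro deg_in_diff_less) auto
    next
      case True
      have "deg_in (u i) f = n i" "deg_in (u i) g = n i" using f'(4,5) g'(4,5) by (auto simp: ldeg_def)
      then have le: "deg_in (u i) ?h \<le> n i"
        using deg_in_mult_free[OF ua(1)[OF i], of f] deg_in_mult_free[OF ua(2)[OF i], of g]
        by (intro deg_in_diff_le) auto
      have "coeff_in (u i) (n i) f = ?b" "coeff_in (u i) (n i) g = ?a"
        using f'(4,5) g'(4,5) by (simp_all add: initial_def)
      \<comment> \<open>The cross-multiplied top coefficients agree, so \<open>?h\<close> either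
        vanishes or has smaller degree in \<open>u i\<close>.\<close>
      then have "coeff_in (u i) (n i) ?h = 0"
        using ua[OF i] by (simp add: coeff_in_diff coeff_in_mult_free)
      then have "deg_in (u i) ?h = n i \<longrightarrow> ?h = 0" using lead_coeff_in_eq_0_iff[of "u i" ?h] by auto
      then show ?thesis using True le n_pos[OF i] by (cases "?h = 0") auto
    qed
  qed
  then have "?a * f = ?b * g" by simp
  moreover have "?a \<noteq> 0" "?b \<noteq> 0" using initial_nonzero f'(3) g'(3) by auto
  ultimately obtain x where x: "f = const x * g"
    using primitive_proportional[of ?a N ?b f g] f'(6,7) g'(6,7) by (auto simp: primitive_def)
  then have x0: "x \<noteq> 0" using f'(3) by auto
  \<comment> \<open>The initial of \<open>f\<close> is \<open>x\<close> times that of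
    \<open>g\<close>, whose leading coefficient is 1; that of \<open>f\<close> is 1 as well, so
    \<open>x\<close> is 1.\<close>
  have "x = lex_coeff le ?b"
    unfolding x using x0 by (simp add: initial_const_mult lex_coeff_const_mult g'(8))
  then show ?thesis using f'(8) x by simp
qed

end

section \<open>The algorithm\<close>

text \<open>The bound \<open>max a b\<close> covers the empty range, which arises in step (a) when
  \<open>C\<close> has at most one element.\<close>

lemma steps_upt:
  assumes "P a s" "steps R [a..<b] s t"
    and "\<And>i s t. a \<le> i \<Longrightarrow> i < b \<Longrightarrow> P i s \<Longrightarrow> R i s t \<Longrightarrow> P (Suc i) t"
  shows "P (max a b) t"
  using assms
proof (induction "b - a" arbitrary: a s)
  case (Suc k)
  then have ab: "a < b" by simp
  then obtain v where v: "R a s v" "steps R [Suc a..<b] v t"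
    using Suc.prems(2) by (auto simp: upt_conv_Cons)
  have "P (Suc a) v" using Suc.prems(3)[OF order.refl ab Suc.prems(1) v(1)] .
  from Suc.hyps(1)[OF _ this v(2) Suc.prems(3)] Suc.hyps(2) show ?case using ab by (simp add: max_def)
qed (simp add: max_def)

lemma steps_upt_ex:
  assumes "P a s"
    and "\<And>i s t. a \<le> i \<Longrightarrow> i < b \<Longrightarrow> P i s \<Longrightarrow> R i s t \<Longrightarrow> P (Suc i) t"
    and "\<And>i s. a \<le> i \<Longrightarrow> i < b \<Longrightarrow> P i s \<Longrightarrow> \<exists>t. R i s t"
  shows "\<exists>t. steps R [a..<b] s t"
  using assms
proof (induction "b - a" arbitrary: a s)
  case (Suc k)
  then have ab: "a < b" by simp
  obtain v where v: "R a s v" using Suc.prems(3)[OF order.refl ab Suc.prems(1)] by blast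
  have "P (Suc a) v" using Suc.prems(2)[OF order.refl ab Suc.prems(1) v] .
  have "\<exists>t. steps R [Suc a..<b] v t"
  proof (rule Suc.hyps(1))
    show "k = b - Suc a" using Suc.hyps(2) by simp
    show "P (Suc a) v" by fact
  qed (use Suc.prems(2,3) in auto)
  then obtain t where "steps R [Suc a..<b] v t" by blast
  then have "steps R [a..<b] s t" using v ab by (auto simp: upt_conv_Cons)
  then show ?case ..
qed auto

context chain
begin

text \<open>Elements not yet reached are required to equal those of \<open>C\<close>: the inverse in
  round \<open>i\<close> exists because the original initial is cancellable modulo
  \<open>I\<close>.\<close>

definition inv_a :: "nat \<Rightarrow> ('y, 'd, 'a) dpoly list \<Rightarrow> bool" where
  "inv_a i D \<longleftrightarrow> length D = length C \<and> (\<forall>j<length C. if j < i then good j (D ! j) else D ! j = C ! j)"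

definition inv_b :: "nat \<Rightarrow> ('y, 'd, 'a) dpoly list \<Rightarrow> bool" where
  "inv_b i D \<longleftrightarrow> length D = length C \<and> (\<forall>j<length C. if j < i then canonical j (D ! j) else good j (D ! j))"

lemma inv_a_processed:
  assumes "inv_a i D" "i < length C"
  shows "processed le I C i (take i D)" "D ! i = C ! i"
proof -
  show "processed le I C i (take i D)"
    by unfold_locales (use assms in \<open>auto simp: inv_a_def\<close>)
qed (use assms in \<open>auto simp: inv_a_def\<close>)

lemma step_a_inv:
  assumes "inv_a i D" "i < length C" "step_a le N L i D D'"
  shows "inv_a (Suc i) D'"
proof -
  interpret processed le I C i "take i D" using inv_a_processed assms by blast
  obtain g r where g: "is_inverse N L (take i D) (initial le (C ! i)) g"
    "pseudo_rem le (take i D) (g * C ! i) r" "D' = D[i := r]"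
    using assms(3) inv_a_processed(2)[OF assms(1,2)] unfolding step_a_def by auto
  have "good i r" using step_a_good[OF compat_nth[OF i] g(1,2)] .
  then show ?thesis using assms(1) i unfolding inv_a_def g(3) by (auto simp: nth_list_update less_Suc_eq)
qed

lemma step_a_total:
  assumes "inv_a i D" "i < length C"
  shows "\<exists>D'. step_a le N L i D D'"
proof -
  interpret processed le I C i "take i D" using inv_a_processed assms by blast
  show ?thesis using step_a_ex inv_a_processed(2)[OF assms] unfolding step_a_def by auto
qed

lemma step_b_inv:
  assumes "inv_b i D" "i < length C" "step_b le N L i D D'"
  shows "inv_b (Suc i) D'"
proof -
  obtain d q where dq: "is_gcd_on (polys (N \<union> L))
      {coeff_in (leader le (D ! i)) j (D ! i) | j. j \<le> ldeg le (D ! i)} d"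
    "D ! i = d * q" "D' = D[i := const (1 / lex_coeff le q) * q]"
    using assms(3) unfolding step_b_def by blast
  have "good i (D ! i)" using assms by (auto simp: inv_b_def)
  from step_b_canonical[OF this assms(2) dq(1,2)] show ?thesis
    using assms(1,2) unfolding inv_b_def dq(3) by (auto simp: nth_list_update less_Suc_eq)
qed

lemma step_b_total:
  assumes "inv_b i D" "i < length C"
  shows "\<exists>D'. step_b le N L i D D'"
proof -
  have "good i (D ! i)" using assms by (auto simp: inv_b_def)
  from step_b_ex[OF this assms(2)] show ?thesis unfolding step_b_def by blast
qed

lemma inv_a_start: "inv_a 1 C"
  using good_0 by (auto simp: inv_a_def)

lemma inv_a_imp_inv_b: "inv_a (max 1 (length C)) D \<Longrightarrow> inv_b 0 D"
  by (auto simp: inv_a_def inv_b_def)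

lemma algorithm_total: "\<exists>C'. algorithm_result le C C'"
proof -
  obtain D where D: "steps (step_a le N L) [1..<length C] C D"
    using steps_upt_ex[of inv_a 1 C "length C" "step_a le N L"] inv_a_start step_a_inv step_a_total by blast
  have "inv_b 0 D"
    using steps_upt[of inv_a 1 C "step_a le N L", OF inv_a_start D] step_a_inv inv_a_imp_inv_b by blast
  then obtain C' where "steps (step_b le N L) [0..<length C] D C'"
    using steps_upt_ex[of inv_b 0 D "length C" "step_b le N L"] step_b_inv step_b_total by blast
  then show ?thesis using D unfolding algorithm_result_def Let_def by blast
qed

lemma algorithm_canonical:
  assumes "algorithm_result le C C'"
  shows "canonical_char_set le I C'"
proof -
  obtain D where D: "steps (step_a le N L) [1..<length C] C D" "steps (step_b le N L) [0..<length C] D C'"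
    using assms unfolding algorithm_result_def Let_def by blast
  have "inv_b 0 D"
    using steps_upt[of inv_a 1 C "step_a le N L", OF inv_a_start D(1)] step_a_inv inv_a_imp_inv_b by blast
  from steps_upt[of inv_b 0 D "step_b le N L", OF this D(2)] step_b_inv
  have "inv_b (length C) C'" by auto
  then show ?thesis by (simp add: canonical_char_set_iff inv_b_def)
qed

lemma canonical_char_set_unique:
  assumes "canonical_char_set le I D" "canonical_char_set le I D'"
  shows "D = D'"
  using assms canonical_unique unfolding canonical_char_set_iff by (intro nth_equalityI) auto

end

theorem lemma2:
  fixes der :: "'d::{finite,linorder} \<Rightarrow> 'a::field_char_0 \<Rightarrow> 'a"
    and le :: "('y::{finite,linorder}, 'd) dvar \<Rightarrow> ('y, 'd) dvar \<Rightarrow> bool"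
    and I :: "('y, 'd, 'a) dpoly set"
    and C :: "('y, 'd, 'a) dpoly list"
  assumes "differential_field der"
    and "ranking le"
    and "characterizable der le I"
    and "char_set le I C"
    and "I = saturation (diff_ideal_gen der (set C)) (H_prod le C)"
  shows "(\<exists>C'. algorithm_result le C C')
    \<and> (\<forall>C'. algorithm_result le C C' \<longrightarrow> (\<forall>D. canonical_char_set le I D \<longleftrightarrow> D = C'))"
proof -
  have ideal: "is_ideal I" using assms(3) by (simp add: characterizable_def is_diff_ideal_def)
  interpret ranking le by fact
  interpret chain le I C
  proof
    show "is_ideal I" "char_set le I C" by fact+
    show "1 \<notin> I" using saturation_proper assms(1,2,4,5) ideal by blast
    show "f \<in> I" if "c \<in> set C" "initial le c * f \<in> I" for c f
      using saturation_cancel[OF _ initial_dvd_H_prod[OF that(1)], of "diff_ideal_gen der (set C)" le f]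
        ideal that(2) assms(5) by simp
  qed
  show ?thesis
    using algorithm_total algorithm_canonical canonical_char_set_unique by blast
qed

end
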